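(* For $d\ge 1$ let $C_d=[-1,1]^d\subset\mathbb{R}^d$. Consider all polytopes of the form $C_d\cap H$, where $H\subset\mathbb{R}^d$ is a linear hyperplane (i.e. a hyperplane containing the origin). The number of distinct combinatorial types among these polytopes is $2$ for $d=3$, $6$ for $d=4$, $23$ for $d=5$, $133$ for $d=6$, and $1657$ for $d=7$.
   Context: The combinatorial type of a polytope is the isomorphism class of its face lattice. A hyperplane through the origin always meets $C_d$ in a $(d-1)$-dimensional polytope. *)

theory Defs
  imports "HOL-Analysis.Analysis" "HOL-Library.Numeral_Type"
begin

definition cube :: "(real ^ 'n) set" where
  "cube = cbox (\<chi> i. - 1) (\<chi> i. 1)"

definition linear_hyperplane :: "'a::euclidean_space set \<Rightarrow> bool" where
  "linear_hyperplane H \<longleftrightarrow> (\<exists>a. a \<noteq> 0 \<and> H = {x. a \<bullet> x = 0})"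

definition central_cube_sections :: "'n::finite itself \<Rightarrow> (real ^ 'n) set set" where
  "central_cube_sections _ = {cube \<inter> H | H. linear_hyperplane H}"

text \<open>The face lattice, ordered by inclusion; it contains the improper faces \<open>{}\<close> and \<open>P\<close>.\<close>

definition face_lattice :: "'a::euclidean_space set \<Rightarrow> 'a set set" where
  "face_lattice P = {F. F face_of P}"

definition face_lattice_iso :: "'a::euclidean_space set \<Rightarrow> 'b::euclidean_space set \<Rightarrow> bool" where
  "face_lattice_iso P Q \<longleftrightarrow>
     (\<exists>f. bij_betw f (face_lattice P) (face_lattice Q) \<and>
          (\<forall>F \<in> face_lattice P. \<forall>G \<in> face_lattice P. F \<subseteq> G \<longleftrightarrow> f F \<subseteq> f G))"

text \<open>The isomorphism class is taken among the polytopes of the same ambient space, which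
  suffices to compare sections of one cube.\<close>

definition combinatorial_type :: "'a::euclidean_space set \<Rightarrow> 'a set set" where
  "combinatorial_type P = {Q. polytope Q \<and> face_lattice_iso P Q}"

end

theory Submission
  imports Defs
begin

text \<open>
  A section by \<open>a \<bullet> x = 0\<close> is determined combinatorially by the signs of \<open>a \<bullet> v\<close> at the vertices \<open>v\<close> of the cube,
  and by symmetry the weights \<open>a\<close> may be assumed nonnegative and descending. If the largest weight is at
  least the sum of the others, the section is a parallelepiped. Otherwise it has all \<open>2 d\<close> facets, and the
  facets that intersect are read off the face lattice; an isomorphism has to respect opposite facets, hence
  comes from a permutation of the coordinates up to signs, and the Chow parameters then force the sign
  patterns of two descending weights to agree. So there is one more type than there are sign patterns of
  descending weights with largest weight below the sum of the others.

  These patterns are counted by computation. Integer weights realise them, in lexicographic order. That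
  there are no others follows by choosing the signs one vertex at a time: a sign is excluded when a linear
  combination of the sign conditions made so far contradicts \<open>a\<^sub>1 \<ge> \<dots> \<ge> a\<^sub>d \<ge> 0\<close> (Farkas).
\<close>

section \<open>Faces of a central section\<close>

text \<open>The information extracted from a face lattice is which families of facets have a common
  point. For nonnegative weights, the facets on the positive sides of \<open>I\<close> meet iff the
  weight of \<open>I\<close> is at most the weight of its complement, so these data amount to a
  threshold function. The obstacle is that disjoint facets need not be opposite: two facets on the
  same side of different coordinates are disjoint as well once their weights together exceed the
  rest, so an isomorphism is not visibly a symmetry of the cube. Reflections cause little trouble,
  since among all choices of sides over \<open>I\<close> the positive one is the hardest to
  intersect. In the count, the rules only have to be sound. They bound the number of sign patterns
  from above, the listed weights bound it from below, and the two numbers coincide; that the rules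
  exclude every unrealisable sign is a consequence and needs no proof of its own.\<close>

definition cube_section :: "real ^ 'n \<Rightarrow> (real ^ 'n) set" where
  "cube_section a = cube \<inter> {x. a \<bullet> x = 0}"

definition cube_vertices :: "(real ^ 'n) set" where
  "cube_vertices = {v. \<forall>i. v $ i = 1 \<or> v $ i = - 1}"

abbreviation pm :: "bool \<Rightarrow> real" where
  "pm s \<equiv> (if s then 1 else - 1)"

definition agrees :: "('n \<times> bool) set \<Rightarrow> real ^ 'n \<Rightarrow> bool" where
  "agrees T x \<longleftrightarrow> (\<forall>(i, s) \<in> T. x $ i = pm s)"

text \<open>Faces are indexed by sets of facets of the cube, a facet being a coordinate with a side.
  The indexing is redundant: different sets can give the same face, and any set with both sides of a
  coordinate gives the empty face, so the bottom of the lattice is included.\<close>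

definition section_face :: "real ^ 'n \<Rightarrow> ('n \<times> bool) set \<Rightarrow> (real ^ 'n) set" where
  "section_face a T = {x \<in> cube_section a. agrees T x}"

lemma mem_cube: "x \<in> cube \<longleftrightarrow> (\<forall>i. \<bar>x $ i\<bar> \<le> 1)"
  by (auto simp: cube_def mem_box_cart abs_le_iff minus_le_iff)

lemma mem_cube_section: "x \<in> cube_section a \<longleftrightarrow> (\<forall>i. \<bar>x $ i\<bar> \<le> 1) \<and> a \<bullet> x = 0"
  by (simp add: cube_section_def mem_cube)

lemma finite_cube_vertices: "finite (cube_vertices :: (real ^ 'n) set)"
proof -
  have "(cube_vertices :: (real ^ 'n) set) \<subseteq> (\<lambda>f. \<chi> i. f i) ` (UNIV \<rightarrow> {1, - 1})"
  proof
    fix v :: "real ^ 'n"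
    assume "v \<in> cube_vertices"
    then have "v $ i \<in> {1, - 1}" for i
      by (auto simp: cube_vertices_def)
    moreover have "v = (\<chi> i. v $ i)"
      by (simp add: vec_eq_iff)
    ultimately show "v \<in> (\<lambda>f. \<chi> i. f i) ` (UNIV \<rightarrow> {1, - 1})"
      by (intro image_eqI[where x = "\<lambda>i. v $ i"]) auto
  qed
  moreover have "finite ((UNIV :: 'n set) \<rightarrow> {1, - 1 :: real})"
    using finite_PiE[of "UNIV :: 'n set" "\<lambda>_. {1, - 1 :: real}"] by (simp add: PiE_UNIV_domain)
  ultimately show ?thesis
    by (blast intro: finite_subset finite_imageI)
qed

lemma convex_cube: "convex (cube :: (real ^ 'n) set)"
  by (simp add: cube_def)

lemma cube_vertices_subset: "(cube_vertices :: (real ^ 'n) set) \<subseteq> cube"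
proof
  fix v :: "real ^ 'n"
  assume "v \<in> cube_vertices"
  then have "v $ i = 1 \<or> v $ i = - 1" for i
    by (simp add: cube_vertices_def)
  then have "\<bar>v $ i\<bar> \<le> 1" for i
    by (metis abs_1 abs_minus_cancel order_refl)
  then show "v \<in> cube"
    by (simp add: mem_cube)
qed

text \<open>By Krein-Milman it is enough that extreme points are vertices: if a coordinate lies
  strictly between -1 and 1, the point is the midpoint of two points of the cube that differ only
  there.\<close>

lemma cube_eq_convex_hull: "(cube :: (real ^ 'n) set) = convex hull cube_vertices"
proof
  have "x \<in> cube_vertices" if x: "x extreme_point_of (cube :: (real ^ 'n) set)" for x
  proof (rule ccontr)
    assume "x \<notin> cube_vertices"
    then obtain i where i: "x $ i \<noteq> 1" "x $ i \<noteq> - 1"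
      by (auto simp: cube_vertices_def)
    have cube: "\<bar>x $ j\<bar> \<le> 1" for j
      using x by (auto simp: extreme_point_of_def mem_cube)
    define e where "e = 1 - \<bar>x $ i\<bar>"
    have e: "e > 0"
      using i cube[of i] unfolding e_def by linarith
    have *: "x + c *\<^sub>R axis i e \<in> cube" if "\<bar>c\<bar> = 1" for c
      unfolding mem_cube
    proof
      fix j
      show "\<bar>(x + c *\<^sub>R axis i e) $ j\<bar> \<le> 1"
        using cube[of j] that e unfolding e_def by (cases "j = i") (auto simp: axis_def abs_if split: if_splits)
    qed
    have "x \<in> open_segment (x + 1 *\<^sub>R axis i e) (x + (- 1) *\<^sub>R axis i e)"
      unfolding in_segment
    proof
      show "x + 1 *\<^sub>R axis i e \<noteq> x + (- 1) *\<^sub>R axis i e"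
        using e by (auto simp: vec_eq_iff axis_def intro!: exI[of _ i])
      show "\<exists>u>0. u < 1 \<and> x = (1 - u) *\<^sub>R (x + 1 *\<^sub>R axis i e) + u *\<^sub>R (x + (- 1) *\<^sub>R axis i e)"
        by (rule exI[of _ "1 / 2"]) (simp add: vec_eq_iff field_simps)
    qed
    then show False
      using x *[of 1] *[of "- 1"] unfolding extreme_point_of_def by simp
  qed
  then have "convex hull {x. x extreme_point_of (cube :: (real ^ 'n) set)} \<subseteq> convex hull cube_vertices"
    by (intro hull_mono) auto
  moreover have "compact (cube :: (real ^ 'n) set)"
    by (simp add: cube_def)
  ultimately show "(cube :: (real ^ 'n) set) \<subseteq> convex hull cube_vertices"
    using Krein_Milman_Minkowski[OF _ convex_cube] by metis
  show "convex hull cube_vertices \<subseteq> (cube :: (real ^ 'n) set)"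
    by (intro hull_minimal cube_vertices_subset convex_cube)
qed

lemma convex_cube_section: "convex (cube_section a)"
  unfolding cube_section_def by (intro convex_Int convex_cube convex_hyperplane)

lemma polytope_cube_section: "polytope (cube_section a)"
  unfolding cube_section_def cube_def
  by (intro polytope_Int_polyhedron polytope_interval polyhedron_hyperplane)

text \<open>Each defining equation is the case of equality in a linear inequality that holds on the
  cube, so if a proper convex combination attains it, both endpoints do.\<close>

lemma section_face_face_of: "section_face a T face_of cube_section a"
proof -
  have conv: "convex (section_face a T)"
  proof (rule convexI)
    fix x y and u v :: real
    assume *: "x \<in> section_face a T" "y \<in> section_face a T" "0 \<le> u" "0 \<le> v" "u + v = 1"
    then have "u *\<^sub>R x + v *\<^sub>R y \<in> cube_section a"
      using convex_cube_section[of a] by (auto simp: section_face_def convex_def)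
    moreover have "(u *\<^sub>R x + v *\<^sub>R y) $ i = pm s" if "(i, s) \<in> T" for i s
    proof -
      have "x $ i = pm s" "y $ i = pm s"
        using * that by (auto simp: section_face_def agrees_def)
      then have "(u *\<^sub>R x + v *\<^sub>R y) $ i = (u + v) * pm s"
        by (simp add: algebra_simps)
      then show ?thesis
        using * by simp
    qed
    ultimately show "u *\<^sub>R x + v *\<^sub>R y \<in> section_face a T"
      by (auto simp: section_face_def agrees_def)
  qed
  have "x \<in> section_face a T \<and> y \<in> section_face a T"
    if xy: "x \<in> cube_section a" "y \<in> cube_section a" and z: "z \<in> section_face a T"
      "z \<in> open_segment x y" for x y z
  proof -
    obtain u where u: "0 < u" "u < 1" "z = (1 - u) *\<^sub>R x + u *\<^sub>R y"
      using z(2) by (auto simp: in_segment)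
    have "x $ i = pm s \<and> y $ i = pm s" if "(i, s) \<in> T" for i s
    proof -
      have "(1 - u) * x $ i + u * y $ i = pm s"
        using z(1) that u(3) by (auto simp: section_face_def agrees_def)
      then have "(1 - u) * (1 - pm s * x $ i) + u * (1 - pm s * y $ i) = 0"
        by (auto simp: algebra_simps split: if_splits)
      moreover have "1 - pm s * x $ i \<ge> 0" "1 - pm s * y $ i \<ge> 0"
        using xy by (auto simp: mem_cube_section abs_le_iff minus_le_iff)
      ultimately have "1 - pm s * x $ i = 0 \<and> 1 - pm s * y $ i = 0"
        using u(1,2) by (smt (verit) mult_pos_pos mult_nonneg_nonneg)
      then show ?thesis
        by (auto split: if_splits)
    qed
    then show ?thesis
      using xy by (auto simp: section_face_def agrees_def)
  qed
  moreover have "section_face a T \<subseteq> cube_section a"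
    by (simp add: section_face_def)
  ultimately show ?thesis
    using conv unfolding face_of_def by blast
qed

text \<open>A point of a face lying on as few facet hyperplanes as possible can be pushed beyond itself, away
  from any point on the same hyperplanes.\<close>

lemma face_of_cube_section_eq:
  fixes a :: "real ^ 'n"
  assumes F: "F face_of cube_section a"
  shows "F = section_face a {(i, s). \<forall>x\<in>F. x $ i = pm s}"
proof
  let ?T = "{(i, s). \<forall>x\<in>F. x $ i = pm s}"
  have sub: "F \<subseteq> cube_section a"
    using F by (rule face_of_imp_subset)
  then show "F \<subseteq> section_face a ?T"
    by (auto simp: section_face_def agrees_def)
  show "section_face a ?T \<subseteq> F"
  proof (cases "F = {}")
    case True
    \<comment> \<open>For the empty face every facet qualifies vacuously, so the index set is
      contradictory.\<close>
    have "\<not> agrees UNIV x" for x :: "real ^ 'n"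
    proof
      assume "agrees UNIV x"
      then have "x $ i = pm s" for i s
        by (auto simp: agrees_def)
      from this[of _ True] this[of _ False] show False
        by simp
    qed
    moreover have "?T = UNIV"
      using True by auto
    ultimately show ?thesis
      by (simp add: section_face_def)
  next
    case False
    \<comment> \<open>\<open>w p\<close> is a point of \<open>F\<close> off the hyperplane of
      \<open>p\<close> whenever there is one. The average \<open>z\<close> of these points is then
      off every hyperplane that does not contain all of \<open>F\<close>.\<close>
    define w where "w = (\<lambda>p :: 'n \<times> bool. SOME x. x \<in> F \<and> (p \<notin> ?T \<longrightarrow> x $ fst p \<noteq> pm (snd p)))"
    have w: "w p \<in> F \<and> (p \<notin> ?T \<longrightarrow> w p $ fst p \<noteq> pm (snd p))" for p
      unfolding w_def by (rule someI_ex) (use False in \<open>auto split: prod.splits\<close>)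
    define n where "n = real CARD('n \<times> bool)"
    have n: "n > 0"
      unfolding n_def by (simp add: card_gt_0_iff)
    define z where "z = (\<Sum>p\<in>UNIV. (1 / n) *\<^sub>R w p)"
    have zF: "z \<in> F"
      unfolding z_def using face_of_imp_convex[OF F] w n
      by (intro convex_sum) (auto simp: n_def)
    have strict: "pm s * z $ i < 1" if "(i, s) \<notin> ?T" for i s
    proof -
      have "pm s * z $ i = (\<Sum>p\<in>UNIV. pm s * (1 / n * w p $ i))"
        by (simp add: z_def sum_distrib_left)
      also have "\<dots> < (\<Sum>p\<in>(UNIV :: ('n \<times> bool) set). 1 / n)"
      proof (rule sum_strict_mono_ex1)
        have le: "pm s * w p $ i \<le> 1" for p
          using w[of p] sub by (force simp: mem_cube_section abs_le_iff minus_le_iff)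
        show "\<forall>p\<in>UNIV. pm s * (1 / n * w p $ i) \<le> 1 / n"
          using le n by (simp add: field_simps)
        have "pm s * w (i, s) $ i < 1"
          using le[of "(i, s)"] w[of "(i, s)"] that by (cases s) (auto simp: less_le)
        then show "\<exists>p\<in>UNIV. pm s * (1 / n * w p $ i) < 1 / n"
          using n by (intro bexI[of _ "(i, s)"]) (simp_all add: field_simps)
      qed simp
      also have "\<dots> = 1"
        using n by (simp add: n_def)
      finally show ?thesis .
    qed
    show ?thesis
    proof
      fix y
      assume y: "y \<in> section_face a ?T"
      show "y \<in> F"
      proof (cases "y = z")
        case True
        then show ?thesis
          using zF by simp
      next
        case False
        \<comment> \<open>Half of the least slack at \<open>z\<close>: the coordinates of
          \<open>z - y\<close> are at most 2 in absolute value, so moving beyond \<open>z\<close> by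
          the factor \<open>e\<close> uses up at most the slack. The value 1 on the index set is a
          dummy that keeps the minimum positive.\<close>
        define e where "e = Min ((\<lambda>(i, s). if (i, s) \<in> ?T then 1 else (1 - pm s * z $ i) / 2) ` UNIV)"
        have e_le: "e \<le> (1 - pm s * z $ i) / 2" if "(i, s) \<notin> ?T" for i s
        proof -
          have "e \<le> (\<lambda>(i, s). if (i, s) \<in> ?T then 1 else (1 - pm s * z $ i) / 2) (i, s)"
            unfolding e_def by (intro Min_le finite_imageI finite_class.finite_UNIV rangeI)
          also have "\<dots> = (1 - pm s * z $ i) / 2"
            unfolding prod.case using that by (rule if_not_P)
          finally show ?thesis .
        qed
        have e: "e > 0"
          unfolding e_def by (subst Min_gr_iff) (use strict in \<open>auto split: prod.splits\<close>)
        define x where "x = z + e *\<^sub>R (z - y)"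
        have y': "y \<in> cube_section a" and z': "z \<in> cube_section a"
          using y zF sub by (auto simp: section_face_def)
        have "pm s * x $ i \<le> 1" for i s
        proof (cases "(i, s) \<in> ?T")
          case True
          then have "y $ i = pm s" "z $ i = pm s"
            using y zF by (auto simp: section_face_def agrees_def)
          then show ?thesis
            by (simp add: x_def)
        next
          case False
          have "\<bar>y $ i\<bar> \<le> 1" "\<bar>z $ i\<bar> \<le> 1"
            using y' z' by (simp_all add: mem_cube_section)
          then have "pm s * (z $ i - y $ i) \<le> 2"
            by (simp add: abs_le_iff)
          then have "e * (pm s * (z $ i - y $ i)) \<le> e * 2"
            using e by (intro mult_left_mono) auto
          then show ?thesis
            using e_le[OF False] by (simp add: x_def algebra_simps)
        qed
        then have "\<bar>x $ i\<bar> \<le> 1" for i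
          using \<open>\<And>s i. pm s * x $ i \<le> 1\<close>[of True i] \<open>\<And>s i. pm s * x $ i \<le> 1\<close>[of False i]
          by (simp add: abs_le_iff)
        moreover have "a \<bullet> x = 0"
          using y' z' by (simp add: x_def mem_cube_section inner_simps)
        ultimately have x': "x \<in> cube_section a"
          by (simp add: mem_cube_section)
        have "z \<in> open_segment y x"
          unfolding in_segment
        proof
          show "y \<noteq> x"
          proof
            assume "y = x"
            then have "(1 + e) *\<^sub>R (z - y) = 0"
              by (simp add: x_def algebra_simps)
            then show False
              using False e by simp
          qed
          have "1 - 1 / (1 + e) = e / (1 + e)"
            using e by (simp add: field_simps)
          then have "(1 - 1 / (1 + e)) *\<^sub>R y + (1 / (1 + e)) *\<^sub>R x = (1 / (1 + e)) *\<^sub>R (e *\<^sub>R y + x)"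
            by (simp add: scaleR_add_right)
          also have "e *\<^sub>R y + x = (1 + e) *\<^sub>R z"
            by (simp add: x_def algebra_simps)
          finally have "z = (1 - 1 / (1 + e)) *\<^sub>R y + (1 / (1 + e)) *\<^sub>R x"
            using e by simp
          then show "\<exists>u>0. u < 1 \<and> z = (1 - u) *\<^sub>R y + u *\<^sub>R x"
            using e by (intro exI[of _ "1 / (1 + e)"]) (auto simp: field_simps)
        qed
        then show ?thesis
          using F y' x' zF unfolding face_of_def by blast
      qed
    qed
  qed
qed

lemma face_lattice_cube_section: "face_lattice (cube_section a) = range (section_face a)"
  unfolding face_lattice_def using section_face_face_of face_of_cube_section_eq by fastforce

text \<open>The vertices that can occur with positive weight in a convex combination lying in the section.\<close>

definition spanning_vertices :: "real ^ 'n \<Rightarrow> ('n \<times> bool) set \<Rightarrow> (real ^ 'n) set" where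
  "spanning_vertices a T = {v \<in> cube_vertices. agrees T v \<and>
     (\<exists>w \<in> cube_vertices. agrees T w \<and> sgn (a \<bullet> w) = - sgn (a \<bullet> v))}"

text \<open>A point of the face is a convex combination of cube vertices agreeing with
  \<open>T\<close>, and those of positive weight are spanning: without a vertex of opposite sign,
  all terms of \<open>a \<bullet> x = 0\<close> would have one sign. Conversely every spanning
  vertex occurs in such a combination. Inclusion of faces is thus expressed by the signs of
  \<open>a \<bullet> v\<close> alone.\<close>

lemma section_face_subset_iff:
  fixes a :: "real ^ 'n"
  shows
  "section_face a T \<subseteq> section_face a U \<longleftrightarrow> (\<forall>v \<in> spanning_vertices a T. agrees U v)"
proof
  assume sub: "section_face a T \<subseteq> section_face a U"
  show "\<forall>v \<in> spanning_vertices a T. agrees U v"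
  proof
    fix v
    assume "v \<in> spanning_vertices a T"
    then obtain w where v: "v \<in> cube_vertices" "agrees T v" and w: "w \<in> cube_vertices" "agrees T w"
      and vw: "sgn (a \<bullet> w) = - sgn (a \<bullet> v)"
      by (auto simp: spanning_vertices_def)
    show "agrees U v"
    proof (cases "a \<bullet> v = 0")
      case True
      then have "v \<in> section_face a T"
        using v cube_vertices_subset by (auto simp: section_face_def cube_section_def)
      then show ?thesis
        using sub by (auto simp: section_face_def)
    next
      case False
      define p q where "p = \<bar>a \<bullet> w\<bar>" and "q = \<bar>a \<bullet> v\<bar>"
      have pq: "p > 0" "q > 0"
        using False vw unfolding p_def q_def by (auto simp: sgn_if split: if_splits)
      \<comment> \<open>The point where the segment from \<open>v\<close> to \<open>w\<close>
        crosses the hyperplane: each endpoint is weighted with the absolute value at the other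
        one.\<close>
      define x where "x = (p / (p + q)) *\<^sub>R v + (q / (p + q)) *\<^sub>R w"
      have "p * (a \<bullet> v) + q * (a \<bullet> w) = 0"
        using False vw unfolding p_def q_def by (auto simp: sgn_if abs_if split: if_splits)
      then have "a \<bullet> x = 0"
        using pq by (simp add: x_def inner_simps add_divide_distrib[symmetric])
      moreover have "x \<in> cube"
        unfolding x_def using v w cube_vertices_subset pq
        by (intro convexD[OF convex_cube]) (auto simp: add_divide_distrib[symmetric])
      moreover have "agrees T x"
        unfolding agrees_def
      proof safe
        fix i s
        assume "(i, s) \<in> T"
        then have "v $ i = pm s" "w $ i = pm s"
          using v(2) w(2) by (auto simp: agrees_def)
        then have "x $ i = (p / (p + q) + q / (p + q)) * pm s"
          by (simp add: x_def distrib_right)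
        then show "x $ i = pm s"
          using pq by (simp add: add_divide_distrib[symmetric])
      qed
      ultimately have "x \<in> section_face a U"
        using sub by (auto simp: section_face_def cube_section_def)
      then have x: "agrees U x"
        by (simp add: section_face_def)
      have "v $ i = pm s" if "(i, s) \<in> U" for i s
      proof -
        have "x $ i = pm s"
          using x that by (auto simp: agrees_def)
        \<comment> \<open>A proper average of two signs is 1 or -1 only if both signs equal
          it.\<close>
        then have "p * v $ i + q * w $ i = (p + q) * pm s"
          using pq by (simp add: x_def add_divide_distrib[symmetric] divide_eq_eq algebra_simps)
        moreover have "v $ i = 1 \<or> v $ i = - 1" "w $ i = 1 \<or> w $ i = - 1"
          using v w by (auto simp: cube_vertices_def)
        ultimately show ?thesis
          using pq by (auto split: if_splits)
      qed
      then show ?thesis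
        by (auto simp: agrees_def)
    qed
  qed
next
  assume *: "\<forall>v \<in> spanning_vertices a T. agrees U v"
  show "section_face a T \<subseteq> section_face a U"
  proof
    fix x
    assume x: "x \<in> section_face a T"
    then have "x \<in> convex hull cube_vertices" and ax: "a \<bullet> x = 0" and xT: "agrees T x"
      by (auto simp: section_face_def cube_section_def cube_eq_convex_hull)
    then obtain u where u: "\<And>v. v \<in> cube_vertices \<Longrightarrow> 0 \<le> u v" "sum u cube_vertices = 1"
      "(\<Sum>v\<in>cube_vertices. u v *\<^sub>R v) = x"
      unfolding convex_hull_finite[OF finite_cube_vertices] by blast
    have fin: "finite (cube_vertices :: (real ^ 'n) set)"
      by (rule finite_cube_vertices)
    have agr: "agrees T v" if v: "v \<in> cube_vertices" "u v > 0" for v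
      unfolding agrees_def
    proof safe
      fix i s
      assume "(i, s) \<in> T"
      then have "x $ i = pm s"
        using xT by (auto simp: agrees_def)
      \<comment> \<open>The slack of \<open>x\<close> is a weighted sum of the nonnegative slacks of
        the vertices, so each vertex of positive weight has slack 0.\<close>
      then have "(\<Sum>v\<in>cube_vertices. u v * (1 - pm s * v $ i)) = 0"
        using u(2) unfolding u(3)[symmetric]
        by (auto simp: algebra_simps sum.distrib sum_subtractf sum_negf split: if_splits)
      moreover have "u v * (1 - pm s * v $ i) \<ge> 0" if "v \<in> cube_vertices" for v
      proof -
        have "v $ i = 1 \<or> v $ i = - 1"
          using that by (simp add: cube_vertices_def)
        then show ?thesis
          using u(1)[OF that] by auto
      qed
      ultimately have "u v * (1 - pm s * v $ i) = 0"
        using sum_nonneg_eq_0_iff[OF fin, of "\<lambda>v. u v * (1 - pm s * v $ i)"] v(1) by auto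
      then show "v $ i = pm s"
        using v(2) by (auto split: if_splits)
    qed
    have span: "v \<in> spanning_vertices a T" if v: "v \<in> cube_vertices" "u v > 0" for v
    proof -
      have "\<exists>w \<in> cube_vertices. agrees T w \<and> sgn (a \<bullet> w) = - sgn (a \<bullet> v)"
      proof (rule ccontr)
        assume neg: "\<not> ?thesis"
        have le: "u w * (sgn (a \<bullet> v) * (a \<bullet> w)) \<ge> 0" if "w \<in> cube_vertices" for w
        proof (cases "u w = 0")
          case False
          then have "agrees T w" "u w > 0"
            using agr[OF that] u(1)[OF that] by auto
          moreover have "sgn (a \<bullet> v) * (a \<bullet> w) \<ge> 0"
            using neg that \<open>agrees T w\<close> by (auto simp: sgn_if split: if_splits)
          ultimately show ?thesis
            by simp
        qed simp
        have "(\<Sum>w\<in>cube_vertices. u w * (sgn (a \<bullet> v) * (a \<bullet> w))) = sgn (a \<bullet> v) * (a \<bullet> x)"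
          unfolding u(3)[symmetric] by (simp add: inner_sum_right sum_distrib_left ac_simps)
        then have "u v * (sgn (a \<bullet> v) * (a \<bullet> v)) = 0"
          using sum_nonneg_eq_0_iff[OF fin, of "\<lambda>w. u w * (sgn (a \<bullet> v) * (a \<bullet> w))"] le v(1) ax by auto
        then have "a \<bullet> v = 0"
          using v(2) by (auto simp: sgn_zero_iff)
        then show False
          using neg v(1) agr[OF v] by auto
      qed
      then show ?thesis
        using v agr by (auto simp: spanning_vertices_def)
    qed
    have "x $ i = pm s" if U: "(i, s) \<in> U" for i s
    proof -
      have "u v * v $ i = u v * pm s" if "v \<in> cube_vertices" for v
      proof (cases "u v = 0")
        case False
        then have "agrees U v"
          using * span[OF that] u(1)[OF that] by auto
        then show ?thesis
          using U by (auto simp: agrees_def)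
      qed simp
      then have "(\<Sum>v\<in>cube_vertices. u v * v $ i) = (\<Sum>v\<in>cube_vertices. u v * pm s)"
        by (intro sum.cong refl)
      also have "\<dots> = pm s"
        unfolding sum_distrib_right[symmetric] using u(2) by simp
      finally show ?thesis
        unfolding u(3)[symmetric] by simp
    qed
    then show "x \<in> section_face a U"
      using x by (auto simp: section_face_def agrees_def)
  qed
qed

section \<open>From equal sign patterns to isomorphic face lattices\<close>

definition same_signs :: "real ^ 'n \<Rightarrow> real ^ 'n \<Rightarrow> bool" where
  "same_signs a b \<longleftrightarrow> (\<forall>v \<in> cube_vertices. sgn (a \<bullet> v) = sgn (b \<bullet> v))"

text \<open>Inclusion between faces depends only on the index sets and the signs, so sending
  \<open>section_face a T\<close> to \<open>section_face b T\<close> is well defined although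
  \<open>T\<close> is not unique, and it is an isomorphism.\<close>

lemma face_lattice_iso_if_same_signs:
  assumes "same_signs a b"
  shows "face_lattice_iso (cube_section a) (cube_section b)"
proof -
  have "spanning_vertices a T = spanning_vertices b T" for T
    using assms by (auto simp: spanning_vertices_def same_signs_def)
  then have sub: "section_face a T \<subseteq> section_face a U \<longleftrightarrow> section_face b T \<subseteq> section_face b U" for T U
    by (simp add: section_face_subset_iff)
  define f where "f = (\<lambda>F. section_face b (SOME T. F = section_face a T))"
  have f: "f (section_face a T) = section_face b T" for T
  proof -
    have "section_face a T = section_face a (SOME U. section_face a T = section_face a U)"
      by (rule someI) simp
    then show ?thesis
      unfolding f_def using sub by (metis subset_antisym order_refl)
  qed
  show ?thesis
    unfolding face_lattice_iso_def face_lattice_cube_section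
  proof (intro exI conjI)
    show "bij_betw f (range (section_face a)) (range (section_face b))"
      unfolding bij_betw_def inj_on_def
      using f sub by (auto simp: image_iff) (metis subset_antisym order_refl)+
    show "\<forall>F\<in>range (section_face a). \<forall>G\<in>range (section_face a). F \<subseteq> G \<longleftrightarrow> f F \<subseteq> f G"
      using f sub by auto
  qed
qed

section \<open>Isomorphisms of face lattices\<close>

lemma face_lattice_iso_refl: "face_lattice_iso P P"
  unfolding face_lattice_iso_def by (rule exI[of _ id]) simp

lemma face_lattice_iso_sym:
  assumes "face_lattice_iso P Q"
  shows "face_lattice_iso Q P"
proof -
  obtain f where f: "bij_betw f (face_lattice P) (face_lattice Q)"
    "\<And>F G. F \<in> face_lattice P \<Longrightarrow> G \<in> face_lattice P \<Longrightarrow> F \<subseteq> G \<longleftrightarrow> f F \<subseteq> f G"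
    using assms by (auto simp: face_lattice_iso_def)
  have "bij_betw (inv_into (face_lattice P) f) (face_lattice Q) (face_lattice P)"
    using f(1) by (rule bij_betw_inv_into)
  moreover have "inv_into (face_lattice P) f F \<in> face_lattice P"
    and "f (inv_into (face_lattice P) f F) = F" if "F \<in> face_lattice Q" for F
    using that f(1) calculation by (auto simp: bij_betw_inv_into_right bij_betwE)
  ultimately show ?thesis
    unfolding face_lattice_iso_def using f(2) by (metis (no_types, lifting))
qed

lemma face_lattice_iso_trans:
  assumes "face_lattice_iso P Q" "face_lattice_iso Q R"
  shows "face_lattice_iso P R"
proof -
  obtain f g where fg: "bij_betw f (face_lattice P) (face_lattice Q)"
    "bij_betw g (face_lattice Q) (face_lattice R)"
    "\<forall>F\<in>face_lattice P. \<forall>G\<in>face_lattice P. F \<subseteq> G \<longleftrightarrow> f F \<subseteq> f G"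
    "\<forall>F\<in>face_lattice Q. \<forall>G\<in>face_lattice Q. F \<subseteq> G \<longleftrightarrow> g F \<subseteq> g G"
    using assms by (auto simp: face_lattice_iso_def)
  then have "\<forall>F\<in>face_lattice P. \<forall>G\<in>face_lattice P. F \<subseteq> G \<longleftrightarrow> (g \<circ> f) F \<subseteq> (g \<circ> f) G"
    by (simp add: bij_betwE)
  then show ?thesis
    unfolding face_lattice_iso_def using bij_betw_trans[OF fg(1,2)] by blast
qed

text \<open>A polytope belongs to its own class, which is how equality of classes yields an
  isomorphism.\<close>

lemma combinatorial_type_eq_iff:
  assumes "polytope P"
  shows "combinatorial_type P = combinatorial_type Q \<longleftrightarrow> face_lattice_iso P Q"
proof
  assume "combinatorial_type P = combinatorial_type Q"
  moreover have "P \<in> combinatorial_type P"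
    using assms face_lattice_iso_refl by (simp add: combinatorial_type_def)
  ultimately show "face_lattice_iso P Q"
    using face_lattice_iso_sym by (auto simp: combinatorial_type_def)
next
  assume "face_lattice_iso P Q"
  then show "combinatorial_type P = combinatorial_type Q"
    unfolding combinatorial_type_def
    using face_lattice_iso_trans face_lattice_iso_sym by blast
qed

lemma face_lattice_iso_linear_image:
  assumes "linear f" "inj f"
  shows "face_lattice_iso P (f ` P)"
proof -
  have "face_lattice (f ` P) = image f ` face_lattice P"
    unfolding face_lattice_def
  proof safe
    fix F
    assume F: "F face_of f ` P"
    then obtain G where "F = f ` G"
      using face_of_imp_subset subset_image_iff by metis
    then show "F \<in> image f ` {F. F face_of P}"
      using F face_of_linear_image[OF assms] by auto
  qed (simp add: face_of_linear_image[OF assms])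
  then show ?thesis
    unfolding face_lattice_iso_def using assms(2)
    by (intro exI[of _ "image f"]) (auto simp: bij_betw_def inj_on_def inj_image_eq_iff inj_image_subset_iff)
qed

section \<open>Intersecting facets and the facets of balanced sections\<close>

text \<open>The coordinates outside \<open>I\<close> can contribute to \<open>a \<bullet> x\<close>
  anything between \<open>- R\<close> and \<open>R\<close>, where \<open>R\<close> is their total
  weight, and this has to cancel the fixed contribution of \<open>I\<close>.\<close>

lemma section_face_nonempty_iff:
  fixes a :: "real ^ 'n"
  assumes nonneg: "\<And>i. 0 \<le> a $ i"
  shows "section_face a ((\<lambda>i. (i, s i)) ` I) \<noteq> {} \<longleftrightarrow>
    \<bar>\<Sum>i\<in>I. pm (s i) * a $ i\<bar> \<le> (\<Sum>i\<in>-I. a $ i)"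
proof -
  have split: "a \<bullet> x = (\<Sum>i\<in>I. a $ i * x $ i) + (\<Sum>i\<in>-I. a $ i * x $ i)" for x
    unfolding inner_vec_def by (subst sum.Int_Diff[of UNIV _ I]) (auto simp: Compl_eq_Diff_UNIV)
  show ?thesis
  proof
    assume "section_face a ((\<lambda>i. (i, s i)) ` I) \<noteq> {}"
    then obtain x where x: "\<And>i. \<bar>x $ i\<bar> \<le> 1" "a \<bullet> x = 0" "\<And>i. i \<in> I \<Longrightarrow> x $ i = pm (s i)"
      by (auto simp: section_face_def mem_cube_section agrees_def)
    have "(\<Sum>i\<in>I. pm (s i) * a $ i) = (\<Sum>i\<in>I. a $ i * x $ i)"
      by (intro sum.cong) (auto simp: x(3))
    also have "\<dots> = - (\<Sum>i\<in>-I. a $ i * x $ i)"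
      using split[of x] x(2) by simp
    finally have "\<bar>\<Sum>i\<in>I. pm (s i) * a $ i\<bar> = \<bar>\<Sum>i\<in>-I. a $ i * x $ i\<bar>"
      by simp
    also have "\<dots> \<le> (\<Sum>i\<in>-I. \<bar>a $ i * x $ i\<bar>)"
      by (rule sum_abs)
    also have "\<dots> \<le> (\<Sum>i\<in>-I. a $ i)"
      using x(1) nonneg by (intro sum_mono) (simp add: abs_mult mult_left_le)
    finally show "\<bar>\<Sum>i\<in>I. pm (s i) * a $ i\<bar> \<le> (\<Sum>i\<in>-I. a $ i)" .
  next
    assume le: "\<bar>\<Sum>i\<in>I. pm (s i) * a $ i\<bar> \<le> (\<Sum>i\<in>-I. a $ i)"
    define S R where "S = (\<Sum>i\<in>I. pm (s i) * a $ i)" and "R = (\<Sum>i\<in>-I. a $ i)"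
    \<comment> \<open>All free coordinates get the same value. If \<open>R = 0\<close>, then
      \<open>S = 0\<close> and the quotient is 0 by convention.\<close>
    define x :: "real ^ 'n" where "x = (\<chi> i. if i \<in> I then pm (s i) else - S / R)"
    have "(\<Sum>i\<in>I. a $ i * x $ i) = S"
      unfolding S_def by (intro sum.cong) (auto simp: x_def)
    moreover have "(\<Sum>i\<in>-I. a $ i * x $ i) = (\<Sum>i\<in>-I. a $ i * (- S / R))"
      by (intro sum.cong) (auto simp: x_def)
    then have "(\<Sum>i\<in>-I. a $ i * x $ i) = R * (- S / R)"
      by (simp only: sum_distrib_right[symmetric] R_def)
    ultimately have "a \<bullet> x = S + R * (- S / R)"
      using split by simp
    also have "\<dots> = 0"
      using le unfolding S_def[symmetric] R_def[symmetric] by (cases "R = 0") auto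
    finally have "a \<bullet> x = 0" .
    moreover have "\<bar>S / R\<bar> \<le> 1"
      using le unfolding S_def[symmetric] R_def[symmetric] by (auto simp: abs_divide divide_le_eq_1)
    then have "\<bar>x $ i\<bar> \<le> 1" for i
      by (auto simp: x_def)
    ultimately have "x \<in> section_face a ((\<lambda>i. (i, s i)) ` I)"
      by (auto simp: section_face_def mem_cube_section agrees_def x_def)
    then show "section_face a ((\<lambda>i. (i, s i)) ` I) \<noteq> {}"
      by auto
  qed
qed

text \<open>Nonnegative weights, each below the sum of the others. This is what makes all facets of
  the cube cut out distinct facets of the section.\<close>

definition balanced :: "real ^ 'n \<Rightarrow> bool" where
  "balanced a \<longleftrightarrow> (\<forall>i. 0 \<le> a $ i \<and> 2 * a $ i < (\<Sum>j\<in>UNIV. a $ j))"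

text \<open>The facets, described by the order alone, so that an isomorphism of face lattices
  carries them along.\<close>

definition coatom :: "real ^ 'n \<Rightarrow> (real ^ 'n) set \<Rightarrow> bool" where
  "coatom a F \<longleftrightarrow> F \<in> range (section_face a) \<and> F \<noteq> cube_section a \<and>
     (\<forall>G \<in> range (section_face a). F \<subseteq> G \<longrightarrow> G = F \<or> G = cube_section a)"

lemma section_face_empty: "section_face a {} = cube_section a"
  by (auto simp: section_face_def agrees_def)

lemma section_face_subset: "section_face a T \<subseteq> cube_section a"
  by (auto simp: section_face_def)

lemma section_face_antimono: "T \<subseteq> U \<Longrightarrow> section_face a U \<subseteq> section_face a T"
  by (auto simp: section_face_def agrees_def)

lemma section_face_singleton_proper: "section_face a {e} \<noteq> cube_section a"
proof -
  have "0 \<in> cube_section a"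
    by (simp add: mem_cube_section)
  moreover have "0 \<notin> section_face a {e}"
    by (cases e) (simp add: section_face_def agrees_def)
  ultimately show ?thesis
    by auto
qed

lemma coatom_eq_singleton:
  assumes "coatom a F"
  shows "\<exists>e. F = section_face a {e}"
proof -
  obtain T where T: "F = section_face a T"
    using assms by (auto simp: coatom_def)
  then obtain e where "e \<in> T"
    using assms section_face_empty by (cases "T = {}") (auto simp: coatom_def)
  then have "F \<subseteq> section_face a {e}"
    unfolding T by (intro section_face_antimono) auto
  then have "section_face a {e} = F \<or> section_face a {e} = cube_section a"
    using assms unfolding coatom_def by simp
  then show ?thesis
    using section_face_singleton_proper[of a e] by metis
qed

lemma sum_remove_balanced:
  fixes a :: "real ^ 'n"
  assumes "balanced a"
  shows "a $ i < (\<Sum>j\<in>-{i}. a $ j)"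
proof -
  have "(\<Sum>j\<in>UNIV. a $ j) = a $ i + (\<Sum>j\<in>-{i}. a $ j)"
    by (subst sum.remove[of _ i]) (auto simp: Compl_eq_Diff_UNIV)
  then show ?thesis
    using assms unfolding balanced_def by (smt (verit))
qed

text \<open>The other coordinates take a common value that cancels coordinate \<open>i\<close>, and
  balance makes it smaller than 1 in absolute value. The point witnesses that no other facet of the
  cube contains this face.\<close>

lemma section_face_singleton:
  fixes a :: "real ^ 'n"
  assumes "balanced a"
  shows "\<exists>x \<in> section_face a {(i, s)}. \<forall>j. j \<noteq> i \<longrightarrow> \<bar>x $ j\<bar> < 1"
proof -
  define R where "R = (\<Sum>j\<in>-{i}. a $ j)"
  have R: "a $ i < R" "0 \<le> a $ i"
    using sum_remove_balanced[OF assms] assms by (auto simp: R_def balanced_def)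
  define x :: "real ^ 'n" where "x = (\<chi> j. if j = i then pm s else - pm s * (a $ i / R))"
  have "a \<bullet> x = a $ i * x $ i + (\<Sum>j\<in>-{i}. a $ j * x $ j)"
    unfolding inner_vec_def by (subst sum.remove[of _ i]) (auto simp: Compl_eq_Diff_UNIV)
  also have "(\<Sum>j\<in>-{i}. a $ j * x $ j) = (\<Sum>j\<in>-{i}. a $ j * (- pm s * (a $ i / R)))"
    by (intro sum.cong) (auto simp: x_def)
  also have "\<dots> = R * (- pm s * (a $ i / R))"
    by (simp only: sum_distrib_right[symmetric] R_def)
  finally have "a \<bullet> x = 0"
    using R by (simp add: x_def)
  moreover have c: "\<bar>a $ i / R\<bar> < 1"
    using R by simp
  ultimately have "x \<in> section_face a {(i, s)}"
    by (auto simp: section_face_def mem_cube_section agrees_def x_def)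
  moreover have "\<forall>j. j \<noteq> i \<longrightarrow> \<bar>x $ j\<bar> < 1"
    using c by (simp add: x_def)
  ultimately show ?thesis
    by blast
qed

lemma section_face_singleton_subset:
  assumes "balanced a" "section_face a {e} \<subseteq> section_face a {e'}"
  shows "e = e'"
proof -
  obtain i s j t where e: "e = (i, s)" "e' = (j, t)"
    by (cases e, cases e')
  obtain x where x: "x \<in> section_face a {e}" "\<forall>j. j \<noteq> i \<longrightarrow> \<bar>x $ j\<bar> < 1"
    using section_face_singleton[OF assms(1)] unfolding e by blast
  then have "x $ i = pm s" "x $ j = pm t"
    using assms(2) e by (auto simp: section_face_def agrees_def)
  then show ?thesis
    using x(2) e by (cases "j = i") (auto split: if_splits)
qed

lemma coatom_singleton:
  assumes "balanced a"
  shows "coatom a (section_face a {e})"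
  unfolding coatom_def
proof (intro conjI ballI impI section_face_singleton_proper)
  fix G
  assume "G \<in> range (section_face a)" and sub: "section_face a {e} \<subseteq> G"
  then obtain T where T: "G = section_face a T"
    by auto
  have "T \<subseteq> {e}"
  proof
    fix e'
    assume "e' \<in> T"
    then have "section_face a {e} \<subseteq> section_face a {e'}"
      using sub section_face_antimono[of "{e'}" T a] unfolding T by auto
    then show "e' \<in> {e}"
      using section_face_singleton_subset[OF assms, of e e'] by simp
  qed
  then show "G = section_face a {e} \<or> G = cube_section a"
    unfolding T using section_face_empty by (metis subset_singletonD)
qed auto

text \<open>Facets are coatoms, and a family of facets has empty intersection iff its only lower
  bound is the bottom element; both are notions of the order. The lemma is also applied with an
  unbalanced \<open>b\<close>, where a coatom still comes from a single facet of the cube.\<close>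

lemma facet_map_of_iso:
  fixes a b :: "real ^ 'n"
  assumes a: "balanced a" and iso: "face_lattice_iso (cube_section a) (cube_section b)"
  obtains \<phi> where "inj \<phi>" "\<And>T. section_face a T = {} \<longleftrightarrow> section_face b (\<phi> ` T) = {}"
proof -
  let ?A = "range (section_face a)" and ?B = "range (section_face b)"
  obtain f where bij: "bij_betw f ?A ?B"
    and ord: "\<And>F G. F \<in> ?A \<Longrightarrow> G \<in> ?A \<Longrightarrow> F \<subseteq> G \<longleftrightarrow> f F \<subseteq> f G"
    using iso unfolding face_lattice_iso_def face_lattice_cube_section by (elim exE conjE) simp
  have f_eq: "f F = f G \<longleftrightarrow> F = G" if "F \<in> ?A" "G \<in> ?A" for F G
    using bij that by (auto simp: bij_betw_def inj_on_eq_iff)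
  have f_in: "f F \<in> ?B" if "F \<in> ?A" for F
    using bij that by (auto simp: bij_betw_def)
  have f_surj: "\<exists>F \<in> ?A. G = f F" if "G \<in> ?B" for G
    using bij that unfolding bij_betw_def by (metis imageE)
  have top: "cube_section a \<in> ?A" "cube_section b \<in> ?B"
    using section_face_empty by (metis rangeI)+
  have "f (cube_section a) = cube_section b"
  proof -
    obtain F where F: "F \<in> ?A" "cube_section b = f F"
      using f_surj[OF top(2)] by blast
    then have "f F \<subseteq> f (cube_section a)"
      using ord[OF F(1) top(1)] section_face_subset by auto
    moreover have "f (cube_section a) \<subseteq> cube_section b"
      using f_in[OF top(1)] section_face_subset by auto
    ultimately show ?thesis
      using F by auto
  qed
  note ftop = this
  have empty: "{} \<in> ?A" "{} \<in> ?B"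
  proof -
    have "section_face c UNIV = {}" for c :: "real ^ 'n"
    proof -
      have "x \<notin> section_face c UNIV" for x
      proof
        assume "x \<in> section_face c UNIV"
        then have "x $ i = pm s" for i s
          by (auto simp: section_face_def agrees_def)
        from this[of _ True] this[of _ False] show False
          by simp
      qed
      then show ?thesis
        by blast
    qed
    then show "{} \<in> ?A" "{} \<in> ?B"
      by (metis rangeI)+
  qed
  have fempty: "f {} = {}"
  proof -
    obtain F where F: "F \<in> ?A" "{} = f F"
      using f_surj[OF empty(2)] by blast
    then show ?thesis
      using ord[OF empty(1) F(1)] by auto
  qed
  have f_coatom: "coatom b (f F)" if F: "coatom a F" for F
    unfolding coatom_def
  proof (intro conjI ballI impI)
    have FA: "F \<in> ?A"
      using F by (simp add: coatom_def)
    then show "f F \<in> ?B"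
      by (rule f_in)
    show "f F \<noteq> cube_section b"
      using F f_eq[OF FA top(1)] ftop by (auto simp: coatom_def)
    fix G
    assume "G \<in> ?B" and sub: "f F \<subseteq> G"
    then obtain H where H: "H \<in> ?A" "G = f H"
      using f_surj by blast
    then have "F \<subseteq> H"
      using sub ord[OF FA H(1)] by simp
    then have "H = F \<or> H = cube_section a"
      using F H(1) unfolding coatom_def by blast
    then show "G = f F \<or> G = cube_section b"
      using H(2) ftop by auto
  qed
  have "\<exists>e'. f (section_face a {e}) = section_face b {e'}" for e
    using coatom_eq_singleton[OF f_coatom[OF coatom_singleton[OF a]]] .
  then obtain \<phi> where \<phi>: "\<And>e. f (section_face a {e}) = section_face b {\<phi> e}"
    by metis
  have "inj \<phi>"
  proof (rule injI)
    fix e e'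
    assume "\<phi> e = \<phi> e'"
    then have "section_face a {e} = section_face a {e'}"
      using \<phi>[of e] \<phi>[of e'] f_eq[of "section_face a {e}" "section_face a {e'}"] by simp
    then show "e = e'"
      using section_face_singleton_subset[OF a] by blast
  qed
  moreover have "section_face a T = {} \<longleftrightarrow> section_face b (\<phi> ` T) = {}" for T
  proof
    assume Ta: "section_face a T = {}"
    \<comment> \<open>Surjectivity makes the intersection of the image facets the image of a face
      \<open>G\<close>, which then lies below all facets in \<open>T\<close> because
      \<open>f\<close> reflects the order.\<close>
    obtain G where G: "G \<in> ?A" "section_face b (\<phi> ` T) = f G"
      using f_surj[of "section_face b (\<phi> ` T)"] by auto
    have "G \<subseteq> section_face a {e}" if "e \<in> T" for e
    proof -
      have "f G \<subseteq> f (section_face a {e})"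
        unfolding \<phi> G(2)[symmetric] using that by (intro section_face_antimono) auto
      then show ?thesis
        using ord[OF G(1), of "section_face a {e}"] by simp
    qed
    moreover have "G \<subseteq> cube_section a"
      using G(1) section_face_subset by auto
    ultimately have "G \<subseteq> section_face a T"
      by (force simp: section_face_def agrees_def)
    then show "section_face b (\<phi> ` T) = {}"
      using Ta G(2) fempty by simp
  next
    assume Tb: "section_face b (\<phi> ` T) = {}"
    have "f (section_face a T) \<subseteq> section_face b {\<phi> e}" if "e \<in> T" for e
      unfolding \<phi>[symmetric] using that
      by (subst ord[symmetric]) (auto intro!: section_face_antimono del: subsetI)
    moreover have "f (section_face a T) \<subseteq> cube_section b"
      using f_in[of "section_face a T"] section_face_subset by auto
    ultimately have "f (section_face a T) \<subseteq> section_face b (\<phi> ` T)"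
      by (force simp: section_face_def agrees_def)
    then show "section_face a T = {}"
      using Tb f_eq[OF _ empty(1), of "section_face a T"] fempty by auto
  qed
  ultimately show thesis
    using that by blast
qed

section \<open>Opposite facets under an isomorphism\<close>

abbreviation antipode :: "'n \<times> bool \<Rightarrow> 'n \<times> bool" where
  "antipode e \<equiv> (fst e, \<not> snd e)"

lemma section_face_antipodal: "section_face a {e, antipode e} = {}"
  by (cases e) (auto simp: section_face_def agrees_def)

text \<open>Facets on different sides always meet, since balance bounds the difference of the two
  weights by the rest; on the same side the weights add up.\<close>

lemma section_face_pair_nonempty_iff:
  fixes a :: "real ^ 'n"
  assumes "balanced a" "i \<noteq> j"
  shows "section_face a {(i, s), (j, t)} \<noteq> {} \<longleftrightarrow> s \<noteq> t \<or> a $ i + a $ j \<le> (\<Sum>k\<in>-{i, j}. a $ k)"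
proof -
  have nonneg: "0 \<le> a $ k" for k
    using assms by (auto simp: balanced_def)
  have *: "{(i, s), (j, t)} = (\<lambda>k. (k, if k = i then s else t)) ` {i, j}"
    using assms by auto
  have total: "(\<Sum>k\<in>UNIV. a $ k) = a $ i + a $ j + (\<Sum>k\<in>-{i, j}. a $ k)"
    using assms(2) sum.subset_diff[of "{i, j}" UNIV "\<lambda>k. a $ k"] by (simp add: Compl_eq_Diff_UNIV)
  have "2 * a $ i < (\<Sum>k\<in>UNIV. a $ k)" "2 * a $ j < (\<Sum>k\<in>UNIV. a $ k)"
    using assms by (auto simp: balanced_def)
  then show ?thesis
    unfolding * section_face_nonempty_iff[of a, OF nonneg]
    using assms(2) nonneg[of i] nonneg[of j] total by auto
qed

text \<open>Describes the disjoint pairs that an isomorphism might confuse with opposite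
  facets.\<close>

lemma section_face_pair_emptyD:
  assumes "balanced a" "section_face a {e, g} = {}" "g \<noteq> antipode e"
  shows "snd g = snd e \<and> fst g \<noteq> fst e \<and> (\<Sum>k\<in>-{fst e, fst g}. a $ k) < a $ fst e + a $ fst g"
proof -
  obtain i s j t where e: "e = (i, s)" "g = (j, t)"
    by (cases e, cases g)
  have "section_face a {e} \<noteq> {}"
    using section_face_singleton[OF assms(1), of i s] unfolding e by blast
  then have "g \<noteq> e"
    using assms(2) by auto
  then have "i \<noteq> j"
    using e assms(3) by auto
  then show ?thesis
    using section_face_pair_nonempty_iff[OF assms(1), of i j s t] assms(2) e by auto
qed

text \<open>Coordinate \<open>j\<close> is pushed to the side \<open>s\<close>; coordinate
  \<open>i\<close>, whose weight is at least as large, leaves that side by the fraction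
  \<open>b $ j / b $ i\<close> of this change to keep the point in the hyperplane.\<close>

lemma section_face_transfer_coordinate:
  fixes b :: "real ^ 'n"
  assumes nonneg: "\<And>k. 0 \<le> b $ k" and le: "b $ j \<le> b $ i" and "i \<noteq> j"
    and T: "\<And>e. e \<in> T \<Longrightarrow> fst e \<noteq> i \<and> fst e \<noteq> j"
    and ne: "section_face b (insert (i, s) T) \<noteq> {}"
  shows "section_face b (insert (j, s) T) \<noteq> {}"
proof -
  obtain p where p: "\<And>k. \<bar>p $ k\<bar> \<le> 1" "b \<bullet> p = 0" "p $ i = pm s" "agrees T p"
    using ne by (auto simp: section_face_def mem_cube_section agrees_def)
  \<comment> \<open>If \<open>b $ i = 0\<close>, then \<open>b $ j = 0\<close> too and the quotient
    is 0. Coordinate \<open>i\<close> of \<open>q\<close> is the convex combination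
    \<open>(1 - c) * pm s + c * p $ j\<close>, hence bounded by 1.\<close>
  define c where "c = b $ j / b $ i"
  have c: "0 \<le> c" "c \<le> 1" "b $ i * c = b $ j"
    using nonneg[of i] nonneg[of j] le by (auto simp: c_def divide_le_eq_1)
  define q :: "real ^ 'n" where
    "q = (\<chi> k. if k = j then pm s else if k = i then pm s - c * (pm s - p $ j) else p $ k)"
  have "b \<bullet> q - b \<bullet> p = (\<Sum>k\<in>UNIV. b $ k * (q $ k - p $ k))"
    by (simp add: inner_vec_def sum_subtractf algebra_simps)
  also have "\<dots> = (\<Sum>k\<in>{i, j}. b $ k * (q $ k - p $ k))"
    by (rule sum.mono_neutral_right) (auto simp: q_def)
  also have "\<dots> = b $ j * (pm s - p $ j) - (b $ i * c) * (pm s - p $ j)"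
    using \<open>i \<noteq> j\<close> p(3) by (simp add: q_def algebra_simps)
  finally have "b \<bullet> q = 0"
    using p(2) c(3) by simp
  moreover have "\<bar>pm s - c * (pm s - p $ j)\<bar> \<le> 1"
  proof -
    have "\<bar>(1 - c) * pm s + c * p $ j\<bar> \<le> (1 - c) * 1 + c * 1"
      using c p(1)[of j] by (intro order_trans[OF abs_triangle_ineq] add_mono) (auto simp: abs_mult mult_left_le)
    then show ?thesis
      by (simp add: algebra_simps)
  qed
  then have "\<bar>q $ k\<bar> \<le> 1" for k
    using p(1)[of k] by (simp add: q_def)
  moreover have "agrees (insert (j, s) T) q"
    using p(4) T by (force simp: agrees_def q_def)
  ultimately show ?thesis
    by (auto simp: section_face_def mem_cube_section)
qed

text \<open>If opposite facets were sent to facets \<open>x\<close>, \<open>y\<close> of different coordinates, then \<open>x\<close> and \<open>y\<close> would have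
  the same sign, and the one with the larger weight could be exchanged for the other in every intersecting
  family of facets avoiding both coordinates. Opposite facets never have this exchange property.\<close>

lemma facet_map_antipode_aux:
  fixes a b :: "real ^ 'n"
  assumes a: "balanced a" and b: "balanced b" and inj: "inj \<phi>"
    and nerve: "\<And>T. section_face a T = {} \<longleftrightarrow> section_face b (\<phi> ` T) = {}"
    and le: "b $ fst (\<phi> (antipode e)) \<le> b $ fst (\<phi> e)"
  shows "\<phi> (antipode e) = antipode (\<phi> e)"
proof (rule ccontr)
  assume neq: "\<phi> (antipode e) \<noteq> antipode (\<phi> e)"
  have surj: "surj \<phi>"
    using inj by (rule finite_UNIV_inj_surj[OF finite_class.finite_UNIV])
  obtain k r where e: "e = (k, r)"
    by (cases e)
  obtain i s where x: "\<phi> e = (i, s)"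
    by (cases "\<phi> e")
  have "section_face b {\<phi> e, \<phi> (antipode e)} = {}"
    using nerve[of "{e, antipode e}"] section_face_antipodal[of a e] by simp
  from section_face_pair_emptyD[OF b this neq]
  obtain j where y: "\<phi> (antipode e) = (j, s)" and ij: "i \<noteq> j"
    and sumb: "(\<Sum>k\<in>-{i, j}. b $ k) < b $ i + b $ j"
    using x by (cases "\<phi> (antipode e)") auto
  \<comment> \<open>The preimages of the facets opposite to the two images. They turn out to be
    opposite to each other, so that the four facets of \<open>k\<close> and \<open>k'\<close> are
    mapped onto the four facets of \<open>i\<close> and \<open>j\<close>.\<close>
  obtain e' e'' where e': "\<phi> e' = (i, \<not> s)" and e'': "\<phi> e'' = (j, \<not> s)"
    using surj by (metis surjD)
  have "section_face a {e, e'} = {}"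
    using nerve[of "{e, e'}"] section_face_antipodal[of b "(i, s)"] x e' by simp
  moreover have "e' \<noteq> antipode e"
    using e' y by auto
  ultimately obtain k' where k': "e' = (k', r)" "k' \<noteq> k"
    and suma: "(\<Sum>m\<in>-{k, k'}. a $ m) < a $ k + a $ k'"
    using section_face_pair_emptyD[OF a, of e e'] e by (cases e') auto
  have "section_face a {antipode e, e''} = {}"
    using nerve[of "{antipode e, e''}"] section_face_antipodal[of b "(j, s)"] y e'' by simp
  moreover have "e'' \<noteq> antipode (antipode e)"
    using e'' x by auto
  ultimately have r'': "snd e'' = (\<not> r)"
    using section_face_pair_emptyD[OF a, of "antipode e" e''] e by auto
  \<comment> \<open>For facets of two coordinates only the equality of the sides counts, so the
    reflected pair is disjoint as well.\<close>
  have "section_face b {(i, \<not> s), (j, \<not> s)} = {}"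
    using section_face_pair_nonempty_iff[OF b ij, of "\<not> s" "\<not> s"] sumb by auto
  then have "section_face a {e', e''} = {}"
    using nerve[of "{e', e''}"] e' e'' by simp
  then have e''_eq: "e'' = (k', \<not> r)"
    using section_face_pair_emptyD[OF a, of e' e''] k' r'' by (cases e'') auto
  \<comment> \<open>The family that violates the exchange. With \<open>(k, r)\<close> the
    contributions of \<open>k\<close> and of the rest have opposite signs and \<open>k'\<close> can
    cancel their difference; with \<open>(k, \<not> r)\<close> they add up to more than
    \<open>k'\<close> can cancel.\<close>
  define T where "T = (\<lambda>m. (m, \<not> r)) ` (- {k, k'})"
  have T: "fst g \<noteq> i \<and> fst g \<noteq> j" if g: "g \<in> \<phi> ` T" for g
  proof -
    obtain m where m: "g = \<phi> (m, \<not> r)" "m \<noteq> k" "m \<noteq> k'"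
      using g unfolding T_def by blast
    have "(m, \<not> r) \<notin> {e, antipode e, e', e''}"
      using m e k' e''_eq by auto
    then have "g \<notin> \<phi> ` {e, antipode e, e', e''}"
      unfolding m(1) inj_image_mem_iff[OF inj] .
    then have "g \<notin> {(i, s), (j, s), (i, \<not> s), (j, \<not> s)}"
      using x y e' e'' by simp
    then show ?thesis
      by (cases g) auto
  qed
  have nonneg: "0 \<le> a $ m" "0 \<le> b $ m" for m
    using a b by (auto simp: balanced_def)
  have total: "(\<Sum>m\<in>UNIV. a $ m) = a $ k + a $ k' + (\<Sum>m\<in>-{k, k'}. a $ m)"
    using k'(2) sum.subset_diff[of "{k, k'}" UNIV "\<lambda>m. a $ m"] by (simp add: Compl_eq_Diff_UNIV)
  have bal: "2 * a $ k < (\<Sum>m\<in>UNIV. a $ m)" "2 * a $ k' < (\<Sum>m\<in>UNIV. a $ m)"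
    using a by (auto simp: balanced_def)
  have ins: "insert (k, t) T = (\<lambda>m. (m, if m = k then t else \<not> r)) ` (- {k'})" for t
  proof -
    have "- {k'} = insert k (- {k, k'})"
      using k'(2) by auto
    then show ?thesis
      unfolding T_def by (simp only: image_insert) (intro arg_cong2[where f = insert] image_cong, auto)
  qed
  have sum: "(\<Sum>m\<in>-{k'}. pm (if m = k then t else \<not> r) * a $ m)
      = pm t * a $ k + pm (\<not> r) * (\<Sum>m\<in>-{k, k'}. a $ m)" for t
  proof -
    have "(\<Sum>m\<in>-{k'}. pm (if m = k then t else \<not> r) * a $ m)
      = pm t * a $ k + (\<Sum>m\<in>-{k'} - {k}. pm (if m = k then t else \<not> r) * a $ m)"
      using k'(2) by (subst sum.remove[of _ k]) auto
    also have "(\<Sum>m\<in>-{k'} - {k}. pm (if m = k then t else \<not> r) * a $ m) = (\<Sum>m\<in>-{k, k'}. pm (\<not> r) * a $ m)"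
      by (intro sum.cong) auto
    finally show ?thesis
      by (simp only: sum_distrib_left)
  qed
  have ne_iff: "section_face a (insert (k, t) T) \<noteq> {} \<longleftrightarrow>
      \<bar>pm t * a $ k + pm (\<not> r) * (\<Sum>m\<in>-{k, k'}. a $ m)\<bar> \<le> a $ k'" for t
    unfolding ins section_face_nonempty_iff[of a, OF nonneg(1)] sum by simp
  have "section_face a (insert (k, r) T) \<noteq> {}"
    unfolding ne_iff using suma bal total nonneg(1)[of k] nonneg(1)[of k'] by (cases r) auto
  then have "section_face b (insert (i, s) (\<phi> ` T)) \<noteq> {}"
    using nerve[of "insert (k, r) T"] x e by simp
  then have "section_face b (insert (j, s) (\<phi> ` T)) \<noteq> {}"
    using section_face_transfer_coordinate[of b, OF nonneg(2) _ ij T] le x y by simp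
  then have "section_face a (insert (k, \<not> r) T) \<noteq> {}"
    using nerve[of "insert (k, \<not> r) T"] y e by simp
  then show False
    unfolding ne_iff using bal total nonneg(1)[of k] nonneg(1)[of k'] by (cases r) auto
qed

text \<open>One of the two images has the larger weight; if it is the image of the opposite facet,
  the roles are exchanged.\<close>

lemma facet_map_antipode:
  fixes a b :: "real ^ 'n"
  assumes a: "balanced a" and b: "balanced b" and inj: "inj \<phi>"
    and nerve: "\<And>T. section_face a T = {} \<longleftrightarrow> section_face b (\<phi> ` T) = {}"
  shows "\<phi> (antipode e) = antipode (\<phi> e)"
proof (cases "b $ fst (\<phi> (antipode e)) \<le> b $ fst (\<phi> e)")
  case True
  then show ?thesis
    by (rule facet_map_antipode_aux[OF a b inj nerve])
next
  case False
  then have "\<phi> (antipode (antipode e)) = antipode (\<phi> (antipode e))"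
    by (intro facet_map_antipode_aux[OF a b inj nerve]) simp
  then show ?thesis
    by (cases "\<phi> (antipode e)") auto
qed

section \<open>From isomorphisms to permuted sign patterns\<close>

lemma inner_cube_vertex:
  assumes "v \<in> cube_vertices"
  shows "a \<bullet> v = (\<Sum>i\<in>{i. v $ i = 1}. a $ i) - (\<Sum>i\<in>- {i. v $ i = 1}. a $ i)"
proof -
  have "a \<bullet> v = (\<Sum>i\<in>{i. v $ i = 1}. a $ i * v $ i) + (\<Sum>i\<in>- {i. v $ i = 1}. a $ i * v $ i)"
    unfolding inner_vec_def
    by (subst sum.Int_Diff[of UNIV _ "{i. v $ i = 1}"]) (auto simp: Compl_eq_Diff_UNIV)
  also have "(\<Sum>i\<in>{i. v $ i = 1}. a $ i * v $ i) = (\<Sum>i\<in>{i. v $ i = 1}. a $ i)"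
    by simp
  also have "(\<Sum>i\<in>- {i. v $ i = 1}. a $ i * v $ i) = (\<Sum>i\<in>- {i. v $ i = 1}. - a $ i)"
  proof (intro sum.cong refl)
    fix i
    assume "i \<in> - {i. v $ i = 1}"
    then have "v $ i = - 1"
      using assms by (auto simp: cube_vertices_def)
    then show "a $ i * v $ i = - a $ i"
      by simp
  qed
  finally show ?thesis
    by (simp add: sum_negf)
qed

text \<open>Used for the positive coordinates of \<open>v\<close> and for their complement, the
  hypothesis transfers both \<open>a \<bullet> v \<le> 0\<close> and
  \<open>a \<bullet> v \<ge> 0\<close>, hence the sign.\<close>

lemma same_signsI:
  assumes "\<And>I. (\<Sum>i\<in>I. a $ i) \<le> (\<Sum>i\<in>-I. a $ i) \<longleftrightarrow> (\<Sum>i\<in>I. b $ i) \<le> (\<Sum>i\<in>-I. b $ i)"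
  shows "same_signs a b"
  unfolding same_signs_def
proof
  fix v :: "real ^ 'a"
  assume v: "v \<in> cube_vertices"
  show "sgn (a \<bullet> v) = sgn (b \<bullet> v)"
    using assms[of "{i. v $ i = 1}"] assms[of "- {i. v $ i = 1}"]
    unfolding inner_cube_vertex[OF v] double_complement by (auto simp: sgn_if)
qed

text \<open>Compatibility with opposite facets turns \<open>\<phi>\<close> into a permutation
  \<open>\<pi>\<close> of the coordinates with sign changes \<open>\<epsilon>\<close>. The sign
  changes are absorbed because a common point of the positive facets over \<open>I\<close> implies
  one for every choice of sides over \<open>I\<close>. Intersection of positive facets then compares
  the weight of \<open>I\<close> with that of its complement.\<close>

lemma same_signs_permuted_if_iso:
  fixes a b :: "real ^ 'n"
  assumes a: "balanced a" and b: "balanced b"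
    and iso: "face_lattice_iso (cube_section a) (cube_section b)"
  obtains \<pi> where "bij \<pi>" "same_signs a (\<chi> i. b $ \<pi> i)"
proof -
  obtain \<phi> where inj: "inj \<phi>" and nerve: "\<And>T. section_face a T = {} \<longleftrightarrow> section_face b (\<phi> ` T) = {}"
    using facet_map_of_iso[OF a iso] by metis
  have anti: "\<phi> (antipode e) = antipode (\<phi> e)" for e
    by (rule facet_map_antipode[OF a b inj nerve])
  define \<pi> \<epsilon> where "\<pi> i = fst (\<phi> (i, True))" and "\<epsilon> i = snd (\<phi> (i, True))" for i
  have \<phi>: "\<phi> (i, True) = (\<pi> i, \<epsilon> i)" "\<phi> (i, False) = (\<pi> i, \<not> \<epsilon> i)" for i
    using anti[of "(i, True)"] by (simp_all add: \<pi>_def \<epsilon>_def)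
  have "inj \<pi>"
  proof (rule injI)
    fix i j
    assume "\<pi> i = \<pi> j"
    then have "\<phi> (i, True) = \<phi> (j, True) \<or> \<phi> (i, True) = \<phi> (j, False)"
      using \<phi> by (cases "\<epsilon> i = \<epsilon> j") auto
    then show "i = j"
      using inj by (auto dest: injD)
  qed
  then have bij: "bij \<pi>"
    using finite_UNIV_inj_surj[OF finite_class.finite_UNIV] by (auto simp: bij_def)
  have nonneg: "0 \<le> a $ i" "0 \<le> b $ i" for i
    using a b by (auto simp: balanced_def)
  have plus: "section_face c (I \<times> {True}) \<noteq> {} \<longleftrightarrow> (\<Sum>i\<in>I. c $ i) \<le> (\<Sum>i\<in>-I. c $ i)"
    and any: "section_face c (I \<times> {True}) \<noteq> {} \<Longrightarrow> section_face c ((\<lambda>i. (i, s i)) ` I) \<noteq> {}"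
    if nn: "\<And>i. 0 \<le> c $ i" for c :: "real ^ 'n" and I s
  proof -
    have I: "I \<times> {True} = (\<lambda>i. (i, True)) ` I"
      by auto
    show p: "section_face c (I \<times> {True}) \<noteq> {} \<longleftrightarrow> (\<Sum>i\<in>I. c $ i) \<le> (\<Sum>i\<in>-I. c $ i)"
      unfolding I section_face_nonempty_iff[of c, OF nn] using sum_nonneg[of I "\<lambda>i. c $ i"] nn by simp
    have "\<bar>\<Sum>i\<in>I. pm (s i) * c $ i\<bar> \<le> (\<Sum>i\<in>I. \<bar>pm (s i) * c $ i\<bar>)"
      by (rule sum_abs)
    also have "\<dots> = (\<Sum>i\<in>I. c $ i)"
      using nn by (intro sum.cong) (auto simp: abs_mult)
    finally show "section_face c ((\<lambda>i. (i, s i)) ` I) \<noteq> {}" if "section_face c (I \<times> {True}) \<noteq> {}"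
      unfolding section_face_nonempty_iff[of c, OF nn] using that p by linarith
  qed
  \<comment> \<open>In both directions the positive sides are first replaced by those that
    \<open>\<phi>\<close> matches with positive sides of the other section.\<close>
  have key: "section_face a (I \<times> {True}) \<noteq> {} \<longleftrightarrow> section_face b ((\<pi> ` I) \<times> {True}) \<noteq> {}" for I
  proof
    assume "section_face a (I \<times> {True}) \<noteq> {}"
    then have "section_face a ((\<lambda>i. (i, \<epsilon> i)) ` I) \<noteq> {}"
      by (rule any[OF nonneg(1)])
    moreover have "\<phi> (i, \<epsilon> i) = (\<pi> i, True)" for i
      using \<phi>[of i] by (cases "\<epsilon> i") auto
    then have "\<phi> ` (\<lambda>i. (i, \<epsilon> i)) ` I = (\<pi> ` I) \<times> {True}"
      by (auto simp: image_iff)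
    ultimately show "section_face b ((\<pi> ` I) \<times> {True}) \<noteq> {}"
      using nerve[of "(\<lambda>i. (i, \<epsilon> i)) ` I"] by simp
  next
    assume "section_face b ((\<pi> ` I) \<times> {True}) \<noteq> {}"
    then have "section_face b ((\<lambda>j. (j, \<epsilon> (inv \<pi> j))) ` \<pi> ` I) \<noteq> {}"
      by (rule any[OF nonneg(2)])
    moreover have "(\<lambda>j. (j, \<epsilon> (inv \<pi> j))) ` \<pi> ` I = \<phi> ` (I \<times> {True})"
      using \<phi>(1) \<open>inj \<pi>\<close> by (auto simp: image_iff)
    ultimately show "section_face a (I \<times> {True}) \<noteq> {}"
      using nerve by simp
  qed
  have re: "(\<Sum>i\<in>\<pi> ` I. b $ i) = (\<Sum>i\<in>I. (\<chi> i. b $ \<pi> i) $ i)" for I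
    using \<open>inj \<pi>\<close> by (subst sum.reindex) (auto intro: inj_on_subset)
  have "same_signs a (\<chi> i. b $ \<pi> i)"
  proof (rule same_signsI)
    fix I
    show "(\<Sum>i\<in>I. a $ i) \<le> (\<Sum>i\<in>-I. a $ i) \<longleftrightarrow>
      (\<Sum>i\<in>I. (\<chi> i. b $ \<pi> i) $ i) \<le> (\<Sum>i\<in>-I. (\<chi> i. b $ \<pi> i) $ i)"
      using key[of I] plus[OF nonneg(1), of I] plus[OF nonneg(2), of "\<pi> ` I"]
      unfolding re[symmetric] bij_image_Compl_eq[OF bij] by simp
  qed
  then show thesis
    using that bij by blast
qed

text \<open>The Chow parameters, which determine a threshold function.\<close>

definition chow :: "real ^ 'n \<Rightarrow> 'n \<Rightarrow> real" where
  "chow a i = (\<Sum>v\<in>cube_vertices. sgn (a \<bullet> v) * v $ i)"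

lemma bij_betw_permute_cube_vertices:
  assumes "bij \<pi>"
  shows "bij_betw (\<lambda>v. \<chi> i. v $ \<pi> i) cube_vertices cube_vertices"
proof (rule bij_betw_byWitness[where f' = "\<lambda>v. \<chi> i. v $ inv \<pi> i"])
  show "\<forall>v\<in>cube_vertices. (\<chi> i. (\<chi> i. v $ \<pi> i) $ inv \<pi> i) = v"
    using assms by (simp add: bij_is_surj surj_f_inv_f)
  show "\<forall>v\<in>cube_vertices. (\<chi> i. (\<chi> i. v $ inv \<pi> i) $ \<pi> i) = v"
    using assms by (simp add: bij_is_inj)
qed (auto simp: cube_vertices_def)

lemma inner_permute:
  fixes a v :: "real ^ 'n"
  assumes "bij \<pi>"
  shows "(\<chi> i. a $ \<pi> i) \<bullet> (\<chi> i. v $ \<pi> i) = a \<bullet> v"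
  using sum.reindex_bij_betw[OF assms, of "\<lambda>i. a $ i * v $ i"] by (simp add: inner_vec_def)

lemma chow_permute:
  fixes a :: "real ^ 'n"
  assumes "bij \<pi>"
  shows "chow (\<chi> i. a $ \<pi> i) i = chow a (\<pi> i)"
  unfolding chow_def
  using sum.reindex_bij_betw[OF bij_betw_permute_cube_vertices[OF assms],
      of "\<lambda>v. sgn ((\<chi> i. a $ \<pi> i) \<bullet> v) * v $ i"]
  by (simp add: inner_permute[OF assms])

lemma chow_cong: "same_signs a b \<Longrightarrow> chow a = chow b"
  unfolding chow_def same_signs_def by (intro ext sum.cong) auto

text \<open>Each vertex is paired with its image under exchanging \<open>i\<close> and
  \<open>j\<close>. The values at the two differ by
  \<open>(a $ i - a $ j) * (v $ i - v $ j)\<close>, so the difference of their signs never opposes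
  \<open>v $ i - v $ j\<close>.\<close>

lemma chow_mono:
  fixes a :: "real ^ 'n"
  assumes "a $ j \<le> a $ i"
  shows "chow a j \<le> chow a i"
proof -
  let ?t = "Transposition.transpose i j" and ?s = "\<lambda>v :: real ^ 'n. \<chi> k. v $ Transposition.transpose i j k"
  have 1: "chow a i - chow a j = (\<Sum>v\<in>cube_vertices. sgn (a \<bullet> v) * (v $ i - v $ j))"
    by (simp add: chow_def sum_subtractf algebra_simps)
  \<comment> \<open>The exchange of coordinates reverses \<open>v $ i - v $ j\<close>, whence the
    minus sign.\<close>
  have 2: "chow a i - chow a j = (\<Sum>v\<in>cube_vertices. - sgn (a \<bullet> ?s v) * (v $ i - v $ j))"
    unfolding 1
    by (subst sum.reindex_bij_betw[OF bij_betw_permute_cube_vertices[OF bij_transpose[of i j]], symmetric])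
      (simp add: algebra_simps)
  have "2 * (chow a i - chow a j) = (\<Sum>v\<in>cube_vertices. sgn (a \<bullet> v) * (v $ i - v $ j)) +
      (\<Sum>v\<in>cube_vertices. - sgn (a \<bullet> ?s v) * (v $ i - v $ j))"
    unfolding 1[symmetric] 2[symmetric] by simp
  also have "\<dots> = (\<Sum>v\<in>cube_vertices. (sgn (a \<bullet> v) - sgn (a \<bullet> ?s v)) * (v $ i - v $ j))"
    unfolding sum.distrib[symmetric] by (simp add: algebra_simps)
  also have "\<dots> \<ge> 0"
  proof (rule sum_nonneg)
    fix v :: "real ^ 'n"
    have "a \<bullet> v - a \<bullet> ?s v = (\<Sum>k\<in>UNIV. a $ k * (v $ k - v $ ?t k))"
      by (simp add: inner_vec_def sum_subtractf algebra_simps)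
    also have "\<dots> = (\<Sum>k\<in>{i, j}. a $ k * (v $ k - v $ ?t k))"
      by (rule sum.mono_neutral_right) auto
    also have "\<dots> = (a $ i - a $ j) * (v $ i - v $ j)"
      by (cases "i = j") (auto simp: algebra_simps)
    finally have eq: "a \<bullet> v - a \<bullet> ?s v = (a $ i - a $ j) * (v $ i - v $ j)" .
    show "0 \<le> (sgn (a \<bullet> v) - sgn (a \<bullet> ?s v)) * (v $ i - v $ j)"
    proof (cases "v $ i \<ge> v $ j")
      case True
      then have "a \<bullet> v \<ge> a \<bullet> ?s v"
        using eq assms by (smt (verit) mult_nonneg_nonneg)
      then have "sgn (a \<bullet> v) \<ge> sgn (a \<bullet> ?s v)"
        by (auto simp: sgn_if)
      then show ?thesis
        using True by simp
    next
      case False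
      then have "a \<bullet> v \<le> a \<bullet> ?s v"
        using eq assms by (smt (verit) mult_nonneg_nonpos)
      then have "sgn (a \<bullet> v) \<le> sgn (a \<bullet> ?s v)"
        by (auto simp: sgn_if)
      then show ?thesis
        using False by (simp add: mult_nonpos_nonpos)
    qed
  qed
  finally show ?thesis
    by simp
qed

text \<open>Equal parameters give \<open>(\<Sum>v\<in>cube_vertices. (sgn (c \<bullet> v) - sgn (d
  \<bullet> v)) * (c \<bullet> v)) = 0\<close>, and no summand is negative, so the signs agree
  wherever \<open>c \<bullet> v \<noteq> 0\<close>. Exchanging the roles of the two vectors settles
  the vertices where one of them vanishes.\<close>

lemma same_signs_if_chow_eq:
  fixes a b :: "real ^ 'n"
  assumes "chow a = chow b"
  shows "same_signs a b"
proof -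
  have dominate: "sgn (d \<bullet> v) = sgn (c \<bullet> v)"
    if eq: "chow c = chow d" and v: "v \<in> cube_vertices" "c \<bullet> v \<noteq> 0" for c d v :: "real ^ 'n"
  proof -
    have chow: "(\<Sum>v\<in>cube_vertices. sgn (u \<bullet> v) * (c \<bullet> v)) = (\<Sum>i\<in>UNIV. c $ i * chow u i)" for u :: "real ^ 'n"
      unfolding chow_def inner_vec_def sum_distrib_left
      by (subst sum.swap) (intro sum.cong refl, simp add: ac_simps)
    have "(\<Sum>v\<in>cube_vertices. (sgn (c \<bullet> v) - sgn (d \<bullet> v)) * (c \<bullet> v)) = 0"
      using chow[of c] chow[of d] eq by (simp add: left_diff_distrib sum_subtractf)
    moreover have "(sgn (c \<bullet> v) - sgn (d \<bullet> v)) * (c \<bullet> v) \<ge> 0" for v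
      by (auto simp: sgn_if)
    ultimately have "(sgn (c \<bullet> v) - sgn (d \<bullet> v)) * (c \<bullet> v) = 0"
      using sum_nonneg_eq_0_iff[OF finite_cube_vertices, of "\<lambda>v. (sgn (c \<bullet> v) - sgn (d \<bullet> v)) * (c \<bullet> v)"] v(1)
      by auto
    then show ?thesis
      using v(2) by simp
  qed
  show ?thesis
    unfolding same_signs_def
  proof
    fix v :: "real ^ 'n"
    assume "v \<in> cube_vertices"
    then show "sgn (a \<bullet> v) = sgn (b \<bullet> v)"
      using dominate[OF assms] dominate[OF assms[symmetric]] by (metis sgn_0)
  qed
qed

section \<open>Removing the permutation for descending weights\<close>

definition descending :: "('n \<Rightarrow> nat) \<Rightarrow> ('n \<Rightarrow> real) \<Rightarrow> bool" where
  "descending h p \<longleftrightarrow> (\<forall>i j. h i \<le> h j \<longrightarrow> p j \<le> p i)"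

text \<open>The sets \<open>{i. c \<le> p i}\<close> and \<open>{i. c \<le> q i}\<close> are initial
  segments with respect to \<open>h\<close>, hence comparable; the permutation makes them
  equinumerous, so they coincide.\<close>

lemma descending_unique:
  fixes p q :: "'n::finite \<Rightarrow> real"
  assumes p: "descending h p" and q: "descending h q" and "bij \<pi>" and pq: "\<And>i. p i = q (\<pi> i)"
  shows "p = q"
proof -
  have "{i. c \<le> p i} = {i. c \<le> q i}" for c
  proof -
    have "{i. c \<le> q i} = \<pi> ` {i. c \<le> p i}"
      using \<open>bij \<pi>\<close> pq by (auto simp: image_iff) (metis bij_pointE)
    then have card: "card {i. c \<le> q i} = card {i. c \<le> p i}"
      using card_image[OF inj_on_subset[OF bij_is_inj[OF \<open>bij \<pi>\<close>] subset_UNIV]] by simp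
    have "{i. c \<le> p i} \<subseteq> {i. c \<le> q i} \<or> {i. c \<le> q i} \<subseteq> {i. c \<le> p i}"
    proof (rule ccontr)
      assume "\<not> ?thesis"
      then obtain i j where "c \<le> p i" "\<not> c \<le> q i" "c \<le> q j" "\<not> c \<le> p j"
        by auto
      then show False
        using p q unfolding descending_def by (metis nle_le order_trans)
    qed
    then show ?thesis
      using card by (metis card_subset_eq finite)
  qed
  then have "c \<le> p i \<longleftrightarrow> c \<le> q i" for c i
    by (metis mem_Collect_eq)
  then show ?thesis
    by (intro ext) (meson order_antisym order_refl)
qed

lemma face_lattice_iso_iff_same_signs:
  fixes a b :: "real ^ 'n"
  assumes "balanced a" "balanced b" "descending h (($) a)" "descending h (($) b)"
  shows "face_lattice_iso (cube_section a) (cube_section b) \<longleftrightarrow> same_signs a b"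
proof
  assume "face_lattice_iso (cube_section a) (cube_section b)"
  then obtain \<pi> where \<pi>: "bij \<pi>" "same_signs a (\<chi> i. b $ \<pi> i)"
    using same_signs_permuted_if_iso[OF assms(1,2)] by metis
  have "descending h (chow a)" "descending h (chow b)"
    using assms(3,4) by (auto simp: descending_def intro!: chow_mono)
  moreover have "chow a i = chow b (\<pi> i)" for i
    using chow_cong[OF \<pi>(2)] chow_permute[OF \<pi>(1)] by metis
  ultimately have "chow a = chow b"
    using descending_unique \<pi>(1) by blast
  then show "same_signs a b"
    by (rule same_signs_if_chow_eq)
qed (rule face_lattice_iso_if_same_signs)

section \<open>Reduction to sign patterns\<close>

text \<open>Unlike the values of \<open>sgn\<close>, these do not depend on the number type, so
  signatures of integer and of real weights can be compared.\<close>

datatype sign = Minus | Null | Plus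

definition sign_of :: "'a::linordered_idom \<Rightarrow> sign" where
  "sign_of x = (if x < 0 then Minus else if x = 0 then Null else Plus)"

lemma sign_of_eq_iff: "sign_of x = sign_of y \<longleftrightarrow> sgn x = sgn y"
  by (auto simp: sign_of_def sgn_if)

lemma sign_of_minus_eq_iff: "sign_of (- x) = sign_of (- y) \<longleftrightarrow> sign_of x = sign_of y"
  by (auto simp: sign_of_def)

fun dot :: "int list \<Rightarrow> 'a::linordered_idom list \<Rightarrow> 'a" where
  "dot (c # cs) (x # xs) = of_int c * x + dot cs xs"
| "dot [] xs = 0"
| "dot cs [] = 0"

fun sign_vectors :: "nat \<Rightarrow> int list list" where
  "sign_vectors 0 = [[]]"
| "sign_vectors (Suc n) = map ((#) 1) (sign_vectors n) @ map ((#) (- 1)) (sign_vectors n)"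

text \<open>Partial sums are carried along, so vertices with the same initial coordinates share
  their evaluation.\<close>

fun vertex_signs :: "'a::linordered_idom \<Rightarrow> 'a list \<Rightarrow> sign list" where
  "vertex_signs s [] = [sign_of s]"
| "vertex_signs s (x # xs) = vertex_signs (s + x) xs @ vertex_signs (s - x) xs"

text \<open>By central symmetry only the vertices with first coordinate 1 are listed.\<close>

definition signature :: "'a::linordered_idom list \<Rightarrow> sign list" where
  "signature xs = vertex_signs (hd xs) (tl xs)"

definition sorted_weights :: "nat \<Rightarrow> real list set" where
  "sorted_weights d = {xs. length xs = d \<and> sorted_wrt (\<ge>) xs \<and> (\<forall>x\<in>set xs. 0 \<le> x)}"

text \<open>For descending weights the bound on the first entry implies the one on every other
  entry.\<close>

definition balanced_weights :: "nat \<Rightarrow> real list set" where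
  "balanced_weights d = {xs \<in> sorted_weights d. hd xs < sum_list (tl xs)}"

lemma set_sign_vectors: "set (sign_vectors n) = {v. length v = n \<and> set v \<subseteq> {1, - 1}}"
proof (induction n)
  case (Suc n)
  show ?case
  proof (rule set_eqI)
    fix v :: "int list"
    show "v \<in> set (sign_vectors (Suc n)) \<longleftrightarrow> v \<in> {v. length v = Suc n \<and> set v \<subseteq> {1, - 1}}"
      using Suc by (cases v) auto
  qed
qed auto

lemma vertex_signs_eq: "vertex_signs s xs = map (\<lambda>v. sign_of (s + dot v xs)) (sign_vectors (length xs))"
  by (induction s xs rule: vertex_signs.induct) (auto simp: algebra_simps)

lemma signature_eq:
  assumes "length xs = Suc n"
  shows "signature xs = map (\<lambda>v. sign_of (dot (1 # v) xs)) (sign_vectors n)"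
  using assms by (cases xs) (auto simp: signature_def vertex_signs_eq)

lemma dot_eq_sum:
  assumes "length v = length xs"
  shows "dot v xs = (\<Sum>k<length xs. of_int (v ! k) * xs ! k)"
  using assms
proof (induction v xs rule: list_induct2)
  case (Cons c cs x xs)
  then show ?case
    by (simp only: dot.simps length_Cons sum.lessThan_Suc_shift) simp
qed simp

lemma dot_uminus: "length v = length xs \<Longrightarrow> dot (map uminus v) xs = - dot v xs"
  by (induction v xs rule: list_induct2) auto

text \<open>The vertices with first coordinate -1 are the negatives of those listed in a signature,
  and negating both values keeps equal signs equal.\<close>

lemma signature_eq_iff:
  assumes "length xs = d" "length ys = d" "0 < d"
  shows "signature xs = signature ys \<longleftrightarrow>
    (\<forall>v \<in> set (sign_vectors d). sign_of (dot v xs) = sign_of (dot v ys))"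
proof -
  obtain n where n: "d = Suc n"
    using assms(3) gr0_conv_Suc by auto
  have "signature xs = signature ys \<longleftrightarrow>
      (\<forall>v \<in> set (sign_vectors n). sign_of (dot (1 # v) xs) = sign_of (dot (1 # v) ys))"
    using assms(1,2) unfolding n by (simp add: signature_eq)
  also have "\<dots> \<longleftrightarrow> (\<forall>v \<in> set (sign_vectors d). sign_of (dot v xs) = sign_of (dot v ys))"
  proof
    assume *: "\<forall>v \<in> set (sign_vectors n). sign_of (dot (1 # v) xs) = sign_of (dot (1 # v) ys)"
    show "\<forall>v \<in> set (sign_vectors d). sign_of (dot v xs) = sign_of (dot v ys)"
    proof
      fix v
      assume v: "v \<in> set (sign_vectors d)"
      then obtain c w where cw: "v = c # w" "length w = n" "c = 1 \<or> c = - 1" "set w \<subseteq> {1, - 1}"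
        unfolding set_sign_vectors n by (cases v) auto
      show "sign_of (dot v xs) = sign_of (dot v ys)"
      proof (cases "c = 1")
        case True
        then show ?thesis
          using * cw by (simp add: set_sign_vectors)
      next
        case False
        then have v_eq: "v = map uminus (1 # map uminus w)"
          using cw by (simp add: comp_def)
        have "map uminus w \<in> set (sign_vectors n)"
          using cw by (auto simp: set_sign_vectors)
        then have "sign_of (dot (1 # map uminus w) xs) = sign_of (dot (1 # map uminus w) ys)"
          using * by blast
        then show ?thesis
          unfolding v_eq using assms(1,2) cw(2) n by (simp add: dot_uminus sign_of_minus_eq_iff del: list.map)
      qed
    qed
  next
    assume *: "\<forall>v \<in> set (sign_vectors d). sign_of (dot v xs) = sign_of (dot v ys)"
    then show "\<forall>v \<in> set (sign_vectors n). sign_of (dot (1 # v) xs) = sign_of (dot (1 # v) ys)"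
      unfolding n by simp
  qed
  finally show ?thesis .
qed

lemma length_signature: "length xs = Suc n \<Longrightarrow> length (signature xs) = 2 ^ n"
proof -
  have "length (sign_vectors n) = 2 ^ n"
    by (induction n) auto
  then show "length xs = Suc n \<Longrightarrow> length (signature xs) = 2 ^ n"
    by (simp add: signature_eq)
qed

lemma finite_sign_lists: "finite {s :: sign list. length s = n}"
proof -
  have "finite (UNIV :: sign set)"
    by (rule finite_subset[of _ "{Minus, Null, Plus}"]) (auto intro: sign.exhaust)
  then show ?thesis
    using finite_lists_length_eq[of "UNIV :: sign set" n] by simp
qed

lemma finite_signatures: "finite (signature ` balanced_weights d)"
proof (cases d)
  case 0
  then have "balanced_weights d \<subseteq> {[]}"
    by (auto simp: balanced_weights_def sorted_weights_def)
  then show ?thesis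
    by (meson finite.emptyI finite.insertI finite_imageI finite_subset)
next
  case (Suc n)
  have "signature ` balanced_weights d \<subseteq> {s. length s = 2 ^ n}"
    using Suc by (auto simp: balanced_weights_def sorted_weights_def length_signature)
  then show ?thesis
    using finite_sign_lists by (rule finite_subset)
qed

text \<open>Lets the types, which are sets of polytopes, be counted through the sign lists that
  \<open>signature\<close> produces.\<close>

lemma bij_betw_images_if_same_fibres:
  assumes "\<And>x y. x \<in> B \<Longrightarrow> y \<in> B \<Longrightarrow> f x = f y \<longleftrightarrow> g x = g y"
  shows "bij_betw (\<lambda>z. g (inv_into B f z)) (f ` B) (g ` B)"
proof (rule bij_betw_imageI)
  have *: "g (inv_into B f (f x)) = g x" if "x \<in> B" for x
    using that assms inv_into_into[of "f x" f B] f_inv_into_f[of "f x" f B] by blast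
  show "inj_on (\<lambda>z. g (inv_into B f z)) (f ` B)"
    using * assms by (auto simp: inj_on_def)
  show "(\<lambda>z. g (inv_into B f z)) ` f ` B = g ` B"
    using * by (force simp: image_iff)
qed

section \<open>Normal forms of the sections\<close>

lemma face_lattice_iso_linear_bijection:
  fixes a b :: "real ^ 'n"
  assumes "linear f" "inj f" "\<And>x. x \<in> cube_section a \<Longrightarrow> f x \<in> cube_section b"
    and "\<And>y. y \<in> cube_section b \<Longrightarrow> \<exists>x \<in> cube_section a. f x = y"
  shows "face_lattice_iso (cube_section a) (cube_section b)"
proof -
  have "f ` cube_section a = cube_section b"
    using assms(3,4) by blast
  then show ?thesis
    using face_lattice_iso_linear_image[OF assms(1,2)] by metis
qed

text \<open>The cube is invariant under permuting and reflecting coordinates; reflecting those of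
  negative weight replaces the weights by their absolute values.\<close>

lemma face_lattice_iso_signed_permutation:
  fixes a :: "real ^ 'n" and \<tau> :: "'n \<Rightarrow> 'n"
  assumes "bij \<tau>"
  shows "face_lattice_iso (cube_section a) (cube_section (\<chi> i. \<bar>a $ \<tau> i\<bar>))"
proof -
  \<comment> \<open>A zero weight gets 1 rather than 0, so that the change of coordinates stays
    invertible.\<close>
  define \<epsilon> where "\<epsilon> j = (if a $ j < 0 then - 1 else 1 :: real)" for j
  have \<epsilon>: "\<epsilon> j * \<epsilon> j = 1" "\<bar>\<epsilon> j\<bar> = 1" "\<bar>a $ j\<bar> * \<epsilon> j = a $ j" "\<epsilon> j \<noteq> 0" for j
    by (auto simp: \<epsilon>_def)
  define f :: "real ^ 'n \<Rightarrow> real ^ 'n" where "f x = (\<chi> i. \<epsilon> (\<tau> i) * x $ \<tau> i)" for x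
  have inner: "(\<chi> i. \<bar>a $ \<tau> i\<bar>) \<bullet> f x = a \<bullet> x" for x
  proof -
    have "(\<chi> i. \<bar>a $ \<tau> i\<bar>) \<bullet> f x = (\<Sum>i\<in>UNIV. a $ \<tau> i * x $ \<tau> i)"
      unfolding inner_vec_def f_def by (simp add: mult.assoc[symmetric] \<epsilon>(3))
    also have "\<dots> = a \<bullet> x"
      unfolding inner_vec_def using sum.reindex_bij_betw[OF assms, of "\<lambda>i. a $ i * x $ i"] by simp
    finally show ?thesis .
  qed
  show ?thesis
  proof (rule face_lattice_iso_linear_bijection[of f])
    show "linear f"
      by (rule linearI) (simp_all add: f_def vec_eq_iff algebra_simps)
    show "inj f"
    proof (rule injI)
      fix x y
      assume "f x = f y"
      then have "x $ \<tau> i = y $ \<tau> i" for i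
        using \<epsilon>(4) by (simp add: f_def vec_eq_iff)
      then show "x = y"
        using assms by (metis vec_eq_iff bij_pointE)
    qed
    show "f x \<in> cube_section (\<chi> i. \<bar>a $ \<tau> i\<bar>)" if "x \<in> cube_section a" for x
      using that unfolding mem_cube_section inner by (simp add: f_def abs_mult \<epsilon>(2))
    show "\<exists>x\<in>cube_section a. f x = y" if y: "y \<in> cube_section (\<chi> i. \<bar>a $ \<tau> i\<bar>)" for y
    proof
      let ?x = "(\<chi> j. \<epsilon> j * y $ inv \<tau> j) :: real ^ 'n"
      show "f ?x = y"
        using assms \<epsilon>(1) by (simp add: f_def vec_eq_iff bij_is_inj mult.assoc[symmetric])
      then show "?x \<in> cube_section a"
        using y inner[of ?x] unfolding mem_cube_section by (simp add: abs_mult \<epsilon>(2))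
    qed
  qed
qed

text \<open>When weight \<open>k\<close> dominates, the bound on \<open>x $ k\<close> follows from
  the other bounds, so the section projects bijectively along axis \<open>k\<close> onto the
  coordinate section \<open>x $ k = 0\<close>.\<close>

lemma face_lattice_iso_parallelepiped:
  fixes a :: "real ^ 'n"
  assumes pos: "0 < a $ k" and nonneg: "\<And>i. 0 \<le> a $ i" and le: "(\<Sum>i\<in>-{k}. a $ i) \<le> a $ k"
  shows "face_lattice_iso (cube_section a) (cube_section (axis k 1))"
proof -
  \<comment> \<open>On the section this is the projection; the entry
    \<open>(a \<bullet> x) / a $ k\<close> makes the map injective on the whole space.\<close>
  define f :: "real ^ 'n \<Rightarrow> real ^ 'n" where "f x = (\<chi> i. if i = k then (a \<bullet> x) / a $ k else x $ i)" for x
  have split: "a \<bullet> x = a $ k * x $ k + (\<Sum>i\<in>-{k}. a $ i * x $ i)" for x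
    unfolding inner_vec_def by (subst sum.remove[of _ k]) (auto simp: Compl_eq_Diff_UNIV)
  have axis: "axis k 1 \<bullet> x = x $ k" for x :: "real ^ 'n"
    by (simp add: inner_axis' )
  show ?thesis
  proof (rule face_lattice_iso_linear_bijection[of f])
    show "linear f"
      by (rule linearI) (simp_all add: f_def vec_eq_iff inner_simps add_divide_distrib)
    show "inj f"
    proof (rule injI)
      fix x y
      assume "f x = f y"
      then have *: "i \<noteq> k \<longrightarrow> x $ i = y $ i" "a \<bullet> x = a \<bullet> y" for i
        using pos by (auto simp: f_def vec_eq_iff split: if_splits)
      then have "(\<Sum>i\<in>-{k}. a $ i * x $ i) = (\<Sum>i\<in>-{k}. a $ i * y $ i)"
        by (intro sum.cong) auto
      then have "x $ k = y $ k"
        using *(2) pos unfolding split by simp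
      then show "x = y"
        using * by (metis vec_eq_iff)
    qed
    show "f x \<in> cube_section (axis k 1)" if "x \<in> cube_section a" for x
      using that by (simp add: mem_cube_section axis f_def)
    show "\<exists>x\<in>cube_section a. f x = y" if y: "y \<in> cube_section (axis k 1)" for y
    proof
      define S where "S = (\<Sum>i\<in>-{k}. a $ i * y $ i)"
      let ?x = "(\<chi> i. if i = k then - S / a $ k else y $ i) :: real ^ 'n"
      have y': "\<bar>y $ i\<bar> \<le> 1" "y $ k = 0" for i
        using y by (auto simp: mem_cube_section axis)
      have "(\<Sum>i\<in>-{k}. a $ i * ?x $ i) = S"
        unfolding S_def by (intro sum.cong) auto
      then have x: "a \<bullet> ?x = 0"
        unfolding split using pos by simp
      have "\<bar>S\<bar> \<le> (\<Sum>i\<in>-{k}. \<bar>a $ i * y $ i\<bar>)"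
        unfolding S_def by (rule sum_abs)
      also have "\<dots> \<le> (\<Sum>i\<in>-{k}. a $ i)"
        using y'(1) nonneg by (intro sum_mono) (simp add: abs_mult mult_left_le)
      finally have "\<bar>- S / a $ k\<bar> \<le> 1"
        using le pos by (simp add: divide_le_eq_1)
      then show "?x \<in> cube_section a"
        using x y'(1) by (simp add: mem_cube_section)
      show "f ?x = y"
        using x y'(2) by (simp add: f_def vec_eq_iff)
    qed
  qed
qed

text \<open>Every facet of the cube gives a nonempty face of a balanced section, and the facet map
  is onto by finiteness; but the facet \<open>(k, True)\<close> misses the hyperplane
  \<open>x $ k = 0\<close>.\<close>

lemma not_face_lattice_iso_parallelepiped:
  fixes b :: "real ^ 'n" and k :: 'n
  assumes "balanced b"
  shows "\<not> face_lattice_iso (cube_section b) (cube_section (axis k 1))"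
proof
  assume "face_lattice_iso (cube_section b) (cube_section (axis k 1))"
  then obtain \<phi> where inj: "inj \<phi>"
    and nerve: "\<And>T. section_face b T = {} \<longleftrightarrow> section_face (axis k 1 :: real ^ 'n) (\<phi> ` T) = {}"
    using facet_map_of_iso[OF assms] by metis
  obtain e where e: "\<phi> e = (k, True)"
    using finite_UNIV_inj_surj[OF finite_class.finite_UNIV inj] by (metis surjD)
  have "section_face b {e} \<noteq> {}"
    using section_face_singleton[OF assms, of "fst e" "snd e"] by auto
  then have "section_face (axis k 1 :: real ^ 'n) {(k, True)} \<noteq> {}"
    using nerve[of "{e}"] e by simp
  then show False
    by (auto simp: section_face_def mem_cube_section agrees_def inner_axis')
qed

lemma central_cube_sections_eq: "central_cube_sections TYPE('n::finite) = cube_section ` (- {0 :: real ^ 'n})"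
  unfolding central_cube_sections_def linear_hyperplane_def cube_section_def by blast

text \<open>The numbering \<open>h\<close> of the coordinates turns lists of weights into vectors,
  the number 0 marking the coordinate of largest weight. The successor accounts for the
  parallelepiped, the common type of all unbalanced weights.\<close>

lemma card_combinatorial_types:
  assumes d: "CARD('n::finite) = d"
  shows "card (combinatorial_type ` central_cube_sections TYPE('n)) = Suc (card (signature ` balanced_weights d))"
proof -
  have d0: "0 < d"
    using d by (metis zero_less_card_finite)
  obtain h :: "'n \<Rightarrow> nat" where h: "bij_betw h UNIV {..<d}"
    using ex_bij_betw_finite_nat[of "UNIV :: 'n set"] d by (auto simp: atLeast0LessThan)
  have h_less: "h i < d" for i
    using h by (auto simp: bij_betw_def)
  obtain k where k: "h k = 0"
    using h d0 by (metis bij_betw_iff_bijections lessThan_iff)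
  define w :: "real list \<Rightarrow> real ^ 'n" where "w xs = (\<chi> i. xs ! h i)" for xs
  have sum_w: "(\<Sum>i\<in>UNIV. w xs $ i) = sum_list xs" if "length xs = d" for xs
    using sum.reindex_bij_betw[OF h, of "\<lambda>k. xs ! k"] that
    by (simp add: w_def sum_list_sum_nth atLeast0LessThan)
  have w_k: "w xs $ k = hd xs" if "length xs = d" for xs
    using that d0 k by (simp add: w_def hd_conv_nth flip: length_greater_0_conv)
  have w_rest: "(\<Sum>i\<in>-{k}. w xs $ i) = sum_list (tl xs)" if "length xs = d" for xs
  proof -
    have "(\<Sum>i\<in>UNIV. w xs $ i) = w xs $ k + (\<Sum>i\<in>-{k}. w xs $ i)"
      by (subst sum.remove[of _ k]) (auto simp: Compl_eq_Diff_UNIV)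
    moreover have "sum_list xs = hd xs + sum_list (tl xs)"
      using that d0 by (cases xs) auto
    ultimately show ?thesis
      using sum_w[OF that] w_k[OF that] by simp
  qed
  have w_nonneg: "0 \<le> w xs $ i" if "xs \<in> sorted_weights d" for xs i
    using that h_less[of i] by (auto simp: sorted_weights_def w_def)
  have w_desc: "descending h (($) (w xs))" if "xs \<in> sorted_weights d" for xs
    unfolding descending_def
  proof (intro allI impI)
    fix i j
    assume "h i \<le> h j"
    then show "w xs $ j \<le> w xs $ i"
      using that h_less[of j] sorted_wrt_nth_less[of "(\<ge>)" xs "h i" "h j"]
      by (cases "h i = h j") (auto simp: sorted_weights_def w_def)
  qed
  have w_balanced: "balanced (w xs)" if xs: "xs \<in> balanced_weights d" for xs
    unfolding balanced_def
  proof (intro allI conjI)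
    fix i
    have xs': "xs \<in> sorted_weights d" "length xs = d" "hd xs < sum_list (tl xs)"
      using xs by (auto simp: balanced_weights_def sorted_weights_def)
    show "0 \<le> w xs $ i"
      by (rule w_nonneg[OF xs'(1)])
    have "w xs $ i \<le> w xs $ k"
      using w_desc[OF xs'(1)] k by (simp add: descending_def)
    moreover have "sum_list xs = hd xs + sum_list (tl xs)"
      using xs'(2) d0 by (cases xs) auto
    ultimately show "2 * w xs $ i < (\<Sum>j\<in>UNIV. w xs $ j)"
      using xs'(3) w_k[OF xs'(2)] sum_w[OF xs'(2)] by linarith
  qed
  \<comment> \<open>The absolute values of the weights are sorted; as \<open>a \<noteq> 0\<close>,
    the largest one is positive, which the parallelepiped case requires.\<close>
  have iso_sorted: "\<exists>xs \<in> sorted_weights d. 0 < hd xs \<and> face_lattice_iso (cube_section a) (cube_section (w xs))"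
    if a: "a \<noteq> 0" for a :: "real ^ 'n"
  proof -
    obtain ks where ks: "set ks = (UNIV :: 'n set)" "distinct ks"
      using finite_distinct_list[OF finite_class.finite_UNIV] by blast
    define js where "js = sort_key (\<lambda>i. - \<bar>a $ i\<bar>) ks"
    have js: "set js = UNIV" "distinct js" "length js = d" "sorted (map (\<lambda>i. - \<bar>a $ i\<bar>) js)"
      using ks d distinct_card[of ks] by (auto simp: js_def)
    define xs where "xs = map (\<lambda>i. \<bar>a $ i\<bar>) js"
    have "sorted_wrt (\<ge>) xs"
      using js(4) unfolding xs_def sorted_wrt_map by simp
    then have xs: "xs \<in> sorted_weights d"
      using js(3) by (auto simp: sorted_weights_def xs_def)
    define \<tau> where "\<tau> i = js ! h i" for i
    have "bij_betw ((!) js) {..<d} UNIV"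
      using bij_betw_nth[OF js(2)] js(1,3) by simp
    from bij_betw_trans[OF h this] have "bij \<tau>"
      unfolding \<tau>_def[abs_def] comp_def .
    then have "face_lattice_iso (cube_section a) (cube_section (\<chi> i. \<bar>a $ \<tau> i\<bar>))"
      by (rule face_lattice_iso_signed_permutation)
    moreover have w_xs: "w xs = (\<chi> i. \<bar>a $ \<tau> i\<bar>)"
      using h_less js(3) by (simp add: w_def xs_def \<tau>_def)
    moreover have "0 < hd xs"
    proof (rule ccontr)
      assume *: "\<not> 0 < hd xs"
      have "w xs $ i \<le> w xs $ k" for i
        using w_desc[OF xs] k by (simp add: descending_def)
      moreover have "w xs $ k = hd xs"
        using xs by (intro w_k) (simp add: sorted_weights_def)
      ultimately have "w xs $ i \<le> 0" for i
        using * by (metis order_trans not_less)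
      then have "a $ \<tau> i = 0" for i
        unfolding w_xs by simp
      then have "a $ j = 0" for j
        using \<open>bij \<tau>\<close> by (metis bij_pointE)
      then show False
        using a by (simp add: vec_eq_iff)
    qed
    ultimately show ?thesis
      using xs by metis
  qed
  let ?type = "\<lambda>a :: real ^ 'n. combinatorial_type (cube_section a)"
  have type_eq: "?type a = ?type b \<longleftrightarrow> face_lattice_iso (cube_section a) (cube_section b)" for a b
    by (rule combinatorial_type_eq_iff[OF polytope_cube_section])
  have "combinatorial_type ` central_cube_sections TYPE('n)
      = insert (?type (axis k 1)) ((\<lambda>xs. ?type (w xs)) ` balanced_weights d)"
    unfolding central_cube_sections_eq image_image
  proof (intro subset_antisym subsetI)
    fix t
    assume "t \<in> ?type ` (- {0})"
    then obtain a :: "real ^ 'n" where a: "a \<noteq> 0" "t = ?type a"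
      by auto
    obtain xs where xs: "xs \<in> sorted_weights d" "0 < hd xs" "t = ?type (w xs)"
      using iso_sorted[OF a(1)] a(2) type_eq by blast
    have len: "length xs = d"
      using xs by (simp add: sorted_weights_def)
    show "t \<in> insert (?type (axis k 1)) ((\<lambda>xs. ?type (w xs)) ` balanced_weights d)"
    proof (cases "hd xs < sum_list (tl xs)")
      case True
      then show ?thesis
        using xs by (auto simp: balanced_weights_def)
    next
      case False
      then have "face_lattice_iso (cube_section (w xs)) (cube_section (axis k 1))"
        using xs(2) w_nonneg[OF xs(1)] w_k[OF len] w_rest[OF len]
        by (intro face_lattice_iso_parallelepiped) auto
      then show ?thesis
        using xs(3) type_eq by auto
    qed
  next
    fix t
    assume "t \<in> insert (?type (axis k 1)) ((\<lambda>xs. ?type (w xs)) ` balanced_weights d)"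
    then consider "t = ?type (axis k 1)" | xs where "xs \<in> balanced_weights d" "t = ?type (w xs)"
      by auto
    then show "t \<in> ?type ` (- {0})"
    proof cases
      case 1
      have "axis k 1 \<noteq> (0 :: real ^ 'n)"
        by (simp add: axis_eq_0_iff)
      then show ?thesis
        using 1 by blast
    next
      case 2
      have "w xs \<noteq> 0"
        using w_balanced[OF 2(1)] by (auto simp: balanced_def)
      then show ?thesis
        using 2 by blast
    qed
  qed
  moreover have "?type (axis k 1) \<notin> (\<lambda>xs. ?type (w xs)) ` balanced_weights d"
  proof
    assume "?type (axis k 1) \<in> (\<lambda>xs. ?type (w xs)) ` balanced_weights d"
    then obtain xs where "xs \<in> balanced_weights d" "?type (w xs) = ?type (axis k 1)"
      by auto
    then show False
      using not_face_lattice_iso_parallelepiped[OF w_balanced] type_eq by blast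
  qed
  moreover have same: "same_signs (w xs) (w ys) \<longleftrightarrow> signature xs = signature ys"
    if len: "length xs = d" "length ys = d" for xs ys
  proof -
    have inner: "w zs \<bullet> (\<chi> i. of_int (v ! h i)) = dot v zs" if "length zs = d" "length v = d" for zs v
      using sum.reindex_bij_betw[OF h, of "\<lambda>k. of_int (v ! k) * zs ! k"] that
      by (simp add: inner_vec_def w_def dot_eq_sum mult.commute)
    \<comment> \<open>The numbering identifies cube vertices with sign lists, which turns
      \<open>same_signs\<close> into equality of signatures.\<close>
    have vertices: "cube_vertices = (\<lambda>v. (\<chi> i. of_int (v ! h i)) :: real ^ 'n) ` set (sign_vectors d)"
    proof (intro subset_antisym subsetI)
      fix u :: "real ^ 'n"
      assume u: "u \<in> cube_vertices"
      define v where "v = map (\<lambda>m. if u $ inv_into UNIV h m = 1 then 1 else - 1 :: int) [0..<d]"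
      have "inv_into UNIV h (h i) = i" for i
        using h by (simp add: bij_betw_def)
      moreover have "u $ i = 1 \<or> u $ i = - 1" for i
        using u by (simp add: cube_vertices_def)
      ultimately have "u = (\<chi> i. of_int (v ! h i))"
        using h_less by (auto simp: vec_eq_iff v_def)
      moreover have "v \<in> set (sign_vectors d)"
        by (auto simp: set_sign_vectors v_def)
      ultimately show "u \<in> (\<lambda>v. (\<chi> i. of_int (v ! h i)) :: real ^ 'n) ` set (sign_vectors d)"
        by blast
    next
      fix u
      assume "u \<in> (\<lambda>v. (\<chi> i. of_int (v ! h i)) :: real ^ 'n) ` set (sign_vectors d)"
      then obtain v where v: "u = (\<chi> i. of_int (v ! h i))" "length v = d" "set v \<subseteq> {1, - 1}"
        by (auto simp: set_sign_vectors)
      have "v ! h i = 1 \<or> v ! h i = - 1" for i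
        using v(2,3) h_less[of i] nth_mem by fastforce
      then have "real_of_int (v ! h i) = 1 \<or> real_of_int (v ! h i) = - 1" for i
        by (metis of_int_1 of_int_minus)
      then show "u \<in> cube_vertices"
        unfolding cube_vertices_def v(1) by simp
    qed
    have "same_signs (w xs) (w ys) \<longleftrightarrow> (\<forall>v \<in> set (sign_vectors d). sgn (dot v xs) = sgn (dot v ys))"
      unfolding same_signs_def vertices using inner len by (simp add: set_sign_vectors)
    then show ?thesis
      by (simp add: signature_eq_iff[OF len d0] sign_of_eq_iff)
  qed
  have "?type (w xs) = ?type (w ys) \<longleftrightarrow> signature xs = signature ys"
    if xy: "xs \<in> balanced_weights d" "ys \<in> balanced_weights d" for xs ys
  proof -
    have "xs \<in> sorted_weights d" "ys \<in> sorted_weights d" "length xs = d" "length ys = d"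
      using xy by (auto simp: balanced_weights_def sorted_weights_def)
    then show ?thesis
      using face_lattice_iso_iff_same_signs[OF w_balanced w_balanced w_desc w_desc] xy same type_eq by simp
  qed
  then have "bij_betw (\<lambda>z. signature (inv_into (balanced_weights d) (\<lambda>xs. ?type (w xs)) z))
      ((\<lambda>xs. ?type (w xs)) ` balanced_weights d) (signature ` balanced_weights d)"
    by (rule bij_betw_images_if_same_fibres)
  then have "card ((\<lambda>xs. ?type (w xs)) ` balanced_weights d) = card (signature ` balanced_weights d)"
    and "finite ((\<lambda>xs. ?type (w xs)) ` balanced_weights d)"
    using finite_signatures by (auto dest: bij_betw_same_card bij_betw_finite)
  ultimately show ?thesis
    by simp
qed

section \<open>Counting sign patterns\<close>

type_synonym rule = "int \<times> int \<times> int list"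

text \<open>The cone of descending nonnegative vectors is generated by the vectors
  \<open>(1,..,1,0,..,0)\<close>, on which a linear form takes its partial sums as values.\<close>

fun nonpos_sums :: "int \<Rightarrow> int list \<Rightarrow> bool" where
  "nonpos_sums s [] = True"
| "nonpos_sums s (c # cs) = (s + c \<le> 0 \<and> nonpos_sums (s + c) cs)"

text \<open>Stops at the end of the shorter list, so a rule may omit trailing zero
  coefficients.\<close>

fun add_multiples :: "int list \<Rightarrow> int list list \<Rightarrow> int list \<Rightarrow> int list" where
  "add_multiples (c # cs) (v # vs) w = add_multiples cs vs (map2 (\<lambda>x y. c * x + y) v w)"
| "add_multiples cs vs w = w"

text \<open>A rule \<open>(m, c, cs)\<close> for a vertex \<open>v\<close> preceded by the vertices \<open>vs\<close> (latest first) certifies that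
  \<open>m * v + c * (- 1, 1, \<dots>, 1) + \<Sum> cs\<^sub>j * vs\<^sub>j\<close> is nonpositive on all descending nonnegative weights.\<close>

definition valid_rule :: "nat \<Rightarrow> int list list \<Rightarrow> int list \<Rightarrow> rule \<Rightarrow> bool" where
  "valid_rule n vs v = (\<lambda>(m, c, cs). m \<noteq> 0 \<and> 0 \<le> c \<and> length cs \<le> length vs \<and>
     nonpos_sums 0 (add_multiples cs vs (map2 (\<lambda>x y. m * x + c * y) v (- 1 # replicate n 1))))"

text \<open>Checked rows are put in front of \<open>vs\<close>, so the first coefficient of a rule
  refers to the row directly above.\<close>

fun valid_table :: "nat \<Rightarrow> int list list \<Rightarrow> (int list \<times> rule list) list \<Rightarrow> bool" where
  "valid_table n vs [] = True"
| "valid_table n vs ((v, rs) # tab) =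
    (length v = Suc n \<and> list_all (valid_rule n vs v) rs \<and> valid_table n (v # vs) tab)"

text \<open>\<open>Minus\<close>: the rule does not apply; \<open>Null\<close>, \<open>Plus\<close>: it applies weakly, strictly.\<close>

fun strength :: "sign list \<Rightarrow> sign list \<Rightarrow> bool \<Rightarrow> sign" where
  "strength (Null # cs) (t # ts) b = strength cs ts b"
| "strength (Plus # cs) (Plus # ts) b = strength cs ts True"
| "strength (Plus # cs) (Null # ts) b = strength cs ts b"
| "strength (Plus # cs) (Minus # ts) b = Minus"
| "strength (Minus # cs) (Plus # ts) b = Minus"
| "strength (Minus # cs) (Null # ts) b = strength cs ts b"
| "strength (Minus # cs) (Minus # ts) b = strength cs ts True"
| "strength [] ts True = Plus"
| "strength [] ts False = Null"
| "strength (c # cs) [] b = Minus"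

text \<open>The triples record which of the signs \<open>Minus\<close>, \<open>Null\<close>, \<open>Plus\<close> are still possible.\<close>

fun exclude :: "bool \<Rightarrow> sign \<Rightarrow> bool \<times> bool \<times> bool \<Rightarrow> bool \<times> bool \<times> bool" where
  "exclude d Minus q = q"
| "exclude True Null (n, z, p) = (n, z, False)"
| "exclude True Plus (n, z, p) = (n, False, False)"
| "exclude False Null (n, z, p) = (False, z, p)"
| "exclude False Plus (n, z, p) = (False, False, p)"

fun possible :: "(bool \<times> bool \<times> sign list) list \<Rightarrow> sign list \<Rightarrow> bool \<times> bool \<times> bool \<Rightarrow> bool \<times> bool \<times> bool" where
  "possible [] ts q = q"
| "possible ((d, b, cs) # rs) ts q = possible rs ts (exclude d (strength cs ts b) q)"

text \<open>Counts the leaves of the search tree below a node at which the signs \<open>ts\<close>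
  have been chosen, latest first.\<close>

fun count_signs :: "(bool \<times> bool \<times> sign list) list list \<Rightarrow> sign list \<Rightarrow> int" where
  "count_signs [] ts = 1"
| "count_signs (r # rs) ts = (case possible r ts (True, True, True) of (n, z, p) \<Rightarrow>
    (if n then count_signs rs (Minus # ts) else 0) + (if z then count_signs rs (Null # ts) else 0)
   + (if p then count_signs rs (Plus # ts) else 0))"

text \<open>Whether a rule fires, and with which effect, depends only on the signs of its entries;
  their sizes matter for its validity alone. The search therefore runs without arithmetic on
  coefficients.\<close>

definition compile_rule :: "rule \<Rightarrow> bool \<times> bool \<times> sign list" where
  "compile_rule = (\<lambda>(m, c, cs). (0 < m, 0 < c, map sign_of cs))"

definition compile :: "(int list \<times> rule list) list \<Rightarrow> (bool \<times> bool \<times> sign list) list list" where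
  "compile = map (\<lambda>(v, rs). map compile_rule rs)"

fun admits :: "bool \<times> bool \<times> bool \<Rightarrow> sign \<Rightarrow> bool" where
  "admits (n, z, p) Minus = n"
| "admits (n, z, p) Null = z"
| "admits (n, z, p) Plus = p"

section \<open>Soundness of the certificates\<close>

text \<open>Summation by parts: \<open>s\<close> is the partial sum so far and \<open>y\<close>
  bounds the remaining weights. As \<open>s \<le> 0\<close>, lowering \<open>y\<close> to the next
  weight can only increase the left-hand side.\<close>

lemma dot_nonpos:
  fixes xs :: "real list"
  assumes "length w = length xs" "sorted_wrt (\<ge>) xs" "\<forall>x\<in>set xs. 0 \<le> x" "nonpos_sums s w" "s \<le> 0"
    and "0 \<le> y" "\<forall>x\<in>set xs. x \<le> y"
  shows "of_int s * y + dot w xs \<le> 0"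
  using assms
proof (induction w xs arbitrary: s y rule: list_induct2)
  case Nil
  then show ?case
    by (simp add: mult_nonpos_nonneg)
next
  case (Cons c cs x xs)
  have "of_int (s + c) * x + dot cs xs \<le> 0"
    using Cons.prems by (intro Cons.IH) auto
  moreover have "of_int s * y \<le> of_int s * x"
    using Cons.prems by (intro mult_left_mono_neg) auto
  ultimately show ?case
    by (simp add: algebra_simps)
qed

lemma dot_map2:
  assumes "length v = length xs" "length w = length xs"
  shows "dot (map2 (\<lambda>x y. c * x + e * y) v w) xs = of_int c * dot v xs + of_int e * dot w xs"
  using assms
proof (induction v xs arbitrary: w rule: list_induct2)
  case (Cons x v y xs)
  then show ?case
    by (cases w) (auto simp: algebra_simps)
qed simp

lemma dot_axpy:
  assumes "length v = length xs" "length w = length xs"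
  shows "dot (map2 (\<lambda>x y. c * x + y) v w) xs = of_int c * dot v xs + dot w xs"
  using dot_map2[OF assms, of c 1] by simp

fun weighted_sum :: "int list \<Rightarrow> real list \<Rightarrow> real" where
  "weighted_sum (c # cs) (y # ys) = of_int c * y + weighted_sum cs ys"
| "weighted_sum cs ys = 0"

lemma dot_add_multiples:
  assumes "\<forall>v\<in>set vs. length v = length xs" "length w = length xs"
  shows "length (add_multiples cs vs w) = length xs \<and>
    dot (add_multiples cs vs w) xs = dot w xs + weighted_sum cs (map (\<lambda>v. dot v xs) vs)"
  using assms by (induction cs vs w rule: add_multiples.induct) (auto simp: dot_axpy)

lemma dot_replicate_one: "length xs = n \<Longrightarrow> dot (replicate n 1) xs = sum_list xs"
  by (induction xs arbitrary: n) (auto simp: replicate_Suc)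

text \<open>A rule fires only if every product of a coefficient and a value is nonnegative. The flag
  \<open>b\<close> accumulates strictness; its initial value tells whether strictness already comes
  from elsewhere.\<close>

lemma strength_sound:
  assumes "length cs \<le> length ys" "strength (map sign_of cs) (map sign_of ys) b \<noteq> Minus"
  shows "0 \<le> weighted_sum cs ys \<and>
    (strength (map sign_of cs) (map sign_of ys) b = Plus \<longrightarrow> b \<or> 0 < weighted_sum cs ys)"
  using assms
proof (induction cs ys arbitrary: b rule: weighted_sum.induct)
  case (1 c cs y ys)
  consider "c = 0" | "y = 0" "c \<noteq> 0" | "0 < c" "0 < y" | "c < 0" "y < 0" | "0 < c" "y < 0" | "c < 0" "0 < y"
    by linarith
  then show ?case
  proof cases
    case 1
    then have "sign_of c = Null"
      by (simp add: sign_of_def)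
    then show ?thesis
      using "1.IH"[of b] "1.prems" 1 by simp
  next
    case 2
    then have "sign_of c \<noteq> Null" "sign_of y = Null"
      by (simp_all add: sign_of_def)
    then show ?thesis
      using "1.IH"[of b] "1.prems" 2 by (cases "sign_of c") auto
  next
    case 3
    then have "0 < of_int c * y" "sign_of c = Plus" "sign_of y = Plus"
      by (simp_all add: sign_of_def)
    then show ?thesis
      using "1.IH"[of True] "1.prems" by auto
  next
    case 4
    then have "0 < of_int c * y" "sign_of c = Minus" "sign_of y = Minus"
      by (simp_all add: sign_of_def mult_neg_neg)
    then show ?thesis
      using "1.IH"[of True] "1.prems" by auto
  qed (use "1.prems" in \<open>auto simp: sign_of_def\<close>)
next
  case ("2_1" ys)
  then show ?case
    by (cases b) auto
next
  case ("2_2" cs)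
  then show ?case
    by (cases b) auto
qed

text \<open>The certificate makes the sum of \<open>m * v\<close>, of \<open>c\<close> times the
  balance form and of a combination of earlier vertices nonpositive. When the rule fires, the last
  two are nonnegative, which bounds \<open>m * dot v xs\<close> from above, strictly if one of them
  is positive.\<close>

lemma valid_rule_sound:
  fixes xs :: "real list"
  assumes xs: "xs \<in> balanced_weights (Suc n)" and lens: "\<forall>v\<in>set vs. length v = Suc n" "length v = Suc n"
    and valid: "valid_rule n vs v (m, c, cs)"
    and fires: "strength (map sign_of cs) (map (\<lambda>v. sign_of (dot v xs)) vs) (0 < c) \<noteq> Minus"
  shows "of_int m * dot v xs \<le> 0 \<and>
    (strength (map sign_of cs) (map (\<lambda>v. sign_of (dot v xs)) vs) (0 < c) = Plus \<longrightarrow> of_int m * dot v xs < 0)"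
proof -
  have len: "length xs = Suc n" and sorted: "sorted_wrt (\<ge>) xs" "\<forall>x\<in>set xs. 0 \<le> x"
    and bal: "hd xs < sum_list (tl xs)"
    using xs by (auto simp: balanced_weights_def sorted_weights_def)
  \<comment> \<open>The balance form, positive on balanced weights.\<close>
  let ?u = "- 1 # replicate n 1 :: int list" and ?ys = "map (\<lambda>v. dot v xs) vs"
  have u: "dot ?u xs = sum_list (tl xs) - hd xs"
    using len by (cases xs) (auto simp: dot_replicate_one)
  have signs: "map (\<lambda>v. sign_of (dot v xs)) vs = map sign_of ?ys"
    by simp
  have sum: "0 \<le> weighted_sum cs ?ys \<and>
    (strength (map sign_of cs) (map sign_of ?ys) (0 < c) = Plus \<longrightarrow> 0 < c \<or> 0 < weighted_sum cs ?ys)"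
    using valid fires unfolding signs by (intro strength_sound) (auto simp: valid_rule_def)
  define w where "w = map2 (\<lambda>x y. m * x + c * y) v ?u"
  have w: "length w = Suc n" "dot w xs = of_int m * dot v xs + of_int c * dot ?u xs"
    using lens(2) len by (auto simp: w_def dot_map2)
  have w': "length (add_multiples cs vs w) = length xs"
      "dot (add_multiples cs vs w) xs = dot w xs + weighted_sum cs ?ys"
    using dot_add_multiples[of vs xs w cs] lens(1) w(1) len by auto
  have "of_int 0 * hd xs + dot (add_multiples cs vs w) xs \<le> 0"
  proof (rule dot_nonpos[OF w'(1) sorted])
    show "nonpos_sums 0 (add_multiples cs vs w)"
      using valid by (simp add: valid_rule_def w_def)
    show "0 \<le> hd xs" "\<forall>x\<in>set xs. x \<le> hd xs"
      using sorted len by (cases xs; auto)+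
  qed simp
  then have "of_int m * dot v xs + of_int c * dot ?u xs + weighted_sum cs ?ys \<le> 0"
    using w(2) w'(2) by simp
  moreover have "0 \<le> of_int c * dot ?u xs" "0 < c \<Longrightarrow> 0 < of_int c * dot ?u xs"
    using valid bal unfolding u by (auto simp: valid_rule_def)
  ultimately show ?thesis
    using sum unfolding signs by linarith
qed

lemma exclude_sound:
  fixes y :: real
  assumes "admits q (sign_of y)" "m \<noteq> 0" "r \<noteq> Minus \<Longrightarrow> of_int m * y \<le> 0" "r = Plus \<Longrightarrow> of_int m * y < 0"
  shows "admits (exclude (0 < m) r q) (sign_of y)"
proof -
  obtain n z p where q: "q = (n, z, p)"
    by (cases q)
  consider "r = Minus" | "r = Null" "0 < m" "y \<le> 0" | "r = Null" "m < 0" "0 \<le> y"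
    | "r = Plus" "0 < m" "y < 0" | "r = Plus" "m < 0" "0 < y"
    using assms(2,3,4) by (cases r; cases "0 < m") (auto simp: mult_le_0_iff mult_less_0_iff)
  then show ?thesis
    using assms(1) by cases (auto simp: q sign_of_def split: if_splits)
qed

lemma possible_sound:
  fixes xs :: "real list"
  assumes xs: "xs \<in> balanced_weights (Suc n)" and lens: "\<forall>v\<in>set vs. length v = Suc n" "length v = Suc n"
    and valid: "list_all (valid_rule n vs v) rs" and "admits q (sign_of (dot v xs))"
  shows "admits (possible (map compile_rule rs) (map (\<lambda>v. sign_of (dot v xs)) vs) q) (sign_of (dot v xs))"
  using valid \<open>admits q _\<close>
proof (induction rs arbitrary: q)
  case (Cons r rs)
  obtain m c cs where r: "r = (m, c, cs)"
    by (cases r)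
  then have v: "valid_rule n vs v (m, c, cs)"
    using Cons.prems(1) by simp
  then have "m \<noteq> 0"
    by (simp add: valid_rule_def)
  then have "admits (exclude (0 < m) (strength (map sign_of cs) (map (\<lambda>v. sign_of (dot v xs)) vs) (0 < c)) q)
      (sign_of (dot v xs))"
    using Cons.prems(2) valid_rule_sound[OF xs lens v] by (intro exclude_sound) auto
  then show ?case
    using Cons.IH Cons.prems(1) by (simp add: r compile_rule_def)
qed simp

section \<open>Upper bound: the search tree covers all sign patterns\<close>

text \<open>The weights are restricted to those with prescribed signs \<open>ts\<close> at the
  earlier vertices. Splitting them by the sign at the next vertex mirrors the branching of
  \<open>count_signs\<close>, and by soundness no weights have an excluded sign.\<close>

lemma card_le_count_signs:
  assumes "valid_table n vs tab" "\<forall>v\<in>set vs. length v = Suc n"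
  shows "int (card ((\<lambda>xs. map (\<lambda>r. sign_of (dot (fst r) xs)) tab) `
      {xs \<in> balanced_weights (Suc n). map (\<lambda>v. sign_of (dot v xs)) vs = ts})) \<le> count_signs (compile tab) ts"
  using assms
proof (induction n vs tab arbitrary: ts rule: valid_table.induct)
  case (1 n vs)
  have "(\<lambda>xs :: real list. map (\<lambda>r. sign_of (dot (fst r) xs)) []) ` X \<subseteq> {[]}" for X
    by auto
  then show ?case
    using card_mono[of "{[] :: sign list}"] by (simp add: compile_def)
next
  case (2 n vs v rs tab)
  let ?sig = "\<lambda>tab xs. map (\<lambda>r. sign_of (dot (fst r) (xs :: real list))) tab"
  let ?X = "\<lambda>vs ts. {xs \<in> balanced_weights (Suc n). map (\<lambda>v. sign_of (dot v xs)) vs = ts}"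
  let ?A = "\<lambda>s. ?sig tab ` ?X (v # vs) (s # ts)"
  obtain a z p where azp: "possible (map compile_rule rs) ts (True, True, True) = (a, z, p)"
    using prod_cases3 by blast
  have adm: "admits (a, z, p) (sign_of (dot v xs))" if "xs \<in> ?X vs ts" for xs
  proof -
    have "admits (True, True, True) s" for s
      by (cases s) auto
    then show ?thesis
      using possible_sound[of xs n vs v rs "(True, True, True)"] that 2(2,3) azp by auto
  qed
  have IH: "int (card (?A s)) \<le> count_signs (compile tab) (s # ts)" for s
    using 2 by (intro "2.IH") auto
  have none: "?A s = {}" if "\<not> admits (a, z, p) s" for s
    using adm that by auto
  have "?sig ((v, rs) # tab) ` ?X vs ts \<subseteq> (#) Minus ` ?A Minus \<union> (#) Null ` ?A Null \<union> (#) Plus ` ?A Plus"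
  proof
    fix t
    assume "t \<in> ?sig ((v, rs) # tab) ` ?X vs ts"
    then obtain xs where xs: "xs \<in> ?X vs ts" "t = sign_of (dot v xs) # ?sig tab xs"
      by auto
    then have "t \<in> (#) (sign_of (dot v xs)) ` ?A (sign_of (dot v xs))"
      by auto
    then show "t \<in> (#) Minus ` ?A Minus \<union> (#) Null ` ?A Null \<union> (#) Plus ` ?A Plus"
      by (cases "sign_of (dot v xs)") auto
  qed
  moreover have fin: "finite (?A s)" for s
    by (rule finite_subset[OF _ finite_sign_lists[of "length tab"]]) auto
  ultimately have "card (?sig ((v, rs) # tab) ` ?X vs ts) \<le>
      card ((#) Minus ` ?A Minus \<union> (#) Null ` ?A Null \<union> (#) Plus ` ?A Plus)"
    by (intro card_mono) auto
  also have "\<dots> \<le> card ((#) Minus ` ?A Minus) + card ((#) Null ` ?A Null) + card ((#) Plus ` ?A Plus)"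
    by (meson add_mono_thms_linordered_semiring(3) card_Un_le order_trans)
  also have "\<dots> = card (?A Minus) + card (?A Null) + card (?A Plus)"
    by (simp add: card_image)
  finally have "int (card (?sig ((v, rs) # tab) ` ?X vs ts)) \<le>
      int (card (?A Minus)) + int (card (?A Null)) + int (card (?A Plus))"
    by linarith
  moreover have "count_signs (compile ((v, rs) # tab)) ts = (if a then count_signs (compile tab) (Minus # ts) else 0)
      + (if z then count_signs (compile tab) (Null # ts) else 0) + (if p then count_signs (compile tab) (Plus # ts) else 0)"
    using azp by (simp add: compile_def)
  moreover have "int (card (?A s)) \<le> (if admits (a, z, p) s then count_signs (compile tab) (s # ts) else 0)" for s
  proof (cases "admits (a, z, p) s")
    case True
    then show ?thesis
      using IH[of s] by (simp only: if_True)
  next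
    case False
    show ?thesis
      unfolding none[OF False] by (simp only: False if_False card.empty of_nat_0 order_refl)
  qed
  from this[of Minus] this[of Null] this[of Plus]
  have "int (card (?A Minus)) \<le> (if a then count_signs (compile tab) (Minus # ts) else 0)"
    "int (card (?A Null)) \<le> (if z then count_signs (compile tab) (Null # ts) else 0)"
    "int (card (?A Plus)) \<le> (if p then count_signs (compile tab) (Plus # ts) else 0)"
    by (simp_all only: admits.simps)
  ultimately show ?case
    by linarith
qed

lemma card_image_le_if_determined:
  assumes "\<And>x y. x \<in> B \<Longrightarrow> y \<in> B \<Longrightarrow> g x = g y \<Longrightarrow> f x = f y" "finite (g ` B)"
  shows "card (f ` B) \<le> card (g ` B)"
proof -
  have "f ` B \<subseteq> (\<lambda>z. f (inv_into B g z)) ` g ` B"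
  proof
    fix t
    assume "t \<in> f ` B"
    then obtain x where x: "x \<in> B" "t = f x"
      by auto
    then have "f (inv_into B g (g x)) = f x"
      using assms(1)[of "inv_into B g (g x)" x] inv_into_into[of "g x" g B] f_inv_into_f[of "g x" g B] by blast
    then show "t \<in> (\<lambda>z. f (inv_into B g z)) ` g ` B"
      using x by (auto intro!: image_eqI[where x = "g x"])
  qed
  then have "card (f ` B) \<le> card ((\<lambda>z. f (inv_into B g z)) ` g ` B)"
    using assms(2) by (intro card_mono) auto
  also have "\<dots> \<le> card (g ` B)"
    by (rule card_image_le[OF assms(2)])
  finally show ?thesis .
qed

text \<open>A table may list the vertices in any order; as it contains all those of a signature, the
  pattern along the table determines the signature.\<close>

lemma card_signatures_le:
  assumes "valid_table n [] tab" "list_all (\<lambda>v. 1 # v \<in> set (map fst tab)) (sign_vectors n)"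
  shows "int (card (signature ` balanced_weights (Suc n))) \<le> count_signs (compile tab) []"
proof -
  let ?g = "\<lambda>xs. map (\<lambda>r. sign_of (dot (fst r) (xs :: real list))) tab"
  have "finite (?g ` balanced_weights (Suc n))"
    by (rule finite_subset[OF _ finite_sign_lists[of "length tab"]]) auto
  moreover have "signature xs = signature ys"
    if xy: "xs \<in> balanced_weights (Suc n)" "ys \<in> balanced_weights (Suc n)" "?g xs = ?g ys" for xs ys
  proof -
    have "length xs = Suc n" "length ys = Suc n"
      using xy by (auto simp: balanced_weights_def sorted_weights_def)
    moreover have "sign_of (dot v xs) = sign_of (dot v ys)" if "v \<in> set (map fst tab)" for v
      using xy(3) that by (auto simp: map_eq_conv)
    ultimately show ?thesis
      using assms(2) by (simp add: signature_eq list_all_iff)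
  qed
  ultimately have "card (signature ` balanced_weights (Suc n)) \<le> card (?g ` balanced_weights (Suc n))"
    by (intro card_image_le_if_determined)
  then show ?thesis
    using card_le_count_signs[OF assms(1), of "[]"] by simp
qed

section \<open>Lower bound: integer weights with distinct signatures\<close>

text \<open>With an order on sign lists, pairwise distinctness of many signatures is checked by
  comparing neighbours only.\<close>

fun lex_less :: "sign list \<Rightarrow> sign list \<Rightarrow> bool" where
  "lex_less (Minus # xs) (Minus # ys) = lex_less xs ys"
| "lex_less (Null # xs) (Null # ys) = lex_less xs ys"
| "lex_less (Plus # xs) (Plus # ys) = lex_less xs ys"
| "lex_less (Minus # xs) (Null # ys) = True"
| "lex_less (Minus # xs) (Plus # ys) = True"
| "lex_less (Null # xs) (Plus # ys) = True"
| "lex_less [] (y # ys) = True"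
| "lex_less _ _ = False"

definition balanced_list :: "nat \<Rightarrow> int list \<Rightarrow> bool" where
  "balanced_list n xs \<longleftrightarrow> length xs = n \<and> sorted_wrt (\<ge>) xs \<and> list_all (\<lambda>x. 0 \<le> x) xs \<and> hd xs < sum_list (tl xs)"

text \<open>The representatives come in chunks, which keeps the terms small that are rewritten in each step.\<close>

fun last_signature :: "nat \<Rightarrow> sign list \<Rightarrow> int list list \<Rightarrow> sign list option" where
  "last_signature n p [] = Some p"
| "last_signature n p (x # xs) = (let s = signature x in
     if balanced_list n x \<and> lex_less p s then last_signature n s xs else None)"

text \<open>The last signature of a chunk is the bound for the next one. The initial bound will be
  \<open>[]\<close>, which lies below every nonempty list.\<close>

fun ascending :: "nat \<Rightarrow> sign list \<Rightarrow> int list list list \<Rightarrow> bool" where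
  "ascending n p [] = True"
| "ascending n p (c # cs) = (case last_signature n p c of None \<Rightarrow> False | Some s \<Rightarrow> ascending n s cs)"

lemma lex_less_irrefl: "\<not> lex_less s s"
proof (induction s)
  case (Cons a s)
  then show ?case
    by (cases a) auto
qed simp

lemma lex_less_trans: "lex_less s t \<Longrightarrow> lex_less t u \<Longrightarrow> lex_less s u"
proof (induction s arbitrary: t u)
  case Nil
  then show ?case
    by (cases t; cases u) auto
next
  case (Cons a s)
  obtain b t' where t: "t = b # t'"
    using Cons.prems(1) by (cases t; cases a) auto
  obtain c u' where u: "u = c # u'"
    using Cons.prems(2) t by (cases u; cases b) auto
  show ?case
    using Cons unfolding t u by (cases a; cases b; cases c) auto
qed

lemma last_signature_sound:
  assumes "last_signature n p xs = Some q"
  shows "(\<forall>x\<in>set xs. balanced_list n x) \<and> sorted_wrt lex_less (p # map signature xs) \<and>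
    (\<forall>s\<in>set (p # map signature xs). s = q \<or> lex_less s q)"
  using assms
proof (induction xs arbitrary: p)
  case (Cons x xs)
  then have "balanced_list n x" "lex_less p (signature x)" "last_signature n (signature x) xs = Some q"
    by (auto simp: Let_def split: if_splits)
  then show ?case
    using Cons.IH[of "signature x"] by (auto intro: lex_less_trans)
qed simp

lemma ascending_sound:
  assumes "ascending n p cs"
  shows "(\<forall>x\<in>set (concat cs). balanced_list n x) \<and> sorted_wrt lex_less (p # map signature (concat cs))"
  using assms
proof (induction cs arbitrary: p)
  case (Cons c cs)
  then obtain q where q: "last_signature n p c = Some q" "ascending n q cs"
    by (auto split: option.splits)
  note 1 = last_signature_sound[OF q(1)] and 2 = Cons.IH[OF q(2)]
  have "lex_less s t" if "s \<in> set (p # map signature c)" "t \<in> set (map signature (concat cs))" for s t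
    using 1 2 that by (metis lex_less_trans sorted_wrt.simps(2))
  then show ?case
    using 1 2 by (auto simp: sorted_wrt_append)
qed simp

lemma sign_of_of_int: "sign_of (of_int x :: 'a::linordered_idom) = sign_of x"
  by (simp add: sign_of_def)

lemma vertex_signs_of_int:
  "vertex_signs (of_int s :: 'a::linordered_idom) (map of_int xs) = vertex_signs s xs"
proof (induction s xs rule: vertex_signs.induct)
  case (2 s x xs)
  then show ?case
    by (metis (no_types) list.simps(9) of_int_add of_int_diff vertex_signs.simps(2))
qed (simp add: sign_of_of_int)

text \<open>A strictly increasing list has no repetitions, and embedding integer weights into the
  reals preserves balance and signature.\<close>

lemma card_signatures_ge:
  assumes "ascending (Suc n) [] cs"
  shows "length (concat cs) \<le> card (signature ` balanced_weights (Suc n))"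
proof -
  have *: "\<forall>x\<in>set (concat cs). balanced_list (Suc n) x" "sorted_wrt lex_less (map signature (concat cs))"
    using ascending_sound[OF assms] by auto
  have "distinct (map signature (concat cs))"
  proof -
    have "distinct l" if "sorted_wrt lex_less l" for l
      using that by (induction l) (auto simp: lex_less_irrefl)
    then show ?thesis
      using *(2) .
  qed
  then have "length (concat cs) = card (set (map signature (concat cs)))"
    by (metis distinct_card length_map)
  also have "\<dots> \<le> card (signature ` balanced_weights (Suc n))"
  proof (rule card_mono[OF finite_signatures], rule subsetI)
    fix s
    assume "s \<in> set (map signature (concat cs))"
    then obtain x where x: "x \<in> set (concat cs)" "s = signature x"
      by auto
    then have bal: "balanced_list (Suc n) x"
      using *(1) by blast
    let ?x = "map of_int x :: real list"
    have "x \<noteq> []"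
      using bal by (auto simp: balanced_list_def)
    have "real_of_int (sum_list l) = sum_list (map of_int l)" for l
      by (induction l) auto
    then have "hd ?x < sum_list (tl ?x)"
      using bal \<open>x \<noteq> []\<close> by (metis balanced_list_def hd_map map_tl of_int_less_iff)
    then have "?x \<in> balanced_weights (Suc n)"
      using bal by (auto simp: balanced_list_def balanced_weights_def sorted_weights_def sorted_wrt_map list_all_iff)
    moreover have "signature ?x = s"
      using vertex_signs_of_int[of "hd x" "tl x", where 'a = real] \<open>x \<noteq> []\<close>
      by (simp add: signature_def x(2) hd_map map_tl)
    ultimately show "s \<in> signature ` balanced_weights (Suc n)"
      by blast
  qed
  finally show ?thesis .
qed

section \<open>Matching the bounds: tables and representatives\<close>

lemma card_combinatorial_types_eq:
  assumes "CARD('n::finite) = d" "d = Suc n"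
    and "valid_table n [] tab" "list_all (\<lambda>v. 1 # v \<in> set (map fst tab)) (sign_vectors n)"
    and "count_signs (compile tab) [] = int N" "ascending d [] cs" "length (concat cs) = N" "M = Suc N"
  shows "card (combinatorial_type ` central_cube_sections TYPE('n)) = M"
proof -
  have "card (signature ` balanced_weights (Suc n)) = N"
    using card_signatures_le[OF assms(3,4)] card_signatures_ge[of n cs] assms(2,5,6,7) by simp
  then show ?thesis
    using card_combinatorial_types[OF assms(1)] assms(2,8) by simp
qed

text \<open>The rows list the vertices with first coordinate 1; the rules of a row exclude all signs that are
  not realised together with the signs chosen before.\<close>

definition table3 :: "(int list \<times> rule list) list" where
  "table3 = [([1,1,1], [(-1,1,[])]), ([1,1,-1], [(-1,1,[])]), ([1,-1,1], [(-1,1,[])]),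
    ([1,-1,-1], [(1,1,[])])]"

text \<open>The regular hexagon; with the parallelogram it makes up the two types for
  \<open>d = 3\<close>.\<close>

definition weights3 :: "int list list list" where
  "weights3 = [[[1,1,1]]]"

lemma valid_table3: "valid_table 2 [] table3"
  by code_simp

lemma table3_complete: "list_all (\<lambda>v. 1 # v \<in> set (map fst table3)) (sign_vectors 2)"
  by code_simp

lemma count_table3: "count_signs (compile table3) [] = 1"
  by code_simp

lemma ascending_weights3: "ascending 3 [] weights3"
  by code_simp

lemma length_weights3: "length (concat weights3) = 1"
  by code_simp

text \<open>An example of a conditional rule: in the row \<open>[1,-1,1,-1]\<close>,
  \<open>(1,0,[-1])\<close> expresses that the value is at most that of the row
  \<open>[1,1,-1,-1]\<close> above. Hence it cannot be positive if the latter is zero.\<close>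

definition table4 :: "(int list \<times> rule list) list" where
  "table4 = [([1,1,1,1], [(-1,1,[])]), ([1,1,1,-1], [(-1,1,[])]), ([1,1,-1,1], [(-1,1,[])]),
    ([1,-1,1,1], [(-1,1,[])]), ([1,-1,-1,-1], [(1,1,[])]), ([1,1,-1,-1], [(-1,0,[])]),
    ([1,-1,1,-1], [(-1,0,[]), (1,0,[-1])]), ([1,-1,-1,1], [(1,0,[-1]), (-1,0,[-1])])]"

text \<open>\<open>[1,1,1,1]\<close> gives the octahedron and \<open>[1,1,1,0]\<close> the prism
  over a hexagon.\<close>

definition weights4 :: "int list list list" where
  "weights4 = [[[1,1,1,1], [2,2,1,1], [1,1,1,0], [3,2,2,1], [2,1,1,1]]]"

lemma valid_table4: "valid_table 3 [] table4"
  by code_simp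

lemma table4_complete: "list_all (\<lambda>v. 1 # v \<in> set (map fst table4)) (sign_vectors 3)"
  by code_simp

lemma count_table4: "count_signs (compile table4) [] = 5"
  by code_simp

lemma ascending_weights4: "ascending 4 [] weights4"
  by code_simp

lemma length_weights4: "length (concat weights4) = 5"
  by code_simp

text \<open>The multiplier in \<open>(-3,1,[])\<close> is the least that works: the entries of
  \<open>[1,1,1,-1,-1]\<close> sum to 1 and those of \<open>[-1,1,1,1,1]\<close> to 3, so with a
  smaller one the last partial sum would be positive.\<close>

definition table5 :: "(int list \<times> rule list) list" where
  "table5 = [([1,1,1,1,1], [(-1,1,[])]), ([1,1,1,1,-1], [(-1,1,[])]), ([1,1,1,-1,1], [(-1,1,[])]),
    ([1,1,1,-1,-1], [(-3,1,[])]), ([1,1,-1,1,1], [(-1,1,[])]), ([1,1,-1,1,-1], [(-3,1,[])]),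
    ([1,-1,1,1,1], [(-1,1,[])]), ([1,-1,1,1,-1], [(-3,1,[])]), ([1,-1,-1,-1,-1], [(1,1,[])]),
    ([1,1,-1,-1,1], [(-1,0,[])]), ([1,-1,1,-1,1], [(-1,0,[]), (1,0,[-1])]),
    ([1,1,-1,-1,-1], [(-1,0,[-2,1]), (1,0,[0,-1])]), ([1,-1,1,-1,-1], [(1,0,[-1]), (-1,0,[0,-1]),
    (1,0,[0,-1])]), ([1,-1,-1,1,1], [(-1,0,[-1]), (1,0,[0,0,-1])]), ([1,-1,-1,-1,1], [(1,0,[0,-1]),
    (2,1,[-1])]), ([1,-1,-1,1,-1], [(1,0,[0,0,-1]), (-1,0,[1]), (1,0,[0,-1]), (-1,0,[0,0,0,0,-1]),
    (1,0,[0,-1,-1,0,1])])]"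

definition weights5 :: "int list list list" where
  "weights5 = [[[1,1,1,1,0], [1,1,1,1,1], [3,3,2,2,2], [2,2,2,1,1], [4,3,3,2,2], [3,2,2,2,1],
    [2,1,1,1,1], [2,2,1,1,0], [2,2,1,1,1], [3,3,2,1,1], [5,4,3,2,2]], [[4,3,2,2,1], [3,2,1,1,1],
    [1,1,1,0,0], [4,3,3,1,1], [3,2,2,1,0], [3,2,2,1,1], [5,3,3,2,1], [4,2,2,1,1], [2,1,1,1,0],
    [5,2,2,2,1], [3,1,1,1,1]]]"

lemma valid_table5: "valid_table 4 [] table5"
  by code_simp

lemma table5_complete: "list_all (\<lambda>v. 1 # v \<in> set (map fst table5)) (sign_vectors 4)"
  by code_simp

lemma count_table5: "count_signs (compile table5) [] = 22"
  by code_simp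

lemma ascending_weights5: "ascending 5 [] weights5"
  by code_simp

lemma length_weights5: "length (concat weights5) = 22"
  by code_simp

text \<open>Pairs of opposite rules come from linear relations between vertices. For instance
  \<open>(1,0,[-1,-1,0,1])\<close> and \<open>(-1,0,[1,1,0,-1])\<close> reflect that
  \<open>[1,-1,-1,1,-1,-1]\<close> is the sum of the two rows above it minus the fourth row above
  it.\<close>

definition table6 :: "(int list \<times> rule list) list" where
  "table6 = [([1,1,1,1,1,1], [(-1,1,[])]), ([1,1,1,1,1,-1], [(-1,1,[])]),
    ([1,1,1,1,-1,1], [(-1,1,[])]), ([1,1,1,1,-1,-1], [(-2,1,[])]), ([1,1,1,-1,1,1], [(-1,1,[])]),
    ([1,1,1,-1,1,-1], [(-2,1,[])]), ([1,1,1,-1,-1,1], [(-3,1,[])]), ([1,1,-1,1,1,1], [(-1,1,[])]),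
    ([1,1,-1,1,1,-1], [(-2,1,[])]), ([1,1,-1,1,-1,1], [(-3,1,[])]), ([1,-1,1,1,1,1], [(-1,1,[])]),
    ([1,-1,1,1,1,-1], [(-2,1,[])]), ([1,-1,1,1,-1,1], [(-3,1,[])]),
    ([1,-1,-1,-1,-1,-1], [(1,1,[])]), ([1,1,1,-1,-1,-1], [(-1,0,[])]),
    ([1,1,-1,1,-1,-1], [(-3,0,[1]), (1,0,[-1])]), ([1,1,-1,-1,1,1], [(-1,0,[]), (-2,1,[0,-1])]),
    ([1,1,-1,-1,1,-1], [(-1,0,[]), (1,0,[0,0,-1]), (1,0,[-1])]),
    ([1,-1,1,1,-1,-1], [(-1,0,[-1,0,1]), (-1,0,[]), (1,0,[0,0,0,-1])]),
    ([1,-1,1,-1,1,1], [(-1,0,[]), (-1,0,[0,-1,1]), (1,0,[0,0,-1]), (-2,1,[-1])]),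
    ([1,-1,1,-1,1,-1], [(-1,0,[]), (1,0,[0,0,-1]), (1,0,[0,-1]), (1,0,[-1])]),
    ([1,1,-1,-1,-1,1], [(-1,0,[-2,0,0,1]), (1,0,[0,0,0,-1])]), ([1,-1,-1,-1,-1,1], [(2,1,[0,-1]),
    (2,1,[-1])]), ([1,-1,1,-1,-1,1], [(1,0,[0,0,-1]), (-1,0,[0,0,-1]), (-2,0,[1,0,0,0,1]),
    (1,0,[0,-1])]), ([1,-1,-1,1,1,1], [(-1,0,[-1]), (-1,0,[0,0,0,-2,1]), (-1,1,[0,2]),
    (1,0,[0,0,0,0,-1])]), ([1,-1,-1,-1,1,1], [(1,0,[0,-1]), (2,0,[-1,0,-1]), (-1,1,[0,0,2]),
    (-1,0,[0,0,0,0,0,0,-1]), (1,0,[0,0,0,0,-2,0,1])]), ([1,-1,-1,1,1,-1], [(-1,0,[0,0,-1]),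
    (1,0,[0,-1]), (-1,0,[1]), (1,0,[0,0,0,0,0,-1]), (-1,0,[1,0,-1,0,0,0,0,1])]),
    ([1,-1,-1,-1,1,-1], [(1,0,[0,-1]), (-1,0,[0,0,0,0,1]), (2,0,[-1,0,0,0,-1])]),
    ([1,-1,-1,1,-1,1], [(1,0,[0,0,0,0,-1]), (-1,0,[0,0,1]), (1,0,[0,-1]),
    (-1,0,[0,0,0,0,0,0,0,-1]), (1,0,[0,-1,0,0,-1,0,0,1])]), ([1,-1,-1,1,-1,-1], [(1,0,[-1]),
    (-1,0,[0,1]), (1,0,[0,0,-2,0,1]), (1,0,[-1,-1,0,1]), (-1,0,[1,0,1,0,-1]), (-1,0,[1,1,0,-1])]),
    ([1,-1,1,-1,-1,-1], [(-1,0,[1]), (1,0,[0,0,0,0,0,0,-1]), (1,0,[-1,1,0,0,0,0,-1]),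
    (-1,0,[0,0,0,0,0,-1]), (-1,0,[1,-1,0,0,0,0,1]), (1,0,[0,0,0,-1,0,1,-1]),
    (-1,0,[0,0,0,1,0,-1,1])]), ([1,1,-1,-1,-1,-1], [(-1,0,[1]), (1,0,[-1,0,0,0,0,0,0,1,0,-1]),
    (-1,0,[1,0,0,0,0,0,0,-1,0,1]), (1,0,[0,0,0,0,0,0,0,0,0,-1])])]"

definition weights6 :: "int list list list" where
  "weights6 = [[[1,1,1,1,1,1], [1,1,1,1,0,0], [2,2,2,2,1,1], [1,1,1,1,1,0], [4,4,3,3,3,1],
    [3,3,3,2,2,1], [5,4,4,3,3,1], [4,3,3,3,2,1], [3,2,2,2,2,1], [3,3,2,2,2,0], [2,2,2,1,1,0],
    [4,3,3,2,2,0]], [[3,2,2,2,1,0], [2,1,1,1,1,0], [3,3,2,2,2,2], [4,4,3,3,2,2], [3,3,2,2,2,1],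
    [5,5,4,3,3,2], [7,6,5,4,4,2], [6,5,4,4,3,2], [5,4,3,3,3,2], [2,2,2,1,1,1], [6,5,5,3,3,2],
    [5,4,4,3,2,2]], [[4,3,3,2,2,2], [4,3,3,2,2,1], [7,5,5,4,3,2], [6,4,4,3,3,2], [3,2,2,2,1,1],
    [5,3,3,3,2,2], [2,1,1,1,1,1], [2,2,1,1,1,1], [3,3,2,2,1,1], [5,5,3,3,3,1], [4,4,3,2,2,1],
    [6,5,4,3,3,1]], [[5,4,3,3,2,1], [4,3,2,2,2,1], [5,5,4,2,2,2], [7,6,5,3,3,2], [6,5,4,3,2,2],
    [5,4,3,2,2,2], [9,7,6,4,4,2], [8,6,5,4,3,2], [7,5,4,3,3,2], [7,5,4,4,2,2], [6,4,3,3,2,2],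
    [5,3,2,2,2,2]], [[3,3,3,1,1,1], [6,5,5,2,2,2], [5,4,4,2,2,1], [4,3,3,2,1,1], [3,2,2,1,1,1],
    [7,5,5,3,3,1], [6,4,4,3,2,1], [5,3,3,2,2,1], [8,5,5,4,2,2], [7,4,4,3,2,2], [6,3,3,2,2,2],
    [5,3,3,3,1,1]], [[4,2,2,2,1,1], [7,3,3,3,2,2], [5,2,2,2,2,1], [3,1,1,1,1,1], [3,3,1,1,1,1],
    [2,2,1,1,0,0], [4,4,2,2,1,1], [2,2,1,1,1,0], [5,5,3,2,2,1], [7,6,4,3,3,1], [6,5,3,3,2,1],
    [5,4,2,2,2,1]], [[3,3,2,1,1,0], [5,4,3,2,2,0], [4,3,2,2,1,0], [3,2,1,1,1,0], [3,3,2,1,1,1],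
    [8,7,5,3,3,2], [7,6,4,3,2,2], [6,5,3,2,2,2], [5,4,3,2,2,1], [9,7,5,4,3,2], [8,6,4,3,3,2],
    [4,3,2,2,1,1]], [[7,5,3,3,2,2], [3,2,1,1,1,1], [4,4,3,1,1,1], [7,6,5,2,2,2], [6,5,4,2,2,1],
    [5,4,3,2,1,1], [4,3,2,1,1,1], [8,6,5,3,3,1], [7,5,4,3,2,1], [6,4,3,2,2,1], [9,6,5,4,2,2],
    [8,5,4,3,2,2]], [[7,4,3,2,2,2], [6,4,3,3,1,1], [5,3,2,2,1,1], [8,4,3,3,2,2], [6,3,2,2,2,1],
    [4,2,1,1,1,1], [1,1,1,0,0,0], [5,4,4,1,1,1], [4,3,3,1,1,0], [3,2,2,1,0,0], [4,3,3,1,1,1],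
    [7,5,5,2,2,1]], [[6,4,4,2,1,1], [5,3,3,1,1,1], [3,2,2,1,1,0], [8,5,5,3,2,1], [7,4,4,2,2,1],
    [5,3,3,2,1,0], [4,2,2,1,1,0], [5,3,3,2,1,1], [9,5,5,3,2,2], [4,2,2,1,1,1], [7,4,4,3,1,1],
    [6,3,3,2,1,1]], [[9,4,4,3,2,2], [7,3,3,2,2,1], [5,2,2,1,1,1], [2,1,1,1,0,0], [7,3,3,3,1,1],
    [5,2,2,2,1,0], [5,2,2,2,1,1], [8,3,3,3,2,1], [6,2,2,2,1,1], [3,1,1,1,1,0], [7,2,2,2,2,1],
    [4,1,1,1,1,1]]]"

lemma valid_table6: "valid_table 5 [] table6"
  by code_simp

lemma table6_complete: "list_all (\<lambda>v. 1 # v \<in> set (map fst table6)) (sign_vectors 5)"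
  by code_simp

lemma count_table6: "count_signs (compile table6) [] = 132"
  by code_simp

lemma ascending_weights6: "ascending 6 [] weights6"
  by code_simp

lemma length_weights6: "length (concat weights6) = 132"
  by code_simp

text \<open>As in the smaller tables, the leading rows with a single rule \<open>(m,1,[])\<close>
  have a sign forced by balance and descent alone, so the search branches only after them.\<close>

definition table7 :: "(int list \<times> rule list) list" where
  "table7 = [([1,1,1,1,1,1,1], [(-1,1,[])]), ([1,1,1,1,1,1,-1], [(-1,1,[])]),
    ([1,1,1,1,1,-1,1], [(-1,1,[])]), ([1,1,1,1,1,-1,-1], [(-2,1,[])]),
    ([1,1,1,1,-1,1,1], [(-1,1,[])]), ([1,1,1,1,-1,1,-1], [(-2,1,[])]),
    ([1,1,1,1,-1,-1,1], [(-2,1,[])]), ([1,1,1,1,-1,-1,-1], [(-5,1,[])]),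
    ([1,1,1,-1,1,1,1], [(-1,1,[])]), ([1,1,1,-1,1,1,-1], [(-2,1,[])]),
    ([1,1,1,-1,1,-1,1], [(-2,1,[])]), ([1,1,1,-1,1,-1,-1], [(-5,1,[])]),
    ([1,1,1,-1,-1,1,1], [(-3,1,[])]), ([1,1,1,-1,-1,1,-1], [(-5,1,[])]),
    ([1,1,-1,1,1,1,1], [(-1,1,[])]), ([1,1,-1,1,1,1,-1], [(-2,1,[])]),
    ([1,1,-1,1,1,-1,1], [(-2,1,[])]), ([1,1,-1,1,1,-1,-1], [(-5,1,[])]),
    ([1,1,-1,1,-1,1,1], [(-3,1,[])]), ([1,1,-1,1,-1,1,-1], [(-5,1,[])]),
    ([1,-1,1,1,1,1,1], [(-1,1,[])]), ([1,-1,1,1,1,1,-1], [(-2,1,[])]),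
    ([1,-1,1,1,1,-1,1], [(-2,1,[])]), ([1,-1,1,1,1,-1,-1], [(-5,1,[])]),
    ([1,-1,1,1,-1,1,1], [(-3,1,[])]), ([1,-1,1,1,-1,1,-1], [(-5,1,[])]),
    ([1,-1,-1,-1,-1,-1,-1], [(1,1,[])]), ([1,1,1,-1,-1,-1,1], [(-1,0,[])]),
    ([1,1,-1,1,-1,-1,1], [(-3,0,[1]), (1,0,[-1])]), ([1,1,-1,-1,1,1,1], [(-1,0,[]),
    (-2,1,[0,-1])]), ([1,1,-1,-1,1,1,-1], [(-3,0,[1]), (1,0,[-1])]),
    ([1,1,-1,-1,1,-1,1], [(-1,0,[]), (1,0,[0,0,0,-1]), (1,0,[0,-1])]),
    ([1,-1,1,1,-1,-1,1], [(-1,0,[-1,0,0,1]), (-1,0,[]), (1,0,[0,0,0,0,-1])]),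
    ([1,-1,1,-1,1,1,1], [(-1,0,[]), (-1,0,[0,-1,0,1]), (1,0,[0,0,0,-1]), (-2,1,[-1])]),
    ([1,-1,1,-1,1,1,-1], [(-3,0,[1]), (1,0,[-1])]), ([1,-1,1,-1,1,-1,1], [(-1,0,[]),
    (1,0,[0,0,0,-1]), (1,0,[0,0,-1]), (1,0,[0,-1])]),
    ([1,1,1,-1,-1,-1,-1], [(-1,0,[-2,0,0,0,0,0,0,0,1]), (1,0,[0,0,0,0,0,0,0,0,-1])]),
    ([1,-1,1,-1,-1,-1,-1], [(1,0,[0,-2,0,1]), (2,1,[-1]), (-1,0,[0,0,0,-1])]),
    ([1,1,-1,1,-1,-1,-1], [(-2,0,[0,1,-1]), (1,0,[0,-1]), (-2,0,[1,0,0,0,0,0,0,0,0,1])]),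
    ([1,-1,-1,1,1,1,1], [(-1,0,[0,-1]), (1,0,[0,0,0,0,0,-1])]),
    ([1,-1,-1,-1,1,-1,-1], [(1,0,[0,0,-1]), (2,1,[-1])]),
    ([1,1,-1,-1,1,-1,-1], [(-2,0,[0,0,0,1,0,0,0,0,0,0,1]), (1,0,[0,0,-1]),
    (-1,0,[0,0,0,0,0,-2,0,0,0,1]), (1,0,[0,0,0,0,0,0,0,0,0,-1])]),
    ([1,-1,-1,-1,-1,1,-1], [(1,0,[0,-1])]), ([1,-1,1,-1,1,-1,-1], [(-2,0,[0,0,0,0,0,1,0,0,1]),
    (1,0,[0,-1]), (-1,0,[0,0,0,0,0,0,0,-1]), (1,0,[0,0,0,0,0,0,0,-1])]),
    ([1,-1,-1,-1,-1,-1,1], [(1,0,[0,-1])]), ([1,1,-1,-1,-1,1,1], [(-1,0,[0,0,0,0,0,0,0,1]),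
    (-1,0,[0,-1]), (-1,0,[0,-2,0,1]), (1,0,[0,0,0,0,0,0,0,0,0,0,0,0,0,-1]),
    (-2,0,[0,0,1,0,0,0,0,0,0,0,0,0,0,0,0,0,0,1]), (-1,0,[0,0,0,0,0,0,-2,0,1])]),
    ([1,-1,1,-1,-1,1,1], [(-1,0,[0,0,0,0,0,0,0,0,1]), (-1,0,[0,0,-1]), (1,0,[-1]),
    (1,0,[0,0,0,0,0,0,0,0,0,0,-1]), (-2,0,[1,0,0,0,-1]), (-2,0,[0,0,0,1,0,0,0,0,0,0,0,0,0,1])]),
    ([1,-1,1,-1,-1,1,-1], [(-2,0,[1,0,0,0,0,0,0,0,0,1]), (1,0,[0,0,0,-1]), (1,0,[-1]),
    (-1,0,[0,0,0,0,0,0,0,0,0,0,0,-1]), (1,0,[-1,0,0,-1,0,0,0,0,0,0,0,1])]),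
    ([1,-1,-1,1,-1,-1,-1], [(1,0,[0,0,0,0,0,0,0,0,0,0,-1]), (-1,0,[0,0,0,0,0,0,0,1]),
    (1,0,[0,0,0,0,0,0,0,0,-1]), (1,0,[0,0,0,0,0,0,0,0,-1,0,-1,0,0,0,1]),
    (-1,0,[0,0,0,0,0,0,0,0,0,0,0,0,0,0,-1])]), ([1,-1,1,1,-1,-1,-1], [(-1,0,[0,0,0,0,0,1]),
    (1,0,[0,0,0,0,0,0,0,0,0,0,-1]), (-1,0,[0,0,0,0,0,1,0,-1,0,0,1]),
    (1,0,[0,0,0,0,0,-1,0,1,0,0,-1]), (-1,0,[0,0,0,0,0,0,0,0,0,0,0,0,0,-2,0,0,1]),
    (1,0,[0,0,0,0,0,0,0,0,0,0,0,0,0,0,0,0,-1])]), ([1,-1,1,-1,-1,-1,1], [(1,0,[0,0,-1]),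
    (-1,0,[0,0,0,0,0,0,0,0,0,0,0,0,1]), (2,0,[0,0,0,-1,0,0,0,0,0,0,0,0,-1]),
    (-2,0,[0,0,0,0,0,1,0,0,0,0,0,0,0,0,0,0,0,1])]), ([1,-1,-1,1,1,1,-1], [(-1,0,[-1]),
    (-2,0,[0,0,1,0,0,0,0,0,0,0,0,1]), (1,0,[0,0,0,0,0,0,0,0,0,0,0,-1]),
    (-1,0,[-1,0,0,0,0,0,0,0,0,0,0,1,0,1]), (-2,0,[0,0,0,0,0,0,0,0,0,0,0,0,0,0,-1,0,0,0,0,0,0,0,1]),
    (1,0,[1,0,0,0,0,0,0,0,0,0,0,-1,0,-1])]), ([1,-1,-1,1,-1,-1,1], [(1,0,[0,-1]), (-1,0,[0,0,0,1]),
    (2,0,[-1,0,0,-1]), (-1,0,[0,1,0,1,0,0,0,0,0,0,0,0,0,0,-1]),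
    (1,0,[0,-1,0,-1,0,0,0,0,0,0,0,0,0,0,1]), (1,0,[0,0,0,0,0,0,0,0,0,0,0,0,0,-2,0,1]),
    (-1,0,[0,1,0,0,0,0,0,0,0,0,0,0,0,1,0,-1]), (-1,1,[0,0,0,0,0,0,0,1,0,0,0,1])]),
    ([1,-1,-1,-1,1,-1,1], [(1,0,[-1]), (-1,0,[0,0,0,0,0,0,0,0,0,0,0,0,1]),
    (1,0,[-1,0,0,0,1,0,0,0,0,0,0,0,-1]), (-1,0,[1,0,0,0,-1,0,0,0,0,0,0,0,1]),
    (1,0,[0,0,0,1,0,0,0,0,0,-2]), (-1,0,[1,0,0,-1,0,0,0,0,0,1]),
    (-1,1,[0,0,0,0,0,0,0,0,1,0,0,0,1])]),
    ([1,-1,-1,1,1,-1,1], [(-2,0,[0,1,0,0,0,0,0,0,0,0,0,0,0,0,1]), (-1,0,[0,0,0,0,0,0,-1]),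
    (1,0,[0,0,-1]), (-1,0,[0,0,1,1,0,0,-1]), (1,0,[0,0,0,0,0,0,0,0,0,0,0,0,0,0,0,0,0,0,-1]),
    (1,0,[0,0,-1,-1,0,0,1]), (-2,0,[0,0,0,0,0,0,0,0,0,0,0,0,0,0,0,0,0,-1,0,0,0,0,0,0,0,1])]),
    ([1,-1,-1,1,-1,1,-1], [(1,0,[0,0,0,0,0,0,0,-1]), (-1,0,[0,0,1]), (1,0,[-1]),
    (1,0,[-1,0,0,0,0,0,0,-1,0,0,0,0,0,0,0,0,0,0,0,1]), (1,0,[0,0,-1,0,1,0,0,-1]),
    (1,0,[-1,0,0,0,1,0,0,0,0,0,0,0,0,0,0,0,0,-1]), (-1,0,[0,0,1,0,-1,0,0,1]),
    (-1,0,[0,0,0,0,0,0,0,0,0,0,0,0,0,0,0,0,0,0,0,-1]), (2,0,[0,0,0,-1,0,0,-1]),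
    (-2,0,[0,0,0,1,0,0,0,0,0,0,0,0,1]), (1,0,[0,0,0,0,0,0,0,0,0,0,0,0,0,0,0,0,-2,0,1]),
    (-1,0,[0,0,0,0,0,0,0,1,0,0,0,0,0,0,0,0,1,0,-1])]), ([1,-1,-1,1,-1,1,1], [(-1,0,[1]),
    (1,0,[0,-1]), (-1,0,[0,0,0,0,0,0,0,0,0,0,0,0,-1]), (1,0,[0,0,0,0,0,0,0,0,0,-1]),
    (-1,0,[0,1,0,0,0,0,0,0,1,0,0,0,-1]), (-1,0,[1,0,0,0,0,1,0,0,0,0,0,0,0,0,0,0,0,0,-1]),
    (1,0,[-1,0,0,0,0,0,0,0,1,-1]), (1,0,[-1,0,0,0,0,-1,0,0,0,0,0,0,0,0,0,0,0,0,1]),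
    (1,0,[0,-1,0,0,0,0,0,0,-1,0,0,0,1]), (1,0,[-1,0,0,-1,0,0,0,1]), (-1,0,[0,0,0,2,0,0,0,-1]),
    (2,0,[0,0,0,-1,0,0,0,0,0,0,0,0,0,0,0,0,-1]), (-2,0,[0,0,0,0,0,0,0,0,0,0,1,0,0,0,0,0,0,0,0,-1]),
    (-1,0,[1,0,0,0,0,0,0,0,-1,1])]), ([1,-1,-1,-1,-1,1,1], [(1,0,[0,0,0,-1]),
    (-1,0,[0,0,0,0,0,0,0,0,0,0,0,0,0,0,1]), (1,0,[0,0,0,-1,0,0,0,0,0,0,0,0,0,0,-1,0,1]),
    (-1,0,[0,0,0,1,0,0,0,0,0,0,0,0,0,0,1,0,-1]), (-1,0,[0,0,0,1,0,0,0,0,0,1,0,0,0,-1]),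
    (1,0,[0,0,0,0,0,0,0,0,0,-2,0,0,0,1]), (-1,1,[0,0,0,0,0,0,0,0,0,0,0,0,1,0,1])]),
    ([1,1,-1,-1,-1,1,-1], [(-1,0,[0,0,0,0,0,0,0,0,0,0,1]),
    (1,0,[0,0,0,0,0,0,0,0,0,0,0,0,0,0,0,0,-1]), (-1,0,[0,0,0,0,0,0,0,0,0,0,1,0,0,0,-1,0,1]),
    (1,0,[0,0,0,0,0,0,0,0,0,0,-1,1,-1]), (-1,0,[0,0,0,0,0,0,0,0,0,0,1,-1,1]),
    (1,0,[0,0,0,0,0,0,0,0,0,0,-1,0,0,0,1,0,-1]), (1,0,[0,0,0,0,0,0,0,0,0,0,0,0,-1])]),
    ([1,-1,-1,-1,1,1,-1], [(1,0,[0,0,0,-1]), (-1,0,[0,0,0,0,0,1]), (1,0,[0,0,0,-1,0,-1,1]),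
    (-1,0,[0,0,0,1,0,1,-1]), (1,0,[0,0,0,0,0,0,0,0,0,1,0,0,0,0,0,-2]),
    (-1,0,[0,0,0,1,0,0,0,0,0,-1,0,0,0,0,0,1]), (-1,0,[0,0,0,0,0,0,0,0,0,0,0,0,0,0,-1,0,1,0,1])]),
    ([1,-1,-1,1,1,-1,-1], [(-1,0,[0,0,0,0,1]), (1,0,[0,0,0,0,0,0,0,0,0,0,0,0,0,0,0,0,-1]),
    (1,0,[0,0,0,0,0,-1]), (-1,0,[0,0,0,0,0,0,0,0,0,0,0,0,0,-1]),
    (1,0,[0,0,0,0,0,-1,0,0,0,1,0,0,0,0,0,0,0,0,0,0,0,0,-1]),
    (-1,0,[0,0,0,0,1,0,0,0,0,0,0,0,-1,0,0,0,1]), (1,0,[0,0,0,-1,0,0,0,0,0,0,0,0,0,1,0,0,-1]),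
    (1,0,[0,0,0,0,-1,0,0,0,0,0,0,0,1,0,0,0,-1]), (-1,0,[0,0,0,-1,1,1]),
    (-1,0,[0,0,0,0,0,1,0,0,0,-1,0,0,0,0,0,0,0,0,0,0,0,0,1]),
    (-1,0,[0,0,0,1,0,0,0,0,0,0,0,0,0,-1,0,0,1]), (1,0,[0,0,0,1,-1,-1]), (1,0,[0,0,1,0,-1,0,0,-1]),
    (-1,0,[0,0,-1,0,0,0,1,1]), (1,0,[0,0,0,0,0,-1,0,0,0,0,0,0,-1,1]),
    (-1,0,[0,0,0,0,0,1,0,0,0,0,0,0,1,-1]),
    (1,0,[0,0,0,0,0,0,0,0,0,0,0,0,0,0,0,0,0,0,0,0,0,-2,0,1]),
    (1,0,[0,0,0,0,0,0,0,0,-2,0,0,0,0,0,0,0,0,0,0,0,1]),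
    (-1,0,[0,0,0,0,0,1,0,0,1,0,0,0,0,0,0,0,0,0,0,0,-1]),
    (-1,0,[0,0,0,0,0,0,0,0,0,0,0,0,0,0,0,0,1,0,0,0,0,1,0,-1])]),
    ([1,1,-1,-1,-1,-1,1], [(-1,0,[0,0,0,0,0,0,0,0,0,0,1]), (1,0,[0,0,-1]),
    (1,0,[0,0,-1,0,0,0,0,0,0,0,-1,0,0,1]), (-1,0,[0,0,1,0,0,0,0,0,0,0,1,0,0,-1])]),
    ([1,1,-1,-1,-1,-1,-1], [(1,0,[-1]), (-1,0,[0,0,0,0,0,0,0,0,0,0,0,0,0,0,0,0,0,0,0,0,0,0,0,0,1]),
    (1,0,[-1,0,0,0,0,1,-1]), (-1,0,[1,0,0,0,0,-1,1]),
    (1,0,[-1,0,0,0,0,0,0,0,0,0,0,1,0,0,0,0,0,0,0,0,0,0,0,0,-1]),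
    (1,0,[-1,0,0,0,0,0,0,0,0,0,0,0,0,0,-1,1]),
    (-1,0,[1,0,0,0,0,0,0,0,0,0,0,-1,0,0,0,0,0,0,0,0,0,0,0,0,1]),
    (-1,0,[1,0,0,0,0,0,0,0,0,0,0,0,0,0,1,-1]), (1,0,[-1,-1,0,0,0,0,0,1]),
    (-1,0,[1,1,0,0,0,0,0,-1]), (1,0,[0,0,0,-2,0,0,0,0,0,0,0,0,0,0,0,0,1]),
    (-1,0,[1,0,0,1,0,0,0,0,0,0,0,0,0,0,0,0,-1])]), ([1,-1,-1,-1,1,1,1], [(1,0,[0,0,0,0,0,0,-1]),
    (-1,0,[0,0,0,1]), (-1,0,[0,0,0,0,0,0,0,0,0,0,0,0,0,-1]),
    (-1,0,[0,0,0,1,0,0,0,0,0,0,0,0,1,0,0,0,0,0,0,0,0,0,0,0,0,-1]),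
    (1,0,[0,0,0,0,0,0,-1,0,0,0,0,0,0,1,0,0,0,0,0,-1]),
    (-1,0,[0,0,0,0,0,0,1,0,0,0,0,0,0,-1,0,0,0,0,0,1]), (1,0,[0,0,0,-1,0,0,-1,1]),
    (-1,0,[0,0,0,1,0,0,1,-1]), (1,0,[0,0,0,-1,0,0,0,0,0,0,0,0,-1,0,0,0,0,0,0,0,0,0,0,0,0,1]),
    (-1,0,[0,0,0,1,0,0,0,0,0,0,1,0,0,0,-1]), (1,0,[0,0,0,-1,0,0,0,0,0,0,-1,0,0,0,1]),
    (1,0,[1,-1,0,-1]), (-1,0,[-1,1,0,1]), (-1,0,[0,0,0,0,0,0,0,0,0,2,0,0,0,0,0,0,0,0,0,0,0,0,-1]),
    (1,0,[0,0,0,-1,0,0,0,0,0,-1,0,0,0,0,0,0,0,0,0,0,0,0,1])])]"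

definition weights7 :: "int list list list" where
  "weights7 = [[[1,1,1,1,1,1,0], [1,1,1,1,1,1,1], [4,4,4,3,3,3,3], [6,6,5,5,4,4,4],
    [3,3,3,3,2,2,2], [5,4,4,4,3,3,3], [2,2,2,2,2,1,1], [5,5,4,4,4,3,3], [4,3,3,3,3,2,2],
    [4,4,3,3,3,3,2], [3,2,2,2,2,2,1], [3,3,2,2,2,2,2], [2,1,1,1,1,1,1], [3,3,3,2,2,2,2],
    [8,8,7,6,5,5,5], [5,5,5,4,3,3,3], [7,6,6,5,4,4,4], [7,7,6,5,5,4,4], [4,4,4,3,3,2,2],
    [6,5,5,4,4,3,3], [6,6,5,4,4,4,3], [3,3,3,2,2,2,1], [5,4,4,3,3,3,2], [5,5,4,3,3,3,3],
    [2,2,2,1,1,1,1], [4,3,3,2,2,2,2], [1,1,1,1,0,0,0], [2,2,2,2,1,1,0], [5,5,4,4,3,3,3],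
    [7,7,6,6,4,4,4], [9,8,7,7,5,5,5], [2,2,2,2,1,1,1], [6,5,5,5,3,3,3], [4,3,3,3,2,2,2],
    [3,3,3,3,2,1,1], [9,9,7,7,6,5,5], [6,6,5,5,4,3,3], [8,7,6,6,5,4,4], [7,7,6,6,4,3,3],
    [9,8,7,7,5,4,4], [11,9,8,8,6,5,5], [5,5,5,4,3,2,2], [8,7,7,6,4,3,3], [7,6,6,5,4,3,3],
    [9,7,7,6,5,4,4], [6,5,5,5,3,2,2]], [[5,4,4,4,3,2,2], [7,5,5,5,4,3,3], [8,8,6,6,5,5,4],
    [5,5,4,4,3,3,2], [7,6,5,5,4,4,3], [6,6,5,5,3,3,2], [8,7,6,6,4,4,3], [10,8,7,7,5,5,4],
    [4,4,4,3,2,2,1], [7,6,6,5,3,3,2], [6,5,5,4,3,3,2], [8,6,6,5,4,4,3], [5,4,4,4,2,2,1],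
    [4,3,3,3,2,2,1], [6,4,4,4,3,3,2], [7,7,5,5,4,4,4], [4,4,3,3,2,2,2], [6,5,4,4,3,3,3],
    [5,5,4,4,2,2,2], [7,6,5,5,3,3,3], [9,7,6,6,4,4,4], [3,3,3,2,1,1,1], [6,5,5,4,2,2,2],
    [5,4,4,3,2,2,2], [7,5,5,4,3,3,3], [4,3,3,3,1,1,1], [3,2,2,2,1,1,1], [5,3,3,3,2,2,2],
    [1,1,1,1,1,0,0], [5,5,4,4,4,1,1], [4,4,4,3,3,1,1], [6,5,5,4,4,1,1], [5,4,4,4,3,1,1],
    [4,3,3,3,3,1,1], [4,4,3,3,3,1,0], [3,3,3,2,2,1,0], [5,4,4,3,3,1,0], [4,3,3,3,2,1,0],
    [3,2,2,2,2,1,0], [3,3,2,2,2,0,0], [2,2,2,1,1,0,0], [4,3,3,2,2,0,0], [3,2,2,2,1,0,0],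
    [2,1,1,1,1,0,0], [4,4,3,3,3,2,2], [9,9,7,7,6,4,4]], [[11,10,8,8,7,5,5], [5,5,4,4,4,2,2],
    [7,7,6,5,5,3,3], [9,8,7,6,6,4,4], [7,6,5,5,5,3,3], [5,5,4,4,3,2,2], [12,11,9,9,7,5,5],
    [7,6,5,5,4,3,3], [6,6,5,5,4,2,2], [8,8,7,6,5,3,3], [11,10,9,8,6,4,4], [10,9,8,7,6,4,4],
    [12,10,9,8,7,5,5], [9,8,7,7,5,3,3], [8,7,6,6,5,3,3], [10,8,7,7,6,4,4], [4,4,3,3,3,1,1],
    [7,7,6,5,5,2,2], [9,8,7,6,6,2,2], [8,7,6,6,5,2,2], [7,6,5,5,5,2,2], [3,3,3,2,2,1,1],
    [9,8,8,6,5,3,3], [8,7,7,5,5,3,3], [6,5,5,4,3,2,2], [11,9,9,7,6,4,4], [5,4,4,3,3,2,2],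
    [8,7,7,5,5,2,2], [7,6,6,5,4,2,2], [6,5,5,4,4,2,2], [10,8,8,7,5,3,3], [9,7,7,6,5,3,3],
    [8,6,6,5,5,3,3], [5,4,4,3,3,1,1], [9,7,7,6,5,2,2], [8,6,6,5,5,2,2], [4,3,3,3,2,1,1],
    [7,5,5,5,4,2,2], [3,2,2,2,2,1,1], [7,7,5,5,5,4,3], [8,8,6,6,5,4,3], [10,9,7,7,6,5,4],
    [4,4,3,3,3,2,1], [6,6,5,4,4,3,2], [8,7,6,5,5,4,3], [6,5,4,4,4,3,2]], [[9,9,7,7,5,4,3],
    [11,10,8,8,6,5,4], [13,11,9,9,7,6,5], [5,5,4,4,3,2,1], [7,7,6,5,4,3,2], [10,9,8,7,5,4,3],
    [9,8,7,6,5,4,3], [11,9,8,7,6,5,4], [8,7,6,6,4,3,2], [7,6,5,5,4,3,2], [9,7,6,6,5,4,3],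
    [7,7,5,5,5,2,1], [6,6,5,4,4,2,1], [8,7,6,5,5,2,1], [7,6,5,5,4,2,1], [6,5,4,4,4,2,1],
    [8,8,7,5,5,3,2], [11,10,9,7,6,4,3], [10,9,8,6,6,4,3], [14,12,11,9,7,5,4], [13,11,10,8,7,5,4],
    [12,10,9,7,7,5,4], [10,9,8,6,6,3,2], [9,8,7,6,5,3,2], [8,7,6,5,5,3,2], [12,10,9,8,6,4,3],
    [11,9,8,7,6,4,3], [10,8,7,6,6,4,3], [12,10,9,7,7,3,2], [11,9,8,7,6,3,2], [10,8,7,6,6,3,2],
    [10,8,7,7,5,3,2], [9,7,6,6,5,3,2], [8,6,5,5,5,3,2], [5,5,5,3,3,2,1], [9,8,8,5,5,3,2],
    [8,7,7,5,4,3,2], [7,6,6,4,4,3,2], [11,9,9,7,5,4,3], [10,8,8,6,5,4,3], [9,7,7,5,5,4,3],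
    [7,6,6,4,4,2,1], [6,5,5,4,3,2,1], [5,4,4,3,3,2,1], [9,7,7,6,4,3,2], [8,6,6,5,4,3,2]],
    [[7,5,5,4,4,3,2], [9,7,7,5,5,2,1], [8,6,6,5,4,2,1], [7,5,5,4,4,2,1], [11,8,8,7,5,3,2],
    [10,7,7,6,5,3,2], [9,6,6,5,5,3,2], [7,5,5,5,3,2,1], [6,4,4,4,3,2,1], [8,5,5,5,4,3,2],
    [5,3,3,3,3,2,1], [6,6,4,4,4,3,3], [7,7,5,5,4,3,3], [9,8,6,6,5,4,4], [3,3,2,2,2,1,1],
    [5,5,4,3,3,2,2], [7,6,5,4,4,3,3], [5,4,3,3,3,2,2], [8,8,6,6,4,3,3], [10,9,7,7,5,4,4],
    [12,10,8,8,6,5,5], [4,4,3,3,2,1,1], [6,6,5,4,3,2,2], [9,8,7,6,4,3,3], [8,7,6,5,4,3,3],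
    [10,8,7,6,5,4,4], [7,6,5,5,3,2,2], [6,5,4,4,3,2,2], [8,6,5,5,4,3,3], [6,6,4,4,4,1,1],
    [5,5,4,3,3,1,1], [7,6,5,4,4,1,1], [6,5,4,4,3,1,1], [5,4,3,3,3,1,1], [7,7,6,4,4,2,2],
    [10,9,8,6,5,3,3], [9,8,7,5,5,3,3], [13,11,10,8,6,4,4], [12,10,9,7,6,4,4], [11,9,8,6,6,4,4],
    [9,8,7,5,5,2,2], [8,7,6,5,4,2,2], [7,6,5,4,4,2,2], [11,9,8,7,5,3,3], [10,8,7,6,5,3,3],
    [9,7,6,5,5,3,3]], [[11,9,8,6,6,2,2], [10,8,7,6,5,2,2], [9,7,6,5,5,2,2], [9,7,6,6,4,2,2],
    [8,6,5,5,4,2,2], [7,5,4,4,4,2,2], [4,4,4,2,2,1,1], [8,7,7,4,4,2,2], [7,6,6,4,3,2,2],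
    [6,5,5,3,3,2,2], [10,8,8,6,4,3,3], [9,7,7,5,4,3,3], [8,6,6,4,4,3,3], [6,5,5,3,3,1,1],
    [5,4,4,3,2,1,1], [4,3,3,2,2,1,1], [8,6,6,5,3,2,2], [7,5,5,4,3,2,2], [6,4,4,3,3,2,2],
    [8,6,6,4,4,1,1], [7,5,5,4,3,1,1], [6,4,4,3,3,1,1], [10,7,7,6,4,2,2], [9,6,6,5,4,2,2],
    [8,5,5,4,4,2,2], [6,4,4,4,2,1,1], [5,3,3,3,2,1,1], [7,4,4,4,3,2,2], [4,2,2,2,2,1,1],
    [3,3,2,2,2,2,0], [3,3,2,2,2,2,1], [7,7,5,5,4,4,2], [9,8,6,6,5,5,3], [6,6,4,4,4,3,1],
    [8,8,6,5,5,4,2], [10,9,7,6,6,5,3], [8,7,5,5,5,4,2], [5,5,4,3,3,3,1], [7,6,5,4,4,4,2],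
    [5,4,3,3,3,3,1], [4,4,3,3,2,2,0], [4,4,3,3,2,2,1], [10,9,7,7,5,5,3], [6,5,4,4,3,3,2],
    [7,7,5,5,4,3,1], [9,9,7,6,5,4,2]], [[12,11,9,8,6,5,3], [11,10,8,7,6,5,3], [13,11,9,8,7,6,4],
    [10,9,7,7,5,4,2], [9,8,6,6,5,4,2], [11,9,7,7,6,5,3], [6,6,5,4,3,3,1], [9,8,7,6,4,4,2],
    [8,7,6,5,4,4,2], [10,8,7,6,5,5,3], [7,6,5,5,3,3,1], [6,5,4,4,3,3,1], [8,6,5,5,4,4,2],
    [3,3,2,2,2,1,0], [8,8,6,5,5,3,1], [10,9,7,6,6,3,1], [9,8,6,6,5,3,1], [8,7,5,5,5,3,1],
    [5,5,4,3,3,2,0], [7,6,5,4,4,2,0], [6,5,4,4,3,2,0], [5,4,3,3,3,2,0], [5,5,4,3,3,2,1],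
    [13,12,10,8,7,5,3], [12,11,9,7,7,5,3], [8,7,6,5,4,3,2], [15,13,11,9,8,6,4], [7,6,5,4,4,3,2],
    [12,11,9,7,7,4,2], [11,10,8,7,6,4,2], [10,9,7,6,6,4,2], [14,12,10,9,7,5,3], [13,11,9,8,7,5,3],
    [12,10,8,7,7,5,3], [7,6,5,4,4,2,1], [13,11,9,8,7,4,2], [12,10,8,7,7,4,2], [6,5,4,4,3,2,1],
    [11,9,7,7,6,4,2], [5,4,3,3,3,2,1], [7,7,6,4,4,3,1], [11,10,9,6,6,4,2], [10,9,8,6,5,4,2],
    [9,8,7,5,5,4,2], [13,11,10,8,6,5,3], [12,10,9,7,6,5,3]], [[11,9,8,6,6,5,3], [9,8,7,5,5,3,1],
    [8,7,6,5,4,3,1], [7,6,5,4,4,3,1], [11,9,8,7,5,4,2], [10,8,7,6,5,4,2], [9,7,6,5,5,4,2],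
    [11,9,8,6,6,3,1], [10,8,7,6,5,3,1], [9,7,6,5,5,3,1], [13,10,9,8,6,4,2], [12,9,8,7,6,4,2],
    [11,8,7,6,6,4,2], [9,7,6,6,4,3,1], [8,6,5,5,4,3,1], [10,7,6,6,5,4,2], [7,5,4,4,4,3,1],
    [2,2,2,1,1,1,0], [8,7,7,4,4,3,1], [7,6,6,4,3,3,1], [6,5,5,3,3,3,1], [6,5,5,3,3,2,0],
    [5,4,4,3,2,2,0], [4,3,3,2,2,2,0], [6,5,5,3,3,2,1], [11,9,9,6,5,4,2], [10,8,8,5,5,4,2],
    [5,4,4,3,2,2,1], [9,7,7,5,4,4,2], [4,3,3,2,2,2,1], [10,8,8,5,5,3,1], [9,7,7,5,4,3,1],
    [8,6,6,4,4,3,1], [12,9,9,7,5,4,2], [11,8,8,6,5,4,2], [10,7,7,5,5,4,2], [8,6,6,5,3,3,1],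
    [7,5,5,4,3,3,1], [9,6,6,5,4,4,2], [6,4,4,3,3,3,1], [4,3,3,2,2,1,0], [11,8,8,6,5,3,1],
    [10,7,7,5,5,3,1], [7,5,5,4,3,2,0], [6,4,4,3,3,2,0], [7,5,5,4,3,2,1]], [[13,9,9,7,6,4,2],
    [6,4,4,3,3,2,1], [10,7,7,6,4,3,1], [9,6,6,5,4,3,1], [11,7,7,6,5,4,2], [8,5,5,4,4,3,1],
    [3,2,2,2,1,1,0], [8,5,5,5,3,3,1], [5,3,3,3,2,2,0], [5,3,3,3,2,2,1], [7,4,4,4,3,3,1],
    [2,1,1,1,1,1,0], [5,5,3,3,3,3,2], [6,6,4,4,3,3,2], [8,7,5,5,4,4,3], [5,5,3,3,3,2,1],
    [7,7,5,4,4,3,2], [9,8,6,5,5,4,3], [7,6,4,4,4,3,2], [4,4,3,2,2,2,1], [6,5,4,3,3,3,2],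
    [4,3,2,2,2,2,1], [7,7,5,5,3,3,2], [9,8,6,6,4,4,3], [11,9,7,7,5,5,4], [6,6,4,4,3,2,1],
    [8,8,6,5,4,3,2], [11,10,8,7,5,4,3], [10,9,7,6,5,4,3], [12,10,8,7,6,5,4], [9,8,6,6,4,3,2],
    [8,7,5,5,4,3,2], [10,8,6,6,5,4,3], [5,5,4,3,2,2,1], [8,7,6,5,3,3,2], [7,6,5,4,3,3,2],
    [9,7,6,5,4,4,3], [6,5,4,4,2,2,1], [5,4,3,3,2,2,1], [7,5,4,4,3,3,2], [8,8,5,5,5,2,1],
    [7,7,5,4,4,2,1], [9,8,6,5,5,2,1], [8,7,5,5,4,2,1], [7,6,4,4,4,2,1], [9,9,7,5,5,3,2]],
    [[12,11,9,7,6,4,3], [11,10,8,6,6,4,3], [15,13,11,9,7,5,4], [14,12,10,8,7,5,4],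
    [13,11,9,7,7,5,4], [11,10,8,6,6,3,2], [10,9,7,6,5,3,2], [9,8,6,5,5,3,2], [13,11,9,8,6,4,3],
    [12,10,8,7,6,4,3], [11,9,7,6,6,4,3], [13,11,9,7,7,3,2], [12,10,8,7,6,3,2], [11,9,7,6,6,3,2],
    [11,9,7,7,5,3,2], [10,8,6,6,5,3,2], [9,7,5,5,5,3,2], [6,6,5,3,3,2,1], [10,9,8,5,5,3,2],
    [9,8,7,5,4,3,2], [8,7,6,4,4,3,2], [12,10,9,7,5,4,3], [11,9,8,6,5,4,3], [10,8,7,5,5,4,3],
    [8,7,6,4,4,2,1], [7,6,5,4,3,2,1], [6,5,4,3,3,2,1], [10,8,7,6,4,3,2], [9,7,6,5,4,3,2],
    [8,6,5,4,4,3,2], [10,8,7,5,5,2,1], [9,7,6,5,4,2,1], [8,6,5,4,4,2,1], [12,9,8,7,5,3,2],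
    [11,8,7,6,5,3,2], [10,7,6,5,5,3,2], [8,6,5,5,3,2,1], [7,5,4,4,3,2,1], [9,6,5,5,4,3,2],
    [6,4,3,3,3,2,1], [7,7,6,3,3,3,1], [9,8,7,4,4,3,1], [8,7,6,4,3,3,1], [7,6,5,3,3,3,1],
    [13,11,10,6,6,4,2], [12,10,9,6,5,4,2]], [[11,9,8,5,5,4,2], [11,9,8,6,4,4,2], [10,8,7,5,4,4,2],
    [9,7,6,4,4,4,2], [11,9,8,5,5,3,1], [10,8,7,5,4,3,1], [9,7,6,4,4,3,1], [13,10,9,7,5,4,2],
    [12,9,8,6,5,4,2], [11,8,7,5,5,4,2], [9,7,6,5,3,3,1], [8,6,5,4,3,3,1], [10,7,6,5,4,4,2],
    [7,5,4,3,3,3,1], [13,10,9,6,6,3,1], [12,9,8,6,5,3,1], [11,8,7,5,5,3,1], [15,11,10,8,6,4,2],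
    [14,10,9,7,6,4,2], [13,9,8,6,6,4,2], [11,8,7,6,4,3,1], [10,7,6,5,4,3,1], [12,8,7,6,5,4,2],
    [9,6,5,4,4,3,1], [10,7,6,6,3,3,1], [9,6,5,5,3,3,1], [11,7,6,6,4,4,2], [8,5,4,4,3,3,1],
    [7,4,3,3,3,3,1], [5,5,5,2,2,2,1], [8,7,7,3,3,3,1], [7,6,6,3,3,2,1], [6,5,5,3,2,2,1],
    [5,4,4,2,2,2,1], [11,9,9,5,5,3,2], [10,8,8,5,4,3,2], [9,7,7,4,4,3,2], [9,7,7,5,3,3,2],
    [8,6,6,4,3,3,2], [7,5,5,3,3,3,2], [9,7,7,4,4,2,1], [8,6,6,4,3,2,1], [7,5,5,3,3,2,1],
    [11,8,8,6,4,3,2], [10,7,7,5,4,3,2], [9,6,6,4,4,3,2]], [[7,5,5,4,2,2,1], [6,4,4,3,2,2,1],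
    [8,5,5,4,3,3,2], [5,3,3,2,2,2,1], [11,8,8,5,5,2,1], [10,7,7,5,4,2,1], [9,6,6,4,4,2,1],
    [13,9,9,7,5,3,2], [12,8,8,6,5,3,2], [11,7,7,5,5,3,2], [9,6,6,5,3,2,1], [8,5,5,4,3,2,1],
    [10,6,6,5,4,3,2], [7,4,4,3,3,2,1], [11,7,7,6,3,3,1], [10,6,6,5,3,3,1], [12,7,7,6,4,4,2],
    [9,5,5,4,3,3,1], [8,4,4,3,3,3,1], [8,5,5,5,2,2,1], [7,4,4,4,2,2,1], [9,5,5,5,3,3,2],
    [6,3,3,3,2,2,1], [9,4,4,4,3,3,1], [7,3,3,3,3,2,1], [5,2,2,2,2,2,1], [2,2,1,1,1,1,0],
    [3,3,2,2,1,1,0], [5,5,3,3,3,1,0], [4,4,3,2,2,1,0], [6,5,4,3,3,1,0], [5,4,3,3,2,1,0],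
    [4,3,2,2,2,1,0], [5,5,4,2,2,2,0], [7,6,5,3,3,2,0], [6,5,4,3,2,2,0], [5,4,3,2,2,2,0],
    [9,7,6,4,4,2,0], [8,6,5,4,3,2,0], [7,5,4,3,3,2,0], [7,5,4,4,2,2,0], [6,4,3,3,2,2,0],
    [5,3,2,2,2,2,0], [3,3,3,1,1,1,0], [6,5,5,2,2,2,0], [5,4,4,2,2,1,0]], [[4,3,3,2,1,1,0],
    [3,2,2,1,1,1,0], [7,5,5,3,3,1,0], [6,4,4,3,2,1,0], [5,3,3,2,2,1,0], [8,5,5,4,2,2,0],
    [7,4,4,3,2,2,0], [6,3,3,2,2,2,0], [5,3,3,3,1,1,0], [4,2,2,2,1,1,0], [7,3,3,3,2,2,0],
    [5,2,2,2,2,1,0], [3,1,1,1,1,1,0], [2,2,1,1,1,1,1], [5,5,3,3,2,2,2], [7,6,4,4,3,3,3],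
    [7,7,4,4,4,2,2], [6,6,4,3,3,2,2], [8,7,5,4,4,3,3], [6,5,3,3,3,2,2], [7,7,5,3,3,3,2],
    [7,6,4,3,3,3,2], [7,5,3,3,3,3,2], [5,5,4,2,2,2,2], [5,4,3,2,2,2,2], [5,3,2,2,2,2,2],
    [3,3,2,2,1,1,1], [8,7,5,5,3,3,3], [5,4,3,3,2,2,2], [8,8,5,5,4,2,2], [7,7,5,4,3,2,2],
    [10,9,7,6,4,3,3], [9,8,6,5,4,3,3], [11,9,7,6,5,4,4], [8,7,5,5,3,2,2], [7,6,4,4,3,2,2],
    [9,7,5,5,4,3,3], [8,8,6,4,3,3,2], [9,8,6,5,3,3,2], [8,7,5,4,3,3,2], [10,8,6,5,4,4,3],
    [10,8,6,6,3,3,2], [9,7,5,5,3,3,2], [8,6,4,4,3,3,2], [6,6,5,3,2,2,2], [7,6,5,4,2,2,2]],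
    [[6,5,4,3,2,2,2], [8,6,5,4,3,3,3], [8,6,5,5,2,2,2], [7,5,4,4,2,2,2], [6,4,3,3,2,2,2],
    [5,5,3,3,3,1,1], [9,9,6,5,5,2,2], [11,10,7,6,6,2,2], [10,9,6,6,5,2,2], [9,8,5,5,5,2,2],
    [4,4,3,2,2,1,1], [11,10,8,6,5,3,3], [10,9,7,5,5,3,3], [7,6,5,4,3,2,2], [13,11,9,7,6,4,4],
    [6,5,4,3,3,2,2], [10,9,7,5,5,2,2], [9,8,6,5,4,2,2], [8,7,5,4,4,2,2], [12,10,8,7,5,3,3],
    [11,9,7,6,5,3,3], [10,8,6,5,5,3,3], [6,5,4,3,3,1,1], [11,9,7,6,5,2,2], [10,8,6,5,5,2,2],
    [5,4,3,3,2,1,1], [9,7,5,5,4,2,2], [4,3,2,2,2,1,1], [9,9,7,4,4,3,2], [11,10,8,5,5,3,2],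
    [10,9,7,5,4,3,2], [9,8,6,4,4,3,2], [13,11,9,7,5,4,3], [12,10,8,6,5,4,3], [11,9,7,5,5,4,3],
    [13,11,9,6,6,3,2], [12,10,8,6,5,3,2], [11,9,7,5,5,3,2], [11,9,7,6,4,3,2], [10,8,6,5,4,3,2],
    [9,7,5,4,4,3,2], [15,12,10,7,7,3,2], [14,11,9,7,6,3,2], [13,10,8,6,6,3,2], [13,10,8,7,5,3,2],
    [12,9,7,6,5,3,2]], [[11,8,6,5,5,3,2], [12,9,7,7,4,3,2], [11,8,6,6,4,3,2], [10,7,5,5,4,3,2],
    [9,6,4,4,4,3,2], [7,7,6,3,3,2,2], [9,8,7,4,4,2,2], [8,7,6,4,3,2,2], [7,6,5,3,3,2,2],
    [11,9,8,6,4,3,3], [10,8,7,5,4,3,3], [9,7,6,4,4,3,3], [11,9,8,5,5,2,2], [10,8,7,5,4,2,2],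
    [9,7,6,4,4,2,2], [9,7,6,5,3,2,2], [8,6,5,4,3,2,2], [7,5,4,3,3,2,2], [13,10,9,6,6,2,2],
    [12,9,8,6,5,2,2], [11,8,7,5,5,2,2], [11,8,7,6,4,2,2], [10,7,6,5,4,2,2], [9,6,5,4,4,2,2],
    [10,7,6,6,3,2,2], [9,6,5,5,3,2,2], [8,5,4,4,3,2,2], [7,4,3,3,3,2,2], [5,5,4,2,2,2,1],
    [12,11,9,5,5,4,2], [11,10,8,5,4,4,2], [10,9,7,4,4,4,2], [7,6,5,3,3,2,1], [13,11,9,6,5,4,2],
    [12,10,8,5,5,4,2], [6,5,4,3,2,2,1], [11,9,7,5,4,4,2], [5,4,3,2,2,2,1], [16,13,11,7,7,4,2],
    [15,12,10,7,6,4,2], [14,11,9,6,6,4,2], [14,11,9,7,5,4,2], [13,10,8,6,5,4,2], [12,9,7,5,5,4,2],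
    [13,10,8,7,4,4,2], [12,9,7,6,4,4,2]], [[11,8,6,5,4,4,2], [10,7,5,4,4,4,2], [9,7,6,4,4,2,1],
    [17,13,11,8,7,4,2], [16,12,10,7,7,4,2], [8,6,5,4,3,2,1], [15,11,9,7,6,4,2], [7,5,4,3,3,2,1],
    [15,11,9,8,5,4,2], [14,10,8,7,5,4,2], [13,9,7,6,5,4,2], [12,8,6,5,5,4,2], [7,5,4,4,2,2,1],
    [13,9,7,7,4,4,2], [6,4,3,3,2,2,1], [11,7,5,5,4,4,2], [5,3,2,2,2,2,1], [8,8,7,3,3,3,2],
    [11,10,9,4,4,4,2], [10,9,8,4,4,3,2], [9,8,7,4,3,3,2], [8,7,6,3,3,3,2], [12,10,9,5,5,3,2],
    [11,9,8,5,4,3,2], [10,8,7,4,4,3,2], [10,8,7,5,3,3,2], [9,7,6,4,3,3,2], [8,6,5,3,3,3,2],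
    [14,11,10,6,6,3,2], [13,10,9,6,5,3,2], [12,9,8,5,5,3,2], [12,9,8,6,4,3,2], [11,8,7,5,4,3,2],
    [10,7,6,4,4,3,2], [11,8,7,6,3,3,2], [10,7,6,5,3,3,2], [9,6,5,4,3,3,2], [8,5,4,3,3,3,2],
    [16,12,11,7,7,3,2], [15,11,10,7,6,3,2], [14,10,9,6,6,3,2], [14,10,9,7,5,3,2], [13,9,8,6,5,3,2],
    [12,8,7,5,5,3,2], [13,9,8,7,4,3,2], [12,8,7,6,4,3,2]], [[11,7,6,5,4,3,2], [10,6,5,4,4,3,2],
    [15,10,9,8,4,4,2], [14,9,8,7,4,4,2], [13,8,7,6,4,4,2], [12,7,6,5,4,4,2], [11,6,5,4,4,4,2],
    [12,8,7,7,3,3,2], [11,7,6,6,3,3,2], [10,6,5,5,3,3,2], [9,5,4,4,3,3,2], [12,6,5,5,4,4,2],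
    [10,5,4,4,4,3,2], [8,4,3,3,3,3,2], [3,3,3,1,1,1,1], [9,8,8,3,3,3,2], [8,7,7,3,3,2,2],
    [7,6,6,3,2,2,2], [6,5,5,2,2,2,2], [6,5,5,2,2,2,1], [11,9,9,4,4,3,2], [10,8,8,4,3,3,2],
    [9,7,7,3,3,3,2], [5,4,4,2,2,1,1], [9,7,7,4,3,2,2], [8,6,6,3,3,2,2], [4,3,3,2,1,1,1],
    [7,5,5,3,2,2,2], [3,2,2,1,1,1,1], [12,9,9,5,5,2,2], [11,8,8,5,4,2,2], [10,7,7,4,4,2,2],
    [10,7,7,5,3,2,2], [9,6,6,4,3,2,2], [8,5,5,3,3,2,2], [12,8,8,6,3,3,2], [11,7,7,5,3,3,2],
    [10,6,6,4,3,3,2], [9,5,5,3,3,3,2], [9,6,6,5,2,2,2], [8,5,5,4,2,2,2], [7,4,4,3,2,2,2],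
    [6,3,3,2,2,2,2], [7,5,5,3,3,1,1], [13,9,9,6,5,2,2], [12,8,8,5,5,2,2]], [[6,4,4,3,2,1,1],
    [11,7,7,5,4,2,2], [5,3,3,2,2,1,1], [14,9,9,7,4,3,2], [13,8,8,6,4,3,2], [12,7,7,5,4,3,2],
    [11,6,6,4,4,3,2], [11,7,7,6,3,2,2], [10,6,6,5,3,2,2], [9,5,5,4,3,2,2], [8,4,4,3,3,2,2],
    [8,5,5,4,2,2,1], [15,9,9,7,4,4,2], [7,4,4,3,2,2,1], [13,7,7,5,4,4,2], [6,3,3,2,2,2,1],
    [13,8,8,7,3,3,2], [12,7,7,6,3,3,2], [11,6,6,5,3,3,2], [10,5,5,4,3,3,2], [13,6,6,5,4,4,2],
    [11,5,5,4,4,3,2], [9,4,4,3,3,3,2], [5,3,3,3,1,1,1], [9,5,5,5,2,2,2], [4,2,2,2,1,1,1],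
    [11,5,5,5,3,3,2], [9,4,4,4,3,2,2], [7,3,3,3,2,2,2], [7,3,3,3,2,2,1], [12,5,5,5,4,3,2],
    [10,4,4,4,3,3,2], [5,2,2,2,2,1,1], [8,3,3,3,3,2,2], [3,1,1,1,1,1,1], [5,5,2,2,2,2,2],
    [6,6,3,3,2,2,2], [9,8,4,4,3,3,3], [4,4,2,2,2,1,1], [7,7,4,3,3,2,2], [10,9,5,4,4,3,3],
    [7,6,3,3,3,2,2], [5,5,3,2,2,2,1], [8,7,4,3,3,3,2], [5,4,2,2,2,2,1], [3,3,2,1,1,1,1]],
    [[6,5,3,2,2,2,2], [3,2,1,1,1,1,1], [7,7,4,4,2,2,2], [10,9,5,5,3,3,3], [13,11,6,6,4,4,4],
    [5,5,3,3,2,1,1], [8,8,5,4,3,2,2], [12,11,7,6,4,3,3], [11,10,6,5,4,3,3], [14,12,7,6,5,4,4],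
    [9,8,5,5,3,2,2], [8,7,4,4,3,2,2], [11,9,5,5,4,3,3], [6,6,4,3,2,2,1], [10,9,6,5,3,3,2],
    [9,8,5,4,3,3,2], [12,10,6,5,4,4,3], [7,6,4,4,2,2,1], [6,5,3,3,2,2,1], [9,7,4,4,3,3,2],
    [4,4,3,2,1,1,1], [8,7,5,4,2,2,2], [7,6,4,3,2,2,2], [10,8,5,4,3,3,3], [5,4,3,3,1,1,1],
    [4,3,2,2,1,1,1], [7,5,3,3,2,2,2], [7,7,4,4,4,1,1], [6,6,4,3,3,1,1], [8,7,5,4,4,1,1],
    [7,6,4,4,3,1,1], [6,5,3,3,3,1,1], [9,9,6,4,4,2,2], [13,12,8,6,5,3,3], [12,11,7,5,5,3,3],
    [17,15,10,8,6,4,4], [16,14,9,7,6,4,4], [15,13,8,6,6,4,4], [11,10,7,5,5,2,2], [10,9,6,5,4,2,2],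
    [9,8,5,4,4,2,2], [14,12,8,7,5,3,3], [13,11,7,6,5,3,3], [12,10,6,5,5,3,3], [13,11,8,6,6,2,2],
    [12,10,7,6,5,2,2]], [[11,9,6,5,5,2,2], [11,9,6,6,4,2,2], [10,8,5,5,4,2,2], [9,7,4,4,4,2,2],
    [7,7,5,3,3,2,1], [12,11,8,5,5,3,2], [11,10,7,5,4,3,2], [10,9,6,4,4,3,2], [15,13,9,7,5,4,3],
    [14,12,8,6,5,4,3], [13,11,7,5,5,4,3], [9,8,6,4,4,2,1], [8,7,5,4,3,2,1], [7,6,4,3,3,2,1],
    [12,10,7,6,4,3,2], [11,9,6,5,4,3,2], [10,8,5,4,4,3,2], [11,9,7,5,5,2,1], [10,8,6,5,4,2,1],
    [9,7,5,4,4,2,1], [14,11,8,7,5,3,2], [13,10,7,6,5,3,2], [12,9,6,5,5,3,2], [9,7,5,5,3,2,1],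
    [8,6,4,4,3,2,1], [11,8,5,5,4,3,2], [7,5,3,3,3,2,1], [5,5,4,2,2,1,1], [10,9,7,4,4,2,2],
    [9,8,6,4,3,2,2], [8,7,5,3,3,2,2], [13,11,8,6,4,3,3], [12,10,7,5,4,3,3], [11,9,6,4,4,3,3],
    [7,6,5,3,3,1,1], [6,5,4,3,2,1,1], [5,4,3,2,2,1,1], [10,8,6,5,3,2,2], [9,7,5,4,3,2,2],
    [8,6,4,3,3,2,2], [9,7,6,4,4,1,1], [8,6,5,4,3,1,1], [7,5,4,3,3,1,1], [12,9,7,6,4,2,2],
    [11,8,6,5,4,2,2], [10,7,5,4,4,2,2]], [[7,5,4,4,2,1,1], [6,4,3,3,2,1,1], [9,6,4,4,3,2,2],
    [5,3,2,2,2,1,1], [8,8,6,3,3,3,1], [10,9,7,4,4,3,1], [9,8,6,4,3,3,1], [8,7,5,3,3,3,1],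
    [15,13,10,6,6,4,2], [14,12,9,6,5,4,2], [13,11,8,5,5,4,2], [13,11,8,6,4,4,2], [12,10,7,5,4,4,2],
    [11,9,6,4,4,4,2], [12,10,8,5,5,3,1], [11,9,7,5,4,3,1], [10,8,6,4,4,3,1], [15,12,9,7,5,4,2],
    [14,11,8,6,5,4,2], [13,10,7,5,5,4,2], [10,8,6,5,3,3,1], [9,7,5,4,3,3,1], [12,9,6,5,4,4,2],
    [8,6,4,3,3,3,1], [14,11,9,6,6,3,1], [13,10,8,6,5,3,1], [12,9,7,5,5,3,1], [17,13,10,8,6,4,2],
    [16,12,9,7,6,4,2], [15,11,8,6,6,4,2], [12,9,7,6,4,3,1], [11,8,6,5,4,3,1], [14,10,7,6,5,4,2],
    [10,7,5,4,4,3,1], [11,8,6,6,3,3,1], [10,7,5,5,3,3,1], [13,9,6,6,4,4,2], [9,6,4,4,3,3,1],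
    [8,5,3,3,3,3,1], [6,6,5,2,2,2,1], [9,8,7,3,3,3,1], [8,7,6,3,3,2,1], [7,6,5,3,2,2,1],
    [6,5,4,2,2,2,1], [13,11,9,5,5,3,2], [12,10,8,5,4,3,2]], [[11,9,7,4,4,3,2], [11,9,7,5,3,3,2],
    [10,8,6,4,3,3,2], [9,7,5,3,3,3,2], [10,8,7,4,4,2,1], [9,7,6,4,3,2,1], [8,6,5,3,3,2,1],
    [13,10,8,6,4,3,2], [12,9,7,5,4,3,2], [11,8,6,4,4,3,2], [8,6,5,4,2,2,1], [7,5,4,3,2,2,1],
    [10,7,5,4,3,3,2], [6,4,3,2,2,2,1], [12,9,8,5,5,2,1], [11,8,7,5,4,2,1], [10,7,6,4,4,2,1],
    [15,11,9,7,5,3,2], [14,10,8,6,5,3,2], [13,9,7,5,5,3,2], [10,7,6,5,3,2,1], [9,6,5,4,3,2,1],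
    [12,8,6,5,4,3,2], [8,5,4,3,3,2,1], [12,8,7,6,3,3,1], [11,7,6,5,3,3,1], [14,9,7,6,4,4,2],
    [10,6,5,4,3,3,1], [9,5,4,3,3,3,1], [9,6,5,5,2,2,1], [8,5,4,4,2,2,1], [11,7,5,5,3,3,2],
    [7,4,3,3,2,2,1], [10,5,4,4,3,3,1], [8,4,3,3,3,2,1], [6,3,2,2,2,2,1], [7,7,6,2,2,2,2],
    [10,9,8,3,3,3,2], [9,8,7,3,3,2,2], [8,7,6,3,2,2,2], [7,6,5,2,2,2,2], [13,11,10,4,4,4,2],
    [12,10,9,4,4,3,2], [11,9,8,4,3,3,2], [10,8,7,3,3,3,2], [11,9,8,4,4,2,2]], [[10,8,7,4,3,2,2],
    [9,7,6,3,3,2,2], [9,7,6,4,2,2,2], [8,6,5,3,2,2,2], [7,5,4,2,2,2,2], [13,10,9,5,5,2,2],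
    [12,9,8,5,4,2,2], [11,8,7,4,4,2,2], [11,8,7,5,3,2,2], [10,7,6,4,3,2,2], [9,6,5,3,3,2,2],
    [13,9,8,6,3,3,2], [12,8,7,5,3,3,2], [11,7,6,4,3,3,2], [10,6,5,3,3,3,2], [10,7,6,5,2,2,2],
    [9,6,5,4,2,2,2], [8,5,4,3,2,2,2], [7,4,3,2,2,2,2], [15,11,10,6,6,2,2], [14,10,9,6,5,2,2],
    [13,9,8,5,5,2,2], [13,9,8,6,4,2,2], [12,8,7,5,4,2,2], [11,7,6,4,4,2,2], [15,10,9,7,4,3,2],
    [14,9,8,6,4,3,2], [13,8,7,5,4,3,2], [12,7,6,4,4,3,2], [12,8,7,6,3,2,2], [11,7,6,5,3,2,2],
    [10,6,5,4,3,2,2], [9,5,4,3,3,2,2], [17,11,10,8,4,4,2], [16,10,9,7,4,4,2], [15,9,8,6,4,4,2],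
    [14,8,7,5,4,4,2], [13,7,6,4,4,4,2], [14,9,8,7,3,3,2], [13,8,7,6,3,3,2], [12,7,6,5,3,3,2],
    [11,6,5,4,3,3,2], [14,7,6,5,4,4,2], [12,6,5,4,4,3,2], [10,5,4,3,3,3,2], [11,7,6,6,2,2,2]],
    [[10,6,5,5,2,2,2], [9,5,4,4,2,2,2], [12,6,5,5,3,3,2], [10,5,4,4,3,2,2], [8,4,3,3,2,2,2],
    [15,7,6,6,4,4,2], [13,6,5,5,4,3,2], [11,5,4,4,3,3,2], [11,5,4,4,4,2,2], [9,4,3,3,3,2,2],
    [7,3,2,2,2,2,2], [4,4,4,1,1,1,1], [8,7,7,2,2,2,2], [7,6,6,2,2,2,1], [6,5,5,2,2,1,1],
    [5,4,4,2,1,1,1], [4,3,3,1,1,1,1], [10,8,8,3,3,3,1], [9,7,7,3,3,2,1], [8,6,6,3,2,2,1],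
    [7,5,5,2,2,2,1], [12,9,9,4,4,2,2], [11,8,8,4,3,2,2], [10,7,7,3,3,2,2], [10,7,7,4,2,2,2],
    [9,6,6,3,2,2,2], [8,5,5,2,2,2,2], [8,6,6,3,3,1,1], [7,5,5,3,2,1,1], [6,4,4,2,2,1,1],
    [12,8,8,5,3,2,2], [11,7,7,4,3,2,2], [10,6,6,3,3,2,2], [9,6,6,4,2,2,1], [8,5,5,3,2,2,1],
    [12,7,7,4,3,3,2], [7,4,4,2,2,2,1], [6,4,4,3,1,1,1], [5,3,3,2,1,1,1], [9,5,5,3,2,2,2],
    [4,2,2,1,1,1,1], [10,7,7,4,4,1,1], [9,6,6,4,3,1,1], [8,5,5,3,3,1,1], [14,9,9,6,4,2,2],
    [13,8,8,5,4,2,2]], [[12,7,7,4,4,2,2], [11,7,7,5,3,2,1], [10,6,6,4,3,2,1], [14,8,8,5,4,3,2],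
    [9,5,5,3,3,2,1], [8,5,5,4,2,1,1], [7,4,4,3,2,1,1], [11,6,6,4,3,2,2], [6,3,3,2,2,1,1],
    [13,8,8,6,3,3,1], [12,7,7,5,3,3,1], [16,9,9,6,4,4,2], [11,6,6,4,3,3,1], [10,5,5,3,3,3,1],
    [10,6,6,5,2,2,1], [9,5,5,4,2,2,1], [13,7,7,5,3,3,2], [8,4,4,3,2,2,1], [11,5,5,4,3,3,1],
    [9,4,4,3,3,2,1], [7,3,3,2,2,2,1], [12,7,7,6,2,2,2], [11,6,6,5,2,2,2], [10,5,5,4,2,2,2],
    [13,6,6,5,3,3,2], [11,5,5,4,3,2,2], [9,4,4,3,2,2,2], [16,7,7,6,4,4,2], [14,6,6,5,4,3,2],
    [12,5,5,4,3,3,2], [12,5,5,4,4,2,2], [10,4,4,3,3,2,2], [8,3,3,2,2,2,2], [7,4,4,4,1,1,1],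
    [6,3,3,3,1,1,1], [11,5,5,5,2,2,2], [9,4,4,4,2,2,1], [7,3,3,3,2,1,1], [5,2,2,2,1,1,1],
    [12,5,5,5,3,3,1], [10,4,4,4,3,2,1], [8,3,3,3,2,2,1], [13,5,5,5,4,2,2], [11,4,4,4,3,2,2],
    [9,3,3,3,2,2,2], [8,3,3,3,3,1,1]], [[6,2,2,2,2,1,1], [10,3,3,3,3,2,2], [7,2,2,2,2,2,1],
    [4,1,1,1,1,1,1], [3,3,1,1,1,1,0], [3,3,1,1,1,1,1], [7,7,3,3,2,2,2], [10,9,4,4,3,3,3],
    [5,5,2,2,2,1,1], [8,8,4,3,3,2,2], [11,10,5,4,4,3,3], [8,7,3,3,3,2,2], [6,6,3,2,2,2,1],
    [9,8,4,3,3,3,2], [6,5,2,2,2,2,1], [4,4,2,1,1,1,1], [7,6,3,2,2,2,2], [4,3,1,1,1,1,1],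
    [2,2,1,1,0,0,0], [4,4,2,2,1,1,0], [4,4,2,2,1,1,1], [11,10,5,5,3,3,3], [7,6,3,3,2,2,2],
    [6,6,3,3,2,1,1], [9,9,5,4,3,2,2], [13,12,7,6,4,3,3], [12,11,6,5,4,3,3], [15,13,7,6,5,4,4],
    [10,9,5,5,3,2,2], [9,8,4,4,3,2,2], [12,10,5,5,4,3,3], [7,7,4,3,2,2,1], [11,10,6,5,3,3,2],
    [10,9,5,4,3,3,2], [13,11,6,5,4,4,3], [8,7,4,4,2,2,1], [7,6,3,3,2,2,1], [10,8,4,4,3,3,2],
    [5,5,3,2,1,1,1], [9,8,5,4,2,2,2], [8,7,4,3,2,2,2], [11,9,5,4,3,3,3], [6,5,3,3,1,1,1],
    [5,4,2,2,1,1,1], [8,6,3,3,2,2,2], [2,2,1,1,1,0,0]], [[7,7,4,3,3,1,1], [9,8,5,4,4,1,1],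
    [8,7,4,4,3,1,1], [7,6,3,3,3,1,1], [5,5,3,2,2,1,0], [7,6,4,3,3,1,0], [6,5,3,3,2,1,0],
    [5,4,2,2,2,1,0], [3,3,2,1,1,0,0], [5,4,3,2,2,0,0], [4,3,2,2,1,0,0], [3,2,1,1,1,0,0],
    [5,5,3,2,2,1,1], [14,13,8,6,5,3,3], [13,12,7,5,5,3,3], [9,8,5,4,3,2,2], [17,15,9,7,6,4,4],
    [8,7,4,3,3,2,2], [12,11,7,5,5,2,2], [11,10,6,5,4,2,2], [10,9,5,4,4,2,2], [15,13,8,7,5,3,3],
    [14,12,7,6,5,3,3], [13,11,6,5,5,3,3], [7,6,4,3,3,1,1], [13,11,7,6,5,2,2], [12,10,6,5,5,2,2],
    [6,5,3,3,2,1,1], [11,9,5,5,4,2,2], [5,4,2,2,2,1,1], [8,8,5,3,3,2,1], [13,12,8,5,5,3,2],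
    [12,11,7,5,4,3,2], [11,10,6,4,4,3,2], [16,14,9,7,5,4,3], [15,13,8,6,5,4,3], [14,12,7,5,5,4,3],
    [10,9,6,4,4,2,1], [9,8,5,4,3,2,1], [8,7,4,3,3,2,1], [13,11,7,6,4,3,2], [12,10,6,5,4,3,2],
    [11,9,5,4,4,3,2], [12,10,7,5,5,2,1], [11,9,6,5,4,2,1], [10,8,5,4,4,2,1]], [[15,12,8,7,5,3,2],
    [14,11,7,6,5,3,2], [13,10,6,5,5,3,2], [10,8,5,5,3,2,1], [9,7,4,4,3,2,1], [12,9,5,5,4,3,2],
    [8,6,3,3,3,2,1], [6,6,4,2,2,1,1], [11,10,7,4,4,2,2], [10,9,6,4,3,2,2], [9,8,5,3,3,2,2],
    [14,12,8,6,4,3,3], [13,11,7,5,4,3,3], [12,10,6,4,4,3,3], [8,7,5,3,3,1,1], [7,6,4,3,2,1,1],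
    [6,5,3,2,2,1,1], [11,9,6,5,3,2,2], [10,8,5,4,3,2,2], [9,7,4,3,3,2,2], [10,8,6,4,4,1,1],
    [9,7,5,4,3,1,1], [8,6,4,3,3,1,1], [13,10,7,6,4,2,2], [12,9,6,5,4,2,2], [11,8,5,4,4,2,2],
    [8,6,4,4,2,1,1], [7,5,3,3,2,1,1], [10,7,4,4,3,2,2], [6,4,2,2,2,1,1], [3,3,2,1,1,1,0],
    [11,10,7,4,4,3,1], [10,9,6,4,3,3,1], [9,8,5,3,3,3,1], [8,7,5,3,3,2,0], [7,6,4,3,2,2,0],
    [6,5,3,2,2,2,0], [8,7,5,3,3,2,1], [15,13,9,6,5,4,2], [14,12,8,5,5,4,2], [7,6,4,3,2,2,1],
    [13,11,7,5,4,4,2], [6,5,3,2,2,2,1], [13,11,8,5,5,3,1], [12,10,7,5,4,3,1], [11,9,6,4,4,3,1]],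
    [[16,13,9,7,5,4,2], [15,12,8,6,5,4,2], [14,11,7,5,5,4,2], [11,9,6,5,3,3,1], [10,8,5,4,3,3,1],
    [13,10,6,5,4,4,2], [9,7,4,3,3,3,1], [5,4,3,2,2,1,0], [14,11,8,6,5,3,1], [13,10,7,5,5,3,1],
    [9,7,5,4,3,2,0], [8,6,4,3,3,2,0], [9,7,5,4,3,2,1], [17,13,9,7,6,4,2], [8,6,4,3,3,2,1],
    [13,10,7,6,4,3,1], [12,9,6,5,4,3,1], [15,11,7,6,5,4,2], [11,8,5,4,4,3,1], [4,3,2,2,1,1,0],
    [11,8,5,5,3,3,1], [7,5,3,3,2,2,0], [7,5,3,3,2,2,1], [10,7,4,4,3,3,1], [3,2,1,1,1,1,0],
    [7,7,5,2,2,2,1], [10,9,7,3,3,3,1], [9,8,6,3,3,2,1], [8,7,5,3,2,2,1], [7,6,4,2,2,2,1],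
    [14,12,9,5,5,3,2], [13,11,8,5,4,3,2], [12,10,7,4,4,3,2], [12,10,7,5,3,3,2], [11,9,6,4,3,3,2],
    [10,8,5,3,3,3,2], [11,9,7,4,4,2,1], [10,8,6,4,3,2,1], [9,7,5,3,3,2,1], [14,11,8,6,4,3,2],
    [13,10,7,5,4,3,2], [12,9,6,4,4,3,2], [9,7,5,4,2,2,1], [8,6,4,3,2,2,1], [11,8,5,4,3,3,2],
    [7,5,3,2,2,2,1]], [[13,10,8,5,5,2,1], [12,9,7,5,4,2,1], [11,8,6,4,4,2,1], [16,12,9,7,5,3,2],
    [15,11,8,6,5,3,2], [14,10,7,5,5,3,2], [11,8,6,5,3,2,1], [10,7,5,4,3,2,1], [13,9,6,5,4,3,2],
    [9,6,4,3,3,2,1], [13,9,7,6,3,3,1], [12,8,6,5,3,3,1], [15,10,7,6,4,4,2], [11,7,5,4,3,3,1],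
    [10,6,4,3,3,3,1], [10,7,5,5,2,2,1], [9,6,4,4,2,2,1], [12,8,5,5,3,3,2], [8,5,3,3,2,2,1],
    [11,6,4,4,3,3,1], [9,5,3,3,3,2,1], [7,4,2,2,2,2,1], [4,4,3,1,1,1,0], [7,6,5,2,2,2,0],
    [6,5,4,2,2,1,0], [5,4,3,2,1,1,0], [4,3,2,1,1,1,0], [8,6,5,3,3,1,0], [7,5,4,3,2,1,0],
    [6,4,3,2,2,1,0], [9,6,5,4,2,2,0], [8,5,4,3,2,2,0], [7,4,3,2,2,2,0], [6,4,3,3,1,1,0],
    [5,3,2,2,1,1,0], [8,4,3,3,2,2,0], [6,3,2,2,2,1,0], [4,2,1,1,1,1,0], [4,4,3,1,1,1,1],
    [11,10,8,3,3,3,2], [10,9,7,3,3,2,2], [9,8,6,3,2,2,2], [8,7,5,2,2,2,2], [7,6,5,2,2,2,1],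
    [13,11,9,4,4,3,2], [12,10,8,4,3,3,2]], [[11,9,7,3,3,3,2], [6,5,4,2,2,1,1], [11,9,7,4,3,2,2],
    [10,8,6,3,3,2,2], [5,4,3,2,1,1,1], [9,7,5,3,2,2,2], [4,3,2,1,1,1,1], [14,11,9,5,5,2,2],
    [13,10,8,5,4,2,2], [12,9,7,4,4,2,2], [12,9,7,5,3,2,2], [11,8,6,4,3,2,2], [10,7,5,3,3,2,2],
    [14,10,8,6,3,3,2], [13,9,7,5,3,3,2], [12,8,6,4,3,3,2], [11,7,5,3,3,3,2], [11,8,6,5,2,2,2],
    [10,7,5,4,2,2,2], [9,6,4,3,2,2,2], [8,5,3,2,2,2,2], [8,6,5,3,3,1,1], [15,11,9,6,5,2,2],
    [14,10,8,5,5,2,2], [7,5,4,3,2,1,1], [13,9,7,5,4,2,2], [6,4,3,2,2,1,1], [16,11,9,7,4,3,2],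
    [15,10,8,6,4,3,2], [14,9,7,5,4,3,2], [13,8,6,4,4,3,2], [13,9,7,6,3,2,2], [12,8,6,5,3,2,2],
    [11,7,5,4,3,2,2], [10,6,4,3,3,2,2], [9,6,5,4,2,2,1], [17,11,9,7,4,4,2], [8,5,4,3,2,2,1],
    [15,9,7,5,4,4,2], [7,4,3,2,2,2,1], [15,10,8,7,3,3,2], [14,9,7,6,3,3,2], [13,8,6,5,3,3,2],
    [12,7,5,4,3,3,2], [15,8,6,5,4,4,2], [13,7,5,4,4,3,2]], [[11,6,4,3,3,3,2], [6,4,3,3,1,1,1],
    [11,7,5,5,2,2,2], [5,3,2,2,1,1,1], [13,7,5,5,3,3,2], [11,6,4,4,3,2,2], [9,5,3,3,2,2,2],
    [8,4,3,3,2,2,1], [14,7,5,5,4,3,2], [12,6,4,4,3,3,2], [6,3,2,2,2,1,1], [10,5,3,3,3,2,2],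
    [4,2,1,1,1,1,1], [5,5,4,1,1,1,1], [9,8,7,2,2,2,2], [8,7,6,2,2,2,1], [7,6,5,2,2,1,1],
    [6,5,4,2,1,1,1], [5,4,3,1,1,1,1], [11,9,8,3,3,3,1], [10,8,7,3,3,2,1], [9,7,6,3,2,2,1],
    [8,6,5,2,2,2,1], [13,10,9,4,4,2,2], [12,9,8,4,3,2,2], [11,8,7,3,3,2,2], [11,8,7,4,2,2,2],
    [10,7,6,3,2,2,2], [9,6,5,2,2,2,2], [9,7,6,3,3,1,1], [8,6,5,3,2,1,1], [7,5,4,2,2,1,1],
    [13,9,8,5,3,2,2], [12,8,7,4,3,2,2], [11,7,6,3,3,2,2], [10,7,6,4,2,2,1], [9,6,5,3,2,2,1],
    [13,8,7,4,3,3,2], [8,5,4,2,2,2,1], [7,5,4,3,1,1,1], [6,4,3,2,1,1,1], [10,6,5,3,2,2,2],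
    [5,3,2,1,1,1,1], [11,8,7,4,4,1,1], [10,7,6,4,3,1,1], [9,6,5,3,3,1,1]], [[15,10,9,6,4,2,2],
    [14,9,8,5,4,2,2], [13,8,7,4,4,2,2], [12,8,7,5,3,2,1], [11,7,6,4,3,2,1], [15,9,8,5,4,3,2],
    [10,6,5,3,3,2,1], [9,6,5,4,2,1,1], [8,5,4,3,2,1,1], [12,7,6,4,3,2,2], [7,4,3,2,2,1,1],
    [14,9,8,6,3,3,1], [13,8,7,5,3,3,1], [17,10,9,6,4,4,2], [12,7,6,4,3,3,1], [11,6,5,3,3,3,1],
    [11,7,6,5,2,2,1], [10,6,5,4,2,2,1], [14,8,7,5,3,3,2], [9,5,4,3,2,2,1], [12,6,5,4,3,3,1],
    [10,5,4,3,3,2,1], [8,4,3,2,2,2,1], [13,8,7,6,2,2,2], [12,7,6,5,2,2,2], [11,6,5,4,2,2,2],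
    [14,7,6,5,3,3,2], [12,6,5,4,3,2,2], [10,5,4,3,2,2,2], [17,8,7,6,4,4,2], [15,7,6,5,4,3,2],
    [13,6,5,4,3,3,2], [13,6,5,4,4,2,2], [11,5,4,3,3,2,2], [9,4,3,2,2,2,2], [8,5,4,4,1,1,1],
    [7,4,3,3,1,1,1], [12,6,5,5,2,2,2], [10,5,4,4,2,2,1], [8,4,3,3,2,1,1], [6,3,2,2,1,1,1],
    [13,6,5,5,3,3,1], [11,5,4,4,3,2,1], [9,4,3,3,2,2,1], [14,6,5,5,4,2,2], [12,5,4,4,3,2,2]],
    [[10,4,3,3,2,2,2], [9,4,3,3,3,1,1], [7,3,2,2,2,1,1], [11,4,3,3,3,2,2], [8,3,2,2,2,2,1],
    [5,2,1,1,1,1,1], [1,1,1,0,0,0,0], [6,5,5,1,1,1,1], [5,4,4,1,1,1,0], [4,3,3,1,1,0,0],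
    [3,2,2,1,0,0,0], [5,4,4,1,1,1,1], [9,7,7,2,2,2,1], [8,6,6,2,2,1,1], [7,5,5,2,1,1,1],
    [6,4,4,1,1,1,1], [4,3,3,1,1,1,0], [11,8,8,3,3,2,1], [10,7,7,3,2,2,1], [9,6,6,2,2,2,1],
    [7,5,5,2,2,1,0], [6,4,4,2,1,1,0], [5,3,3,1,1,1,0], [7,5,5,2,2,1,1], [13,9,9,4,3,2,2],
    [12,8,8,3,3,2,2], [6,4,4,2,1,1,1], [11,7,7,3,2,2,2], [5,3,3,1,1,1,1], [10,7,7,3,3,1,1],
    [9,6,6,3,2,1,1], [8,5,5,2,2,1,1], [14,9,9,5,3,2,2], [13,8,8,4,3,2,2], [12,7,7,3,3,2,2],
    [11,7,7,4,2,2,1], [10,6,6,3,2,2,1], [14,8,8,4,3,3,2], [9,5,5,2,2,2,1], [8,5,5,3,1,1,1],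
    [7,4,4,2,1,1,1], [11,6,6,3,2,2,2], [6,3,3,1,1,1,1], [3,2,2,1,1,0,0], [11,7,7,4,3,1,1],
    [10,6,6,3,3,1,1]], [[8,5,5,3,2,1,0], [7,4,4,2,2,1,0], [5,3,3,2,1,0,0], [4,2,2,1,1,0,0],
    [8,5,5,3,2,1,1], [15,9,9,5,4,2,2], [7,4,4,2,2,1,1], [13,8,8,5,3,2,1], [12,7,7,4,3,2,1],
    [16,9,9,5,4,3,2], [11,6,6,3,3,2,1], [10,6,6,4,2,1,1], [9,5,5,3,2,1,1], [13,7,7,4,3,2,2],
    [8,4,4,2,2,1,1], [5,3,3,2,1,1,0], [14,8,8,5,3,3,1], [9,5,5,3,2,2,0], [9,5,5,3,2,2,1],
    [13,7,7,4,3,3,1], [4,2,2,1,1,1,0], [12,7,7,5,2,2,1], [11,6,6,4,2,2,1], [15,8,8,5,3,3,2],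
    [10,5,5,3,2,2,1], [13,6,6,4,3,3,1], [11,5,5,3,3,2,1], [9,4,4,2,2,2,1], [7,4,4,3,1,1,0],
    [6,3,3,2,1,1,0], [9,4,4,3,2,2,0], [7,3,3,2,2,1,0], [5,2,2,1,1,1,0], [7,4,4,3,1,1,1],
    [13,7,7,5,2,2,2], [6,3,3,2,1,1,1], [15,7,7,5,3,3,2], [13,6,6,4,3,2,2], [11,5,5,3,2,2,2],
    [9,4,4,3,2,2,1], [16,7,7,5,4,3,2], [14,6,6,4,3,3,2], [7,3,3,2,2,1,1], [12,5,5,3,3,2,2],
    [5,2,2,1,1,1,1], [9,5,5,4,1,1,1]], [[8,4,4,3,1,1,1], [13,6,6,5,2,2,2], [11,5,5,4,2,2,1],
    [9,4,4,3,2,1,1], [7,3,3,2,1,1,1], [14,6,6,5,3,3,1], [12,5,5,4,3,2,1], [10,4,4,3,2,2,1],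
    [15,6,6,5,4,2,2], [13,5,5,4,3,2,2], [11,4,4,3,2,2,2], [10,4,4,3,3,1,1], [8,3,3,2,2,1,1],
    [12,4,4,3,3,2,2], [9,3,3,2,2,2,1], [6,2,2,1,1,1,1], [2,1,1,1,0,0,0], [9,4,4,4,1,1,1],
    [7,3,3,3,1,1,0], [5,2,2,2,1,0,0], [7,3,3,3,1,1,1], [12,5,5,5,2,2,1], [10,4,4,4,2,1,1],
    [8,3,3,3,1,1,1], [5,2,2,2,1,1,0], [13,5,5,5,3,2,1], [11,4,4,4,2,2,1], [8,3,3,3,2,1,0],
    [6,2,2,2,1,1,0], [8,3,3,3,2,1,1], [14,5,5,5,3,2,2], [6,2,2,2,1,1,1], [11,4,4,4,3,1,1],
    [9,3,3,3,2,1,1], [13,4,4,4,3,2,2], [10,3,3,3,2,2,1], [7,2,2,2,1,1,1], [3,1,1,1,1,0,0],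
    [10,3,3,3,3,1,1], [7,2,2,2,2,1,0], [7,2,2,2,2,1,1], [11,3,3,3,3,2,1], [8,2,2,2,2,1,1],
    [4,1,1,1,1,1,0], [9,2,2,2,2,2,1], [5,1,1,1,1,1,1]]]"

lemma valid_table7: "valid_table 6 [] table7"
  by code_simp

lemma table7_complete: "list_all (\<lambda>v. 1 # v \<in> set (map fst table7)) (sign_vectors 6)"
  by code_simp

lemma count_table7: "count_signs (compile table7) [] = 1656"
  by code_simp

lemma ascending_weights7: "ascending 7 [] weights7"
  by code_simp

lemma length_weights7: "length (concat weights7) = 1656"
  by code_simp

theorem theorem1p2:
  "card (combinatorial_type ` central_cube_sections TYPE(3)) = 2 \<and>
   card (combinatorial_type ` central_cube_sections TYPE(4)) = 6 \<and>
   card (combinatorial_type ` central_cube_sections TYPE(5)) = 23 \<and>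
   card (combinatorial_type ` central_cube_sections TYPE(6)) = 133 \<and>
   card (combinatorial_type ` central_cube_sections TYPE(7)) = 1657"
proof (intro conjI)
  show "card (combinatorial_type ` central_cube_sections TYPE(3)) = 2"
    by (rule card_combinatorial_types_eq[OF _ _ valid_table3 table3_complete _ ascending_weights3 length_weights3])
      (simp_all add: count_table3)
  show "card (combinatorial_type ` central_cube_sections TYPE(4)) = 6"
    by (rule card_combinatorial_types_eq[OF _ _ valid_table4 table4_complete _ ascending_weights4 length_weights4])
      (simp_all add: count_table4)
  show "card (combinatorial_type ` central_cube_sections TYPE(5)) = 23"
    by (rule card_combinatorial_types_eq[OF _ _ valid_table5 table5_complete _ ascending_weights5 length_weights5])
      (simp_all add: count_table5)
  show "card (combinatorial_type ` central_cube_sections TYPE(6)) = 133"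
    by (rule card_combinatorial_types_eq[OF _ _ valid_table6 table6_complete _ ascending_weights6 length_weights6])
      (simp_all add: count_table6)
  show "card (combinatorial_type ` central_cube_sections TYPE(7)) = 1657"
    by (rule card_combinatorial_types_eq[OF _ _ valid_table7 table7_complete _ ascending_weights7 length_weights7])
      (simp_all add: count_table7)
qed

end
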